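(* Let $C$ be a manifold with a pre-contact distribution $\xi_C$, line bundle $\ell=TC/\xi_C$, and characteristic foliation $\mathcal{F}$. The map $[\Phi]\colon H^1(\mathcal{F},\ell)\to H^1(\mathcal{F},N\mathcal{F})$ is injective.
   Context: Pre-contact data. For a hyperplane distribution $\xi_C$ on $C$, let $\ell:=TC/\xi_C$, let $\theta_C\in\Omega^1(C,\ell)$ be the quotient projection, and let $\omega(X,Y)=\theta_C([X,Y])$ for $X,Y\in\Gamma(\xi_C)$. $\xi_C$ is pre-contact if $\ker\omega^\flat\subset\xi_C$ has constant rank; it is then involutive and its foliation $\mathcal{F}$ is the characteristic foliation, $T\mathcal{F}=\ker\omega^\flat$. Let $N\mathcal{F}=TC/T\mathcal{F}$. Complexes. $\Omega^\bullet(\mathcal{F},E)=\Gamma(\wedge^\bullet T^*\mathcal{F}\otimes E)$, with Koszul differential $d_\nabla$ for a flat $T\mathcal{F}$-connection $\nabla$ on $E$; $H^\bullet(\mathcal{F},E)$ is its cohomology. Here $\nabla^\ell_X\theta_C(Y)=\theta_C([X,Y])$ on $\ell$, and $\nabla^{N\mathcal{F}}_X(Y\bmod T\mathcal{F})=[X,Y]\bmod T\mathcal{F}$ on $N\mathcal{F}$, for $X\in\Gamma(T\mathcal{F})$, $Y\in\mathfrak{X}(C)$. Atiyah algebroid. Sections of $D\ell\to C$ are derivations of $\ell$: $\mathbb{R}$-linear maps $\square\colon\Gamma(\ell)\to\Gamma(\ell)$ with $\square(f\lambda)=\sigma(\square)(f)\lambda+f\square\lambda$ for a unique vector field $\sigma(\square)$.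 $D\ell$ is a Lie algebroid with commutator bracket and anchor the symbol $\sigma\colon D\ell\to TC$; it acts tautologically on $\ell$, giving the Koszul differential $d_D$ on $\Omega^\bullet_D(\ell):=\Gamma(\wedge^\bullet(D\ell)^*\otimes\ell)$. Put $\varpi:=d_D(\sigma^*\theta_C)$, $\varpi^\flat\colon D\ell\to(D\ell)^*\otimes\ell$, $K:=\ker\varpi^\flat$, a Lie subalgebroid which $\sigma$ maps isomorphically onto $T\mathcal{F}$. For a complement $TC=T\mathcal{F}\oplus G$, let $\widetilde G:=\sigma^{-1}(G)$, so $D\ell=K\oplus\widetilde G$ with projection $\mathrm{pr}_K$; $\varpi^\flat$ restricts to an isomorphism $\varpi^\flat|_{\widetilde G}\colon\widetilde G\to\widetilde G^*\otimes\ell$. The map $\Phi_G\colon\Omega^\bullet(\mathcal{F},\ell)\to\Omega^\bullet(\mathcal{F},N\mathcal{F})$ is defined by $$\langle\beta,\Phi_G(\eta)(\sigma(\Delta_1),\ldots,\sigma(\Delta_n))\rangle=d_D(\mathrm{pr}_K^*\sigma^*\eta)\big(\Delta_1,\ldots,\Delta_n,(\varpi^\flat|_{\widetilde G})^{-1}(\sigma^*\beta)\big)$$ for $\eta\in\Omega^n(\mathcal{F},\ell)$, $\beta\in\Gamma(N^*\mathcal{F}\otimes\ell)$, $\Delta_i\in\Gamma(K)$, where $N^*\mathcal{F}\otimes\ell\simeq G^*\otimes\ell$. It is a chain map $(\Omega^\bullet(\mathcal{F},\ell),d_{\nabla^\ell})\to(\Omega^\bullet(\mathcal{F},N\mathcal{F}),-d_{\nabla^{N\mathcal{F}}})$,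 and the induced map in cohomology, denoted $[\Phi]$, does not depend on $G$. *)

theory Defs
  imports "HOL-Analysis.Analysis" "HOL-Library.Function_Algebras"
begin

section \<open>Linear preliminaries\<close>

text \<open>Functions with values in a real vector space form a real vector space (pointwise).  This is
  used for tangent vectors (functionals), sections, derivations and forms.\<close>

instantiation "fun" :: (type, real_vector) real_vector
begin
definition scaleR_fun :: "real \<Rightarrow> ('a \<Rightarrow> 'b) \<Rightarrow> 'a \<Rightarrow> 'b" where
  "scaleR_fun c f = (\<lambda>x. c *\<^sub>R f x)"
instance
  by standard (auto simp: scaleR_fun_def plus_fun_def scaleR_add_right scaleR_add_left)
end

text \<open>The class of \<open>v\<close> modulo a subspace \<open>W\<close>, realised as evaluation at \<open>v\<close> on the annihilator
  of \<open>W\<close>.  The two lemmas show that \<open>quot W\<close> is linear with kernel \<open>W\<close>, so \<open>quot W ` V\<close> is the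
  quotient \<open>V / W\<close>.  The point of this model is that classes are elements of a type of class
  \<open>real_vector\<close>, which cosets are not.\<close>

definition quot :: "'v::real_vector set \<Rightarrow> 'v \<Rightarrow> ('v \<Rightarrow> real) \<Rightarrow> real" where
  "quot W v = (\<lambda>\<alpha>. if linear \<alpha> \<and> (\<forall>w\<in>W. \<alpha> w = 0) then \<alpha> v else 0)"

lemma linear_quot: "linear (quot W)"
  by (rule linearI) (auto simp: quot_def fun_eq_iff plus_fun_def scaleR_fun_def linear_add linear_scale)

lemma quot_eq_iff:
  assumes "subspace W"
  shows "quot W u = quot W v \<longleftrightarrow> u - v \<in> W"
proof
  assume d: "u - v \<in> W"
  have "\<alpha> u = \<alpha> v" if "linear \<alpha>" "\<forall>w\<in>W. \<alpha> w = 0" for \<alpha> :: "'a \<Rightarrow> real"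
    using that d linear_diff[of \<alpha> u v] by auto
  then show "quot W u = quot W v"
    by (auto simp: quot_def fun_eq_iff)
next
  assume eq: "quot W u = quot W v"
  show "u - v \<in> W"
  proof (rule ccontr)
    assume n: "u - v \<notin> W"
    obtain B where B: "B \<subseteq> W" "independent B" "W \<subseteq> span B"
      using basis_exists[of W] by metis
    have sp: "span B = W"
      using B assms by (metis span_minimal subset_antisym)
    have "independent (insert (u - v) B)"
      using B n sp by (simp add: independent_insert)
    then obtain \<alpha> :: "'a \<Rightarrow> real" where
      \<alpha>: "linear \<alpha>" "\<forall>x\<in>insert (u - v) B. \<alpha> x = (if x = u - v then 1 else 0)"
      using linear_independent_extend[of "insert (u - v) B" "\<lambda>x. if x = u - v then 1 else 0"]
      by metis
    have "\<alpha> b = 0" if "b \<in> B" for b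
      using \<alpha>(2) that B(1) n by auto
    then have "\<forall>w\<in>W. \<alpha> w = 0"
      using linear_eq_0_on_span[OF \<alpha>(1), of B] sp by auto
    then have "\<alpha> u = \<alpha> v"
      using fun_cong[OF eq, of \<alpha>] \<alpha>(1) by (simp add: quot_def)
    moreover have "\<alpha> (u - v) = 1"
      using \<alpha>(2) by simp
    ultimately show False
      using linear_diff[OF \<alpha>(1), of u v] by simp
  qed
qed

section \<open>Smooth manifolds\<close>

primrec Ck_on :: "nat \<Rightarrow> 'e::euclidean_space set \<Rightarrow> ('e \<Rightarrow> 'f::real_normed_vector) \<Rightarrow> bool" where
  "Ck_on 0 S f \<longleftrightarrow> continuous_on S f"
| "Ck_on (Suc k) S f \<longleftrightarrow>
     (\<forall>x\<in>S. f differentiable (at x)) \<and> (\<forall>v. Ck_on k S (\<lambda>x. frechet_derivative f (at x) v))"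

text \<open>Only used for open \<open>S\<close>.\<close>

definition smooth_on :: "'e::euclidean_space set \<Rightarrow> ('e \<Rightarrow> 'f::real_normed_vector) \<Rightarrow> bool" where
  "smooth_on S f \<longleftrightarrow> (\<forall>k. Ck_on k S f)"

type_synonym ('c, 'e) atlas = "('c set \<times> ('c \<Rightarrow> 'e)) set"
type_synonym 'c tvec = "('c \<Rightarrow> real) \<Rightarrow> real"
type_synonym 'c qvec = "('c tvec \<Rightarrow> real) \<Rightarrow> real"
type_synonym 'c vfield = "'c \<Rightarrow> 'c tvec"
type_synonym 'c qsec = "'c \<Rightarrow> 'c qvec"
type_synonym 'c deriv = "'c qsec \<Rightarrow> 'c qsec"

definition fscale :: "('c \<Rightarrow> real) \<Rightarrow> ('c \<Rightarrow> 'v::real_vector) \<Rightarrow> 'c \<Rightarrow> 'v" (infixr "\<cdot>" 75) where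
  "f \<cdot> s = (\<lambda>p. f p *\<^sub>R s p)"

locale smooth_manifold =
  fixes A :: "('c::{t2_space, second_countable_topology}, 'e::euclidean_space) atlas"
  assumes chart: "(U, \<phi>) \<in> A \<Longrightarrow>
      open U \<and> open (\<phi> ` U) \<and> homeomorphism U (\<phi> ` U) \<phi> (inv_into U \<phi>)"
    and cover: "(\<Union>(U, \<phi>)\<in>A. U) = UNIV"
    and compatible: "(U, \<phi>) \<in> A \<Longrightarrow> (V, \<psi>) \<in> A \<Longrightarrow> smooth_on (\<phi> ` (U \<inter> V)) (\<psi> \<circ> inv_into U \<phi>)"
begin

definition Cinf :: "('c \<Rightarrow> real) set" where
  "Cinf = {f. \<forall>(U, \<phi>)\<in>A. smooth_on (\<phi> ` U) (f \<circ> inv_into U \<phi>)}"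

text \<open>Tangent vectors at \<open>p\<close> are the derivations at \<open>p\<close> of \<open>Cinf\<close>.  Here and below, maps defined on
  a set of functions or sections only are normalised to be \<open>0\<close> elsewhere, so that equality
  of maps is equality on the intended domain.\<close>

definition tangent :: "'c \<Rightarrow> 'c tvec set" where
  "tangent p = {v.
     (\<forall>f\<in>Cinf. \<forall>g\<in>Cinf. v (f + g) = v f + v g) \<and>
     (\<forall>c. \<forall>f\<in>Cinf. v (c *\<^sub>R f) = c * v f) \<and>
     (\<forall>f\<in>Cinf. \<forall>g\<in>Cinf. v (f * g) = v f * g p + f p * v g) \<and>
     (\<forall>f. f \<notin> Cinf \<longrightarrow> v f = 0)}"

definition vfields :: "'c vfield set" where
  "vfields = {X. (\<forall>p. X p \<in> tangent p) \<and> (\<forall>f\<in>Cinf. (\<lambda>p. X p f) \<in> Cinf)}"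

definition bracket :: "'c vfield \<Rightarrow> 'c vfield \<Rightarrow> 'c vfield" where
  "bracket X Y = (\<lambda>p f. X p (\<lambda>q. Y q f) - Y p (\<lambda>q. X q f))"

text \<open>Smooth subbundles of the tangent bundle.  The local frames are taken to be restrictions
  of global vector fields, which is no loss since local frames can be cut off.\<close>

definition subbundle :: "('c \<Rightarrow> 'c tvec set) \<Rightarrow> bool" where
  "subbundle W \<longleftrightarrow> (\<forall>p. \<exists>U B. open U \<and> p \<in> U \<and> finite B \<and> B \<subseteq> vfields \<and>
     (\<forall>q\<in>U. inj_on (\<lambda>X. X q) B \<and> independent ((\<lambda>X. X q) ` B) \<and> span ((\<lambda>X. X q) ` B) = W q))"

definition hyperplane_distribution :: "('c \<Rightarrow> 'c tvec set) \<Rightarrow> bool" where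
  "hyperplane_distribution W \<longleftrightarrow> subbundle W \<and>
     (\<forall>p. \<exists>v\<in>tangent p. v \<notin> W p \<and> tangent p = span (insert v (W p)))"

definition secs :: "('c \<Rightarrow> 'c tvec set) \<Rightarrow> 'c vfield set" where
  "secs W = {X \<in> vfields. \<forall>p. X p \<in> W p}"

text \<open>The projection \<open>X \<mapsto> X mod W\<close> and the sections of the quotient bundle \<open>TC/W\<close>.  By paracompactness
  every smooth section of \<open>TC/W\<close> is the class of a global vector field.\<close>

definition cls :: "('c \<Rightarrow> 'c tvec set) \<Rightarrow> 'c vfield \<Rightarrow> 'c qsec" where
  "cls W X = (\<lambda>p. quot (W p) (X p))"

definition qsecs :: "('c \<Rightarrow> 'c tvec set) \<Rightarrow> 'c qsec set" where
  "qsecs W = cls W ` vfields"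

text \<open>The \<open>Cinf\<close>-linear maps between modules of sections, i.e. the sections of \<open>Hom(E, E')\<close> if
  \<open>M = \<Gamma>(E)\<close> and \<open>N = \<Gamma>(E')\<close>.\<close>

definition bundle_hom :: "('c \<Rightarrow> 'u::real_vector) set \<Rightarrow> ('c \<Rightarrow> 'v::real_vector) set
    \<Rightarrow> (('c \<Rightarrow> 'u) \<Rightarrow> 'c \<Rightarrow> 'v) set" where
  "bundle_hom M N = {h.
     (\<forall>s\<in>M. h s \<in> N) \<and> (\<forall>s. s \<notin> M \<longrightarrow> h s = 0) \<and>
     (\<forall>s\<in>M. \<forall>t\<in>M. h (s + t) = h s + h t) \<and>
     (\<forall>f\<in>Cinf. \<forall>s\<in>M. h (f \<cdot> s) = f \<cdot> h s)}"

end

section \<open>Pre-contact distributions\<close>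

locale hyperplane_manifold = smooth_manifold A
  for A :: "('c::{t2_space, second_countable_topology}, 'e::euclidean_space) atlas" +
  fixes \<xi> :: "'c \<Rightarrow> 'c tvec set"
  assumes hyperplane: "hyperplane_distribution \<xi>"
begin

abbreviation \<theta> :: "'c vfield \<Rightarrow> 'c qsec" where "\<theta> \<equiv> cls \<xi>"
abbreviation \<Gamma>L :: "'c qsec set" where "\<Gamma>L \<equiv> qsecs \<xi>"

definition \<omega> :: "'c vfield \<Rightarrow> 'c vfield \<Rightarrow> 'c qsec" where
  "\<omega> X Y = \<theta> (bracket X Y)"

text \<open>The kernel of \<open>\<omega>\<close> at \<open>p\<close>; since \<open>\<omega>\<close> is \<open>Cinf\<close>-bilinear on \<open>\<Gamma>(\<xi>)\<close>, the value of \<open>\<omega> X Y\<close> at \<open>p\<close>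
  depends on \<open>X p\<close> and \<open>Y p\<close> only, and each vector of \<open>\<xi> p\<close> is the value of some section.\<close>

definition TF :: "'c \<Rightarrow> 'c tvec set" where
  "TF p = {X p | X. X \<in> secs \<xi> \<and> (\<forall>Y\<in>secs \<xi>. \<omega> X Y p = 0)}"

abbreviation \<Gamma>TF :: "'c vfield set" where "\<Gamma>TF \<equiv> secs TF"
abbreviation \<Gamma>NF :: "'c qsec set" where "\<Gamma>NF \<equiv> qsecs TF"

subsection \<open>Foliated cohomology\<close>

text \<open>The flat connection \<open>\<nabla>\<^sub>X (Y mod W) = [X, Y] mod W\<close> on \<open>TC/W\<close> along \<open>X \<in> \<Gamma>(TF)\<close>, used for
  \<open>W = \<xi>\<close> (the bundle \<open>\<ell>\<close>) and for \<open>W = TF\<close> (the bundle \<open>NF\<close>).\<close>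

definition nabla :: "('c \<Rightarrow> 'c tvec set) \<Rightarrow> 'c vfield \<Rightarrow> 'c qsec \<Rightarrow> 'c qsec" where
  "nabla W X s = (THE t. \<exists>Y\<in>vfields. s = cls W Y \<and> t = cls W (bracket X Y))"

text \<open>\<open>\<Omega>\<^sup>1(\<F>, TC/W)\<close> and the Koszul differential on forms of degree \<open>0\<close> and \<open>1\<close>.\<close>

definition Omega1 :: "('c \<Rightarrow> 'c tvec set) \<Rightarrow> ('c vfield \<Rightarrow> 'c qsec) set" where
  "Omega1 W = bundle_hom \<Gamma>TF (qsecs W)"

definition d0 :: "('c \<Rightarrow> 'c tvec set) \<Rightarrow> 'c qsec \<Rightarrow> 'c vfield \<Rightarrow> 'c qsec" where
  "d0 W s = (\<lambda>X. if X \<in> \<Gamma>TF then nabla W X s else 0)"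

definition d1 :: "('c \<Rightarrow> 'c tvec set) \<Rightarrow> ('c vfield \<Rightarrow> 'c qsec) \<Rightarrow> 'c vfield \<Rightarrow> 'c vfield \<Rightarrow> 'c qsec" where
  "d1 W \<eta> X Y = nabla W X (\<eta> Y) - nabla W Y (\<eta> X) - \<eta> (bracket X Y)"

definition Z1 :: "('c \<Rightarrow> 'c tvec set) \<Rightarrow> ('c vfield \<Rightarrow> 'c qsec) set" where
  "Z1 W = {\<eta> \<in> Omega1 W. \<forall>X\<in>\<Gamma>TF. \<forall>Y\<in>\<Gamma>TF. d1 W \<eta> X Y = 0}"

definition B1 :: "('c \<Rightarrow> 'c tvec set) \<Rightarrow> ('c vfield \<Rightarrow> 'c qsec) set" where
  "B1 W = d0 W ` qsecs W"

definition cohomology_class ::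
  "('c \<Rightarrow> 'c tvec set) \<Rightarrow> ('c vfield \<Rightarrow> 'c qsec) \<Rightarrow> ('c vfield \<Rightarrow> 'c qsec) set" where
  "cohomology_class W \<eta> = {\<eta>'. \<eta>' - \<eta> \<in> B1 W}"

definition H1 :: "('c \<Rightarrow> 'c tvec set) \<Rightarrow> ('c vfield \<Rightarrow> 'c qsec) set set" where
  "H1 W = cohomology_class W ` Z1 W"

text \<open>\<open>H\<^sup>1(\<F>, \<ell>)\<close>; correspondingly \<open>H1 TF\<close> is \<open>H\<^sup>1(\<F>, NF)\<close>.  As \<open>d\<close> and \<open>- d\<close> have the same kernel and image,
  the sign in the target complex of \<open>\<Phi>\<close> is immaterial here.\<close>

definition H1_line :: "('c vfield \<Rightarrow> 'c qsec) set set" where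
  "H1_line = H1 \<xi>"

subsection \<open>The Atiyah algebroid of \<open>\<ell>\<close>\<close>

text \<open>Sections of \<open>D\<ell>\<close> are maps on \<open>\<Gamma>(\<ell>)\<close>, and forms on \<open>D\<ell>\<close> are given by their values on sections.\<close>

definition symbol_rel :: "'c deriv \<Rightarrow> 'c vfield \<Rightarrow> bool" where
  "symbol_rel \<Delta> X \<longleftrightarrow> X \<in> vfields \<and>
     (\<forall>f\<in>Cinf. \<forall>s\<in>\<Gamma>L. \<Delta> (f \<cdot> s) = (\<lambda>p. X p f) \<cdot> s + f \<cdot> \<Delta> s)"

definition \<Gamma>D :: "'c deriv set" where
  "\<Gamma>D = {\<Delta>.
     (\<forall>s\<in>\<Gamma>L. \<Delta> s \<in> \<Gamma>L) \<and> (\<forall>s. s \<notin> \<Gamma>L \<longrightarrow> \<Delta> s = 0) \<and>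
     (\<forall>s\<in>\<Gamma>L. \<forall>t\<in>\<Gamma>L. \<Delta> (s + t) = \<Delta> s + \<Delta> t) \<and>
     (\<forall>c. \<forall>s\<in>\<Gamma>L. \<Delta> (c *\<^sub>R s) = c *\<^sub>R \<Delta> s) \<and>
     (\<exists>X. symbol_rel \<Delta> X)}"

definition \<sigma> :: "'c deriv \<Rightarrow> 'c vfield" where
  "\<sigma> \<Delta> = (THE X. symbol_rel \<Delta> X)"

definition comm :: "'c deriv \<Rightarrow> 'c deriv \<Rightarrow> 'c deriv" where
  "comm \<Delta> \<Delta>' = (\<Delta> \<circ> \<Delta>') - (\<Delta>' \<circ> \<Delta>)"

definition dD :: "('c deriv \<Rightarrow> 'c qsec) \<Rightarrow> 'c deriv \<Rightarrow> 'c deriv \<Rightarrow> 'c qsec" where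
  "dD \<zeta> \<Delta> \<Delta>' = \<Delta> (\<zeta> \<Delta>') - \<Delta>' (\<zeta> \<Delta>) - \<zeta> (comm \<Delta> \<Delta>')"

definition varpi :: "'c deriv \<Rightarrow> 'c deriv \<Rightarrow> 'c qsec" where
  "varpi = dD (\<lambda>\<Delta>. \<theta> (\<sigma> \<Delta>))"

definition \<Gamma>K :: "'c deriv set" where
  "\<Gamma>K = {\<Delta>\<in>\<Gamma>D. \<forall>\<Delta>'\<in>\<Gamma>D. varpi \<Delta> \<Delta>' = 0}"

subsection \<open>The map \<open>\<Phi>\<close> in degree one\<close>

definition complement :: "('c \<Rightarrow> 'c tvec set) \<Rightarrow> bool" where
  "complement G \<longleftrightarrow> subbundle G \<and>
     (\<forall>p. TF p \<inter> G p = {0} \<and> tangent p = {a + b | a b. a \<in> TF p \<and> b \<in> G p})"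

definition \<Gamma>Gt :: "('c \<Rightarrow> 'c tvec set) \<Rightarrow> 'c deriv set" where
  "\<Gamma>Gt G = {\<Delta>\<in>\<Gamma>D. \<sigma> \<Delta> \<in> secs G}"

definition prK :: "('c \<Rightarrow> 'c tvec set) \<Rightarrow> 'c deriv \<Rightarrow> 'c deriv" where
  "prK G \<Delta> = (THE \<Delta>'. \<Delta>' \<in> \<Gamma>K \<and> \<Delta> - \<Delta>' \<in> \<Gamma>Gt G)"

definition varpi_flat :: "('c \<Rightarrow> 'c tvec set) \<Rightarrow> 'c deriv \<Rightarrow> 'c deriv \<Rightarrow> 'c qsec" where
  "varpi_flat G \<Delta> = (\<lambda>\<Delta>'. if \<Delta>' \<in> \<Gamma>Gt G then varpi \<Delta> \<Delta>' else 0)"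

text \<open>\<open>\<sigma>\<^sup>*\<beta>\<close> for a section \<open>\<beta>\<close> of \<open>N\<^sup>*F \<otimes> \<ell> = Hom(NF, \<ell>)\<close>, as a form on \<open>\<sigma>\<inverse>(G)\<close>; it uses the isomorphism
  \<open>G \<simeq> NF\<close> given by the projection.\<close>

definition symbol_pullback ::
  "('c \<Rightarrow> 'c tvec set) \<Rightarrow> ('c qsec \<Rightarrow> 'c qsec) \<Rightarrow> 'c deriv \<Rightarrow> 'c qsec" where
  "symbol_pullback G \<beta> = (\<lambda>\<Delta>'. if \<Delta>' \<in> \<Gamma>Gt G then \<beta> (cls TF (\<sigma> \<Delta>')) else 0)"

definition sharp :: "('c \<Rightarrow> 'c tvec set) \<Rightarrow> ('c qsec \<Rightarrow> 'c qsec) \<Rightarrow> 'c deriv" where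
  "sharp G \<beta> = inv_into (\<Gamma>Gt G) (varpi_flat G) (symbol_pullback G \<beta>)"

definition \<Phi> :: "('c \<Rightarrow> 'c tvec set) \<Rightarrow> ('c vfield \<Rightarrow> 'c qsec) \<Rightarrow> 'c vfield \<Rightarrow> 'c qsec" where
  "\<Phi> G \<eta> = (THE \<phi>. \<phi> \<in> Omega1 TF \<and>
     (\<forall>\<beta>\<in>bundle_hom \<Gamma>NF \<Gamma>L. \<forall>\<Delta>\<in>\<Gamma>K.
        \<beta> (\<phi> (\<sigma> \<Delta>)) = dD (\<lambda>\<Delta>'. \<eta> (\<sigma> (prK G \<Delta>'))) \<Delta> (sharp G \<beta>)))"

text \<open>The induced map: the union is over equal classes, because \<open>\<Phi> G\<close> is a chain map up to sign.\<close>

definition Phi_cohomology :: "('c \<Rightarrow> 'c tvec set) \<Rightarrow>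
    ('c vfield \<Rightarrow> 'c qsec) set \<Rightarrow> ('c vfield \<Rightarrow> 'c qsec) set" where
  "Phi_cohomology G c = (\<Union>\<eta>\<in>c. cohomology_class TF (\<Phi> G \<eta>))"

end

locale precontact_manifold = hyperplane_manifold A \<xi>
  for A :: "('c::{t2_space, second_countable_topology}, 'e::euclidean_space) atlas"
    and \<xi> :: "'c \<Rightarrow> 'c tvec set" +
  assumes constant_rank: "\<exists>k. \<forall>p. dim (TF p) = k"

end

theory Submission
  imports Defs
begin

text \<open>
  The projection \<open>NF \<rightarrow> \<ell>\<close> induced by \<open>\<theta>\<close> is a section \<open>\<beta>\<close> of \<open>N\<^sup>*F \<otimes> \<ell>\<close>, and the derivation that
  \<open>\<varpi>\<close> associates with \<open>\<sigma>\<^sup>*\<beta>\<close> is the identity of \<open>\<Gamma>(\<ell>)\<close>: its symbol lies in the reduced distribution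
  \<open>\<xi> \<inter> G\<close>, on which \<open>\<omega>\<close> is nondegenerate, and is \<open>\<omega>\<close>-orthogonal to it.  Hence the composition of
  \<open>\<Phi>\<close> with \<open>NF \<rightarrow> \<ell>\<close> is minus the identity on forms, and since \<open>NF \<rightarrow> \<ell>\<close> intertwines the flat
  connections, \<open>\<Phi>\<close> has a left inverse in cohomology.

  The work lies in the existence of the objects defined by \<open>THE\<close> and \<open>inv_into\<close>, that is, in the
  \<open>\<omega>\<close>-duality on sections of \<open>\<xi> \<inter> G\<close>.  The duals are pointwise unique, so smoothness is local; it is
  proved by exhibiting, for each point, a smooth multiple by a function not vanishing there.  In
  this way bump functions suffice in place of partitions of unity.
\<close>

text \<open>The minus sign comes from \<open>dD\<close>. In \<open>dD \<zeta> \<Delta> S\<close>,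
  with \<open>\<zeta>\<close> pulled back along the projection to \<open>K\<close> and
  \<open>S\<close> the identity, the terms with \<open>\<zeta> S\<close> and
  \<open>\<zeta> (comm \<Delta> S)\<close> vanish because both arguments have symbol zero;
  \<open>- S (\<zeta> \<Delta>)\<close> remains. The obstacle is that frames are given for
  \<open>\<xi>\<close> and \<open>G\<close>, whereas \<open>TF\<close> is described through its
  sections. The component of a vector field along \<open>TF\<close> is therefore found indirectly: a
  frame of \<open>G\<close>, corrected by one transversal field, gives a frame of
  \<open>\<xi> \<inter> G\<close>; duality there splits \<open>\<xi>\<close>, and then the tangent
  bundle. Relations of the form \<open>c \<cdot> u = g\<close> are stated on the whole manifold,
  with \<open>c\<close> allowed to vanish away from the given point. So every section is global, and
  sections over open subsets need no representation. Derivations with prescribed symbol are likewise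
  constructed up to such a factor. The form in the definition of \<open>\<Phi>\<close> is unique
  because Hom(NF, \<ell>) separates \<open>\<Gamma>NF\<close>; it exists because the prescribed
  functional is evaluation at an explicit section.\<close>

section \<open>Smooth functions on Euclidean spaces\<close>

lemma Ck_on_cong:
  assumes "open S" "\<And>x. x \<in> S \<Longrightarrow> f x = g x" "Ck_on k S f"
  shows "Ck_on k S g"
  using assms
proof (induction k arbitrary: f g)
  case 0
  then show ?case by (metis Ck_on.simps(1) continuous_on_cong)
next
  case (Suc k)
  have d: "(g has_derivative frechet_derivative f (at x)) (at x)" if "x \<in> S" for x
  proof -
    have "(f has_derivative frechet_derivative f (at x)) (at x)"
      using Suc.prems(3) that frechet_derivative_works by auto
    then show ?thesis
      using has_derivative_transform_within_open Suc.prems(1,2) that by metis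
  qed
  have e: "frechet_derivative g (at x) = frechet_derivative f (at x)" if "x \<in> S" for x
    using frechet_derivative_at[OF d[OF that]] by simp
  have "Ck_on k S (\<lambda>x. frechet_derivative g (at x) v)" for v
    by (rule Suc.IH[OF Suc.prems(1), of "\<lambda>x. frechet_derivative f (at x) v"])
      (use Suc.prems(3) e in auto)
  moreover have "\<forall>x\<in>S. g differentiable (at x)"
    using d by (auto simp: differentiable_def)
  ultimately show ?case by simp
qed

text \<open>Any derivative \<open>f'\<close> may be supplied in place of
  \<open>frechet_derivative\<close>; together with \<open>Ck_on_SucD\<close> this lets the
  inductions below differentiate by \<open>derivative_eq_intros\<close>.\<close>

lemma Ck_on_SucI:
  assumes "open S" "\<And>x. x \<in> S \<Longrightarrow> (f has_derivative f' x) (at x)"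
    "\<And>v. Ck_on k S (\<lambda>x. f' x v)"
  shows "Ck_on (Suc k) S f"
proof -
  have "Ck_on k S (\<lambda>x. frechet_derivative f (at x) v)" for v
    by (rule Ck_on_cong[OF assms(1) _ assms(3)[of v]])
      (metis assms(2) frechet_derivative_at)
  then show ?thesis
    using assms(2) by (auto simp: differentiable_def)
qed

lemma Ck_on_SucD:
  assumes "Ck_on (Suc k) S f"
  obtains f' where "\<And>x. x \<in> S \<Longrightarrow> (f has_derivative f' x) (at x)"
    "\<And>v. Ck_on k S (\<lambda>x. f' x v)"
proof
  show "\<And>x. x \<in> S \<Longrightarrow> (f has_derivative frechet_derivative f (at x)) (at x)"
    using assms frechet_derivative_works by auto
  show "\<And>v. Ck_on k S (\<lambda>x. frechet_derivative f (at x) v)"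
    using assms by simp
qed

text \<open>The product, reciprocal and chain rules involve the functions themselves besides their
  derivatives, so their induction steps call for the lower order as well.\<close>

lemma Ck_on_pred: "Ck_on (Suc k) S f \<Longrightarrow> Ck_on k S f"
proof (induction k arbitrary: f)
  case 0
  then show ?case
    by (auto intro!: continuous_at_imp_continuous_on differentiable_imp_continuous_within)
next
  case (Suc k)
  then have "\<forall>x\<in>S. f differentiable (at x)"
    "\<And>v. Ck_on (Suc k) S (\<lambda>x. frechet_derivative f (at x) v)"
    using Ck_on.simps(2)[of "Suc k" S f] by blast+
  then show ?case
    using Suc.IH unfolding Ck_on.simps(2)[of k S f] by blast
qed

lemma Ck_on_subset: "Ck_on k S f \<Longrightarrow> T \<subseteq> S \<Longrightarrow> Ck_on k T f"
  by (induction k arbitrary: f) (auto intro: continuous_on_subset)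

lemma Ck_on_local:
  assumes "\<And>x. x \<in> S \<Longrightarrow> \<exists>T. open T \<and> x \<in> T \<and> Ck_on k T f"
  shows "Ck_on k S f"
  using assms
proof (induction k arbitrary: f)
  case 0
  then show ?case
    by (metis Ck_on.simps(1) at_within_open continuous_at_imp_continuous_on continuous_on_eq_continuous_at)
next
  case (Suc k)
  have "f differentiable (at x)" if "x \<in> S" for x
    using Suc.prems[OF that] by auto
  moreover have "Ck_on k S (\<lambda>x. frechet_derivative f (at x) v)" for v
    by (rule Suc.IH) (use Suc.prems in fastforce)
  ultimately show ?case by simp
qed

lemma Ck_on_const: "Ck_on k S (\<lambda>x. c)"
proof (induction k arbitrary: c)
  case (Suc k)
  then show ?case
    by (simp add: frechet_derivative_const)
qed simp

lemma Ck_on_add: "open S \<Longrightarrow> Ck_on k S f \<Longrightarrow> Ck_on k S g \<Longrightarrow> Ck_on k S (\<lambda>x. f x + g x)"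
proof (induction k arbitrary: f g)
  case 0
  then show ?case by (simp add: continuous_on_add)
next
  case (Suc k)
  obtain f' where f': "\<And>x. x \<in> S \<Longrightarrow> (f has_derivative f' x) (at x)" "\<And>v. Ck_on k S (\<lambda>x. f' x v)"
    by (rule Ck_on_SucD[OF Suc.prems(2)]) blast
  obtain g' where g': "\<And>x. x \<in> S \<Longrightarrow> (g has_derivative g' x) (at x)" "\<And>v. Ck_on k S (\<lambda>x. g' x v)"
    by (rule Ck_on_SucD[OF Suc.prems(3)]) blast
  show ?case
    by (rule Ck_on_SucI[OF Suc.prems(1), of _ "\<lambda>x h. f' x h + g' x h"])
      (auto intro!: derivative_eq_intros f' g' Suc.IH Suc.prems(1))
qed

lemma Ck_on_mult:
  fixes f g :: "'e::euclidean_space \<Rightarrow> real"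
  shows "open S \<Longrightarrow> Ck_on k S f \<Longrightarrow> Ck_on k S g \<Longrightarrow> Ck_on k S (\<lambda>x. f x * g x)"
proof (induction k arbitrary: f g)
  case 0
  then show ?case by (simp add: continuous_on_mult)
next
  case (Suc k)
  obtain f' where f': "\<And>x. x \<in> S \<Longrightarrow> (f has_derivative f' x) (at x)" "\<And>v. Ck_on k S (\<lambda>x. f' x v)"
    by (rule Ck_on_SucD[OF Suc.prems(2)]) blast
  obtain g' where g': "\<And>x. x \<in> S \<Longrightarrow> (g has_derivative g' x) (at x)" "\<And>v. Ck_on k S (\<lambda>x. g' x v)"
    by (rule Ck_on_SucD[OF Suc.prems(3)]) blast
  note fg = Ck_on_pred[OF Suc.prems(2)] Ck_on_pred[OF Suc.prems(3)]
  show ?case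
    by (rule Ck_on_SucI[OF Suc.prems(1), of _ "\<lambda>x h. f x * g' x h + f' x h * g x"])
      (auto intro!: derivative_eq_intros f' g' Suc.IH Suc.prems(1) Ck_on_add fg)
qed

lemma Ck_on_sum:
  assumes "open S" "\<And>i. i \<in> I \<Longrightarrow> Ck_on k S (f i)"
  shows "Ck_on k S (\<lambda>x. \<Sum>i\<in>I. f i x)"
  using assms by (induction I rule: infinite_finite_induct) (auto intro: Ck_on_const Ck_on_add)

lemma Ck_on_bounded_linear:
  assumes "bounded_linear L"
  shows "open S \<Longrightarrow> Ck_on k S f \<Longrightarrow> Ck_on k S (\<lambda>x. L (f x))"
proof (induction k arbitrary: f)
  case 0
  then show ?case
    by (simp add: bounded_linear.continuous_on[OF assms])
next
  case (Suc k)
  obtain f' where f': "\<And>x. x \<in> S \<Longrightarrow> (f has_derivative f' x) (at x)" "\<And>v. Ck_on k S (\<lambda>x. f' x v)"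
    by (rule Ck_on_SucD[OF Suc.prems(2)]) blast
  show ?case
    by (rule Ck_on_SucI[OF Suc.prems(1), of _ "\<lambda>x h. L (f' x h)"])
      (auto intro!: bounded_linear.has_derivative[OF assms] f' Suc.IH Suc.prems(1))
qed

lemma Ck_on_id: "open S \<Longrightarrow> Ck_on k S (\<lambda>x. x)"
proof (induction k)
  case (Suc k)
  show ?case
    by (rule Ck_on_SucI[OF Suc.prems, of _ "\<lambda>x h. h"]) (auto intro: Ck_on_const)
qed simp

lemma Ck_on_inverse:
  fixes f :: "'e::euclidean_space \<Rightarrow> real"
  assumes "open S" "\<And>x. x \<in> S \<Longrightarrow> f x \<noteq> 0"
  shows "Ck_on k S f \<Longrightarrow> Ck_on k S (\<lambda>x. inverse (f x))"
proof (induction k)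
  case 0
  then show ?case using assms by (simp add: continuous_on_inverse)
next
  case (Suc k)
  obtain f' where f': "\<And>x. x \<in> S \<Longrightarrow> (f has_derivative f' x) (at x)" "\<And>v. Ck_on k S (\<lambda>x. f' x v)"
    by (rule Ck_on_SucD[OF Suc.prems]) blast
  have i: "Ck_on k S (\<lambda>x. inverse (f x))"
    using Suc.IH Ck_on_pred[OF Suc.prems] by blast
  show ?case
    by (rule Ck_on_SucI[OF assms(1), of _ "\<lambda>x h. (-1) * (inverse (f x) * f' x h * inverse (f x))"])
      (use assms(2) in \<open>auto intro!: derivative_eq_intros f' Ck_on_mult[OF assms(1)] i
          Ck_on_bounded_linear[OF bounded_linear_minus[OF bounded_linear_ident] assms(1)]\<close>)
qed

lemma Ck_on_compose:
  fixes g :: "'e::euclidean_space \<Rightarrow> 'd::euclidean_space" and f :: "'d \<Rightarrow> real"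
  assumes "open S" "open T" "g ` S \<subseteq> T"
  shows "Ck_on k T f \<Longrightarrow> Ck_on k S g \<Longrightarrow> Ck_on k S (\<lambda>x. f (g x))"
proof (induction k arbitrary: f)
  case 0
  then show ?case using assms(3) by (auto intro: continuous_on_compose2)
next
  case (Suc k)
  obtain f' where f': "\<And>x. x \<in> T \<Longrightarrow> (f has_derivative f' x) (at x)" "\<And>v. Ck_on k T (\<lambda>x. f' x v)"
    by (rule Ck_on_SucD[OF Suc.prems(1)]) blast
  obtain g' where g': "\<And>x. x \<in> S \<Longrightarrow> (g has_derivative g' x) (at x)" "\<And>v. Ck_on k S (\<lambda>x. g' x v)"
    by (rule Ck_on_SucD[OF Suc.prems(2)]) blast
  \<comment> \<open>\<open>Ck_on\<close> controls \<open>f' y v\<close> for a fixed direction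
    \<open>v\<close>, while the chain rule produces the direction \<open>g' x h\<close>, which moves
    with \<open>x\<close>. Expanding it in \<open>Basis\<close> leaves fixed directions with
    coefficients of class \<open>Ck_on k\<close>.\<close>
  have d: "((\<lambda>x. f (g x)) has_derivative (\<lambda>h. \<Sum>i\<in>Basis. (g' x h \<bullet> i) * f' (g x) i)) (at x)"
    if "x \<in> S" for x
  proof -
    have "g x \<in> T" using that assms(3) by auto
    then have l: "linear (f' (g x))" using f'(1) has_derivative_linear by blast
    have "((\<lambda>x. f (g x)) has_derivative (\<lambda>h. f' (g x) (g' x h))) (at x)"
      using g'(1)[OF that] f'(1)[OF \<open>g x \<in> T\<close>] by (rule has_derivative_compose)
    moreover have "f' (g x) (g' x h) = (\<Sum>i\<in>Basis. (g' x h \<bullet> i) * f' (g x) i)" for h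
      using Linear_Algebra.linear_componentwise[OF l, of "g' x h" 1] by simp
    ultimately show ?thesis by simp
  qed
  have "Ck_on k S (\<lambda>x. f' (g x) v)" for v
    using Suc.IH[OF f'(2) Ck_on_pred[OF Suc.prems(2)]] .
  then have "Ck_on k S (\<lambda>x. \<Sum>i\<in>Basis. (g' x v \<bullet> i) * f' (g x) i)" for v
    by (intro Ck_on_sum Ck_on_mult assms(1) Ck_on_bounded_linear[OF bounded_linear_inner_left] g'(2))
  with d show ?case by (intro Ck_on_SucI[OF assms(1)])
qed

section \<open>Smooth functions, and a family of functions flat at the origin\<close>

lemma smooth_on_cong:
  "open S \<Longrightarrow> (\<And>x. x \<in> S \<Longrightarrow> f x = g x) \<Longrightarrow> smooth_on S f \<Longrightarrow> smooth_on S g"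
  unfolding smooth_on_def using Ck_on_cong by blast

lemma smooth_on_subset: "smooth_on S f \<Longrightarrow> T \<subseteq> S \<Longrightarrow> smooth_on T f"
  unfolding smooth_on_def using Ck_on_subset by blast

lemma smooth_on_local:
  "(\<And>x. x \<in> S \<Longrightarrow> \<exists>T. open T \<and> x \<in> T \<and> smooth_on T f) \<Longrightarrow> smooth_on S f"
  unfolding smooth_on_def using Ck_on_local by meson

lemma smooth_on_const: "smooth_on S (\<lambda>x. c)"
  by (simp add: smooth_on_def Ck_on_const)

lemma smooth_on_imp_continuous_on: "smooth_on S f \<Longrightarrow> continuous_on S f"
  unfolding smooth_on_def using Ck_on.simps(1) by blast

lemma smooth_on_add:
  "open S \<Longrightarrow> smooth_on S f \<Longrightarrow> smooth_on S g \<Longrightarrow> smooth_on S (\<lambda>x. f x + g x)"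
  by (simp add: smooth_on_def Ck_on_add)

lemma smooth_on_mult:
  fixes f g :: "'e::euclidean_space \<Rightarrow> real"
  shows "open S \<Longrightarrow> smooth_on S f \<Longrightarrow> smooth_on S g \<Longrightarrow> smooth_on S (\<lambda>x. f x * g x)"
  by (simp add: smooth_on_def Ck_on_mult)

lemma smooth_on_inverse:
  fixes f :: "'e::euclidean_space \<Rightarrow> real"
  shows "open S \<Longrightarrow> (\<And>x. x \<in> S \<Longrightarrow> f x \<noteq> 0) \<Longrightarrow> smooth_on S f \<Longrightarrow> smooth_on S (\<lambda>x. inverse (f x))"
  by (simp add: smooth_on_def Ck_on_inverse)

lemma smooth_on_compose:
  fixes g :: "'e::euclidean_space \<Rightarrow> 'd::euclidean_space" and f :: "'d \<Rightarrow> real"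
  shows "open S \<Longrightarrow> open T \<Longrightarrow> g ` S \<subseteq> T \<Longrightarrow> smooth_on T f \<Longrightarrow> smooth_on S g
    \<Longrightarrow> smooth_on S (\<lambda>x. f (g x))"
  unfolding smooth_on_def using Ck_on_compose[of S T g _ f] by blast

text \<open>The polynomial factor makes the family closed under differentiation.\<close>

definition flat_exp :: "real poly \<Rightarrow> real \<Rightarrow> real" where
  "flat_exp P t = (if t > 0 then poly P (inverse t) * exp (- inverse t) else 0)"


text \<open>On the right of 0, substituting \<open>x = 1 / t\<close> turns this into the decay of a
  polynomial times \<open>exp (- x)\<close> at infinity.\<close>

lemma flat_exp_tendsto_0: "(flat_exp P \<longlongrightarrow> 0) (at 0)"
proof -
  have mono: "((\<lambda>x. poly P x * exp (- x)) \<longlongrightarrow> 0) at_top"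
  proof -
    have "((\<lambda>x. \<Sum>i\<le>degree P. coeff P i * (x ^ i / exp x)) \<longlongrightarrow> (\<Sum>i\<le>degree P. coeff P i * 0)) at_top"
      by (intro tendsto_sum tendsto_mult tendsto_const tendsto_power_div_exp_0)
    moreover have "(\<lambda>x. \<Sum>i\<le>degree P. coeff P i * (x ^ i / exp x)) = (\<lambda>x. poly P x * exp (- x))"
      by (simp add: fun_eq_iff poly_altdef sum_distrib_right exp_minus divide_inverse mult.assoc)
    ultimately show ?thesis by simp
  qed
  have r: "(flat_exp P \<longlongrightarrow> 0) (at_right 0)"
  proof (rule Lim_transform_eventually)
    show "((\<lambda>t. poly P (inverse t) * exp (- inverse t)) \<longlongrightarrow> 0) (at_right 0)"
      by (rule filterlim_compose[OF mono filterlim_inverse_at_top_right])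
    show "\<forall>\<^sub>F t in at_right 0. poly P (inverse t) * exp (- inverse t) = flat_exp P t"
      by (auto simp: flat_exp_def eventually_at_filter)
  qed
  have l: "(flat_exp P \<longlongrightarrow> 0) (at_left 0)"
  proof (rule Lim_transform_eventually[of "\<lambda>_. 0"])
    show "\<forall>\<^sub>F t in at_left 0. 0 = flat_exp P t"
      by (auto simp: flat_exp_def eventually_at_filter)
  qed simp
  show ?thesis
    using r l filterlim_split_at by blast
qed

text \<open>The polynomial \<open>[:0,0,1:]\<close> is the square of the variable: with
  \<open>x = 1 / t\<close> one has dx/dt = - x^2, and P(x) exp(-x) has x-derivative (P' - P)(x)
  exp(-x).\<close>

lemma flat_exp_has_derivative:
  "(flat_exp P has_real_derivative flat_exp ([:0,0,1:] * (P - pderiv P)) t) (at t)"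
proof -
  consider "t > 0" | "t < 0" | "t = 0" by linarith
  then show ?thesis
  proof cases
    case 1
    have "((\<lambda>t. poly P (inverse t) * exp (- inverse t)) has_real_derivative
        flat_exp ([:0,0,1:] * (P - pderiv P)) t) (at t)"
      using 1 by (auto intro!: derivative_eq_intros DERIV_chain'[where g = "poly P"] poly_DERIV
          simp: flat_exp_def algebra_simps power2_eq_square)
    then show ?thesis
      by (rule DERIV_cong_ev[THEN iffD1, rotated 3])
        (use 1 in \<open>auto simp: flat_exp_def intro!: eventually_mono[OF eventually_nhds_in_open[of "{0<..}"]]\<close>)
  next
    case 2
    have "((\<lambda>t. 0) has_real_derivative flat_exp ([:0,0,1:] * (P - pderiv P)) t) (at t)"
      using 2 by (simp add: flat_exp_def)
    then show ?thesis
      by (rule DERIV_cong_ev[THEN iffD1, rotated 3])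
        (use 2 in \<open>auto simp: flat_exp_def intro!: eventually_mono[OF eventually_nhds_in_open[of "{..<0}"]]\<close>)
  next
    case 3
    \<comment> \<open>The difference quotient at 0 stays in the family: dividing by \<open>h\<close>
      multiplies the polynomial by its variable, which stands for \<open>1 / h\<close>.\<close>
    have "(flat_exp ([:0,1:] * P) \<longlongrightarrow> 0) (at 0)"
      by (rule flat_exp_tendsto_0)
    moreover
    have "flat_exp ([:0,1:] * P) h = (flat_exp P (0 + h) - flat_exp P 0) / h" if "h \<noteq> 0" for h
      using that by (auto simp: flat_exp_def field_simps)
    then have "\<forall>\<^sub>F h in at 0. flat_exp ([:0,1:] * P) h = (flat_exp P (0 + h) - flat_exp P 0) / h"
      by (simp add: eventually_at_filter)
    ultimately have "((\<lambda>h. (flat_exp P (0 + h) - flat_exp P 0) / h) \<longlongrightarrow> 0) (at 0)"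
      by (rule Lim_transform_eventually)
    then show ?thesis
      using 3 by (simp add: DERIV_def) (simp add: flat_exp_def)
  qed
qed

lemma smooth_on_flat_exp: "smooth_on UNIV (flat_exp P)"
  unfolding smooth_on_def
proof
  show "Ck_on k UNIV (flat_exp P)" for k
  proof (induction k arbitrary: P)
    case 0
    show ?case
      using flat_exp_has_derivative
      by (auto intro!: continuous_at_imp_continuous_on DERIV_isCont)
  next
    case (Suc k)
    show ?case
      by (rule Ck_on_SucI[of _ _ "\<lambda>t h. flat_exp ([:0,0,1:] * (P - pderiv P)) t * h"])
        (use flat_exp_has_derivative[of P, unfolded has_field_derivative_def] in
          \<open>auto intro!: Ck_on_mult Ck_on_const Suc simp del: mult_pCons_left\<close>)
  qed
qed

section \<open>Smooth functions on a manifold\<close>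

context smooth_manifold
begin

section \<open>Charts and the algebra of smooth functions\<close>

lemma chart_open: "(U, \<phi>) \<in> A \<Longrightarrow> open U" "(U, \<phi>) \<in> A \<Longrightarrow> open (\<phi> ` U)"
  using chart by auto

lemma chart_inv: "(U, \<phi>) \<in> A \<Longrightarrow> q \<in> U \<Longrightarrow> inv_into U \<phi> (\<phi> q) = q"
  using chart[of U \<phi>] unfolding homeomorphism_def by blast

lemma chart_image_open:
  assumes "(U, \<phi>) \<in> A" "open O'"
  shows "open (\<phi> ` (U \<inter> O'))"
proof -
  have "openin (top_of_set (\<phi> ` U)) (\<phi> ` (U \<inter> O'))"
    using chart[OF assms(1)] assms(2) openin_open homeomorphism_imp_open_map by metis
  then show ?thesis
    using chart_open(2)[OF assms(1)] openin_open_trans by blast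
qed

lemma chart_ex: obtains U \<phi> where "(U, \<phi>) \<in> A" "p \<in> U"
proof -
  have "p \<in> (\<Union>(U, \<phi>)\<in>A. U)" unfolding cover by simp
  then show ?thesis using that by (auto split: prod.splits)
qed

lemma CinfD: "f \<in> Cinf \<Longrightarrow> (U, \<phi>) \<in> A \<Longrightarrow> smooth_on (\<phi> ` U) (\<lambda>x. f (inv_into U \<phi> x))"
  unfolding Cinf_def by (auto simp: o_def)

lemma CinfI: "(\<And>U \<phi>. (U, \<phi>) \<in> A \<Longrightarrow> smooth_on (\<phi> ` U) (\<lambda>x. f (inv_into U \<phi> x))) \<Longrightarrow> f \<in> Cinf"
  unfolding Cinf_def by (auto simp: o_def)

lemma Cinf_const: "(\<lambda>p. c) \<in> Cinf"
  by (rule CinfI) (rule smooth_on_const)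

lemma Cinf_add: "f \<in> Cinf \<Longrightarrow> g \<in> Cinf \<Longrightarrow> (\<lambda>p. f p + g p) \<in> Cinf"
  by (rule CinfI, rule smooth_on_add) (auto intro: CinfD chart_open)

lemma Cinf_mult: "f \<in> Cinf \<Longrightarrow> g \<in> Cinf \<Longrightarrow> (\<lambda>p. f p * g p) \<in> Cinf"
  by (rule CinfI, rule smooth_on_mult) (auto intro: CinfD chart_open)

lemma Cinf_uminus: "f \<in> Cinf \<Longrightarrow> (\<lambda>p. - f p) \<in> Cinf"
  using Cinf_mult[OF Cinf_const[of "-1"], of f] by simp

lemma Cinf_diff: "f \<in> Cinf \<Longrightarrow> g \<in> Cinf \<Longrightarrow> (\<lambda>p. f p - g p) \<in> Cinf"
  using Cinf_add[OF _ Cinf_uminus, of f g] by simp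

lemma Cinf_sum: "(\<And>i. i \<in> I \<Longrightarrow> f i \<in> Cinf) \<Longrightarrow> (\<lambda>p. \<Sum>i\<in>I. f i p) \<in> Cinf"
  by (induction I rule: infinite_finite_induct) (auto intro: Cinf_const Cinf_add)

lemmas Cinf_intros = Cinf_const Cinf_add Cinf_mult Cinf_uminus Cinf_diff Cinf_sum

lemma Cinf_continuous:
  assumes "f \<in> Cinf"
  shows "continuous_on UNIV f"
proof -
  have "\<exists>U. open U \<and> p \<in> U \<and> continuous_on U f" for p
  proof -
    obtain U \<phi> where U: "(U, \<phi>) \<in> A" "p \<in> U" by (rule chart_ex)
    have "continuous_on (\<phi> ` U) (\<lambda>x. f (inv_into U \<phi> x))"
      using smooth_on_imp_continuous_on[OF CinfD[OF assms U(1)]] .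
    moreover have "continuous_on U \<phi>"
      using chart[OF U(1)] by (auto simp: homeomorphism_def)
    ultimately have "continuous_on U (\<lambda>q. f (inv_into U \<phi> (\<phi> q)))"
      using continuous_on_compose2 by blast
    then have "continuous_on U f"
      using chart_inv[OF U(1)] by (simp cong: continuous_on_cong)
    then show ?thesis using U chart_open by blast
  qed
  then show ?thesis
    by (simp add: continuous_on_eq_continuous_at) (metis continuous_on_eq_continuous_at)
qed

lemma Cinf_nonzero_open: "f \<in> Cinf \<Longrightarrow> open {p. f p \<noteq> 0}"
  using Cinf_continuous[of f] open_Collect_neq[of f "\<lambda>_. 0"] by auto

text \<open>Where \<open>b\<close> does not vanish, \<open>u\<close> is the quotient of
  \<open>g\<close> by \<open>b\<close>, and the open sets where this happens cover the
  manifold.\<close>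

lemma Cinf_divide_local:
  assumes "\<And>p. \<exists>b\<in>Cinf. \<exists>g\<in>Cinf. b p \<noteq> 0 \<and> (\<forall>q. b q * u q = g q)"
  shows "u \<in> Cinf"
proof (rule CinfI, rule smooth_on_local)
  fix U \<phi> x assume U: "(U, \<phi>) \<in> A" and "x \<in> \<phi> ` U"
  then obtain p where p: "p \<in> U" "x = \<phi> p" by auto
  obtain b g where b: "b \<in> Cinf" "g \<in> Cinf" "b p \<noteq> 0" "\<And>q. b q * u q = g q"
    using assms by blast
  define N where "N = {q. b q \<noteq> 0}"
  have op: "open (\<phi> ` (U \<inter> N))"
    using chart_image_open[OF U] Cinf_nonzero_open[OF b(1)] unfolding N_def by blast
  have nz: "b (inv_into U \<phi> y) \<noteq> 0" if "y \<in> \<phi> ` (U \<inter> N)" for y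
    using that chart_inv[OF U] by (auto simp: N_def)
  have "smooth_on (\<phi> ` (U \<inter> N)) (\<lambda>y. g (inv_into U \<phi> y) * inverse (b (inv_into U \<phi> y)))"
    by (intro smooth_on_mult smooth_on_inverse op nz)
      (auto intro: smooth_on_subset[OF CinfD[OF b(1) U]] smooth_on_subset[OF CinfD[OF b(2) U]])
  then have "smooth_on (\<phi> ` (U \<inter> N)) (\<lambda>y. u (inv_into U \<phi> y))"
    by (rule smooth_on_cong[OF op, rotated]) (use nz in \<open>auto simp: field_simps simp flip: b(4)\<close>)
  then show "\<exists>T. open T \<and> x \<in> T \<and> smooth_on T (\<lambda>y. u (inv_into U \<phi> y))"
    using op p b(3) by (auto simp: N_def)
qed

text \<open>A bump on a closed ball in a chart, extended by zero. The extension is smooth because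
  the preimage of the closed ball is compact, hence closed in the Hausdorff space \<open>'c\<close>,
  and its open complement carries the zero function.\<close>

lemma bump:
  assumes "open O'" "p \<in> O'"
  obtains b where "b \<in> Cinf" "b p \<noteq> 0" "\<And>q. q \<notin> O' \<Longrightarrow> b q = 0"
proof -
  obtain U \<phi> where U: "(U, \<phi>) \<in> A" "p \<in> U" by (rule chart_ex)
  have "open (\<phi> ` (U \<inter> O'))" using chart_image_open[OF U(1) assms(1)] .
  moreover have "\<phi> p \<in> \<phi> ` (U \<inter> O')" using U assms by blast
  ultimately obtain r where r: "r > 0" "cball (\<phi> p) r \<subseteq> \<phi> ` (U \<inter> O')"
    using open_contains_cball by blast
  \<comment> \<open>\<open>flat_exp 1 t\<close> is \<open>exp (- 1 / t)\<close> for positive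
    \<open>t\<close>, and the argument here is positive exactly on the open ball of radius
    \<open>r\<close>.\<close>
  define \<rho> where "\<rho> x = flat_exp 1 (r\<^sup>2 - (x - \<phi> p) \<bullet> (x - \<phi> p))" for x
  have \<rho>: "smooth_on UNIV \<rho>"
  proof -
    have "smooth_on UNIV (\<lambda>x. r\<^sup>2 - (x - \<phi> p) \<bullet> (x - \<phi> p))"
    proof -
      \<comment> \<open>The squared distance is written in coordinates so that the closure rules for
        sums and products apply.\<close>
      have "smooth_on UNIV (\<lambda>x. r\<^sup>2 + (\<Sum>i\<in>Basis. (-1) * ((x \<bullet> i + (- (\<phi> p \<bullet> i))) * (x \<bullet> i + (- (\<phi> p \<bullet> i))))))"
        unfolding smooth_on_def
        by (intro allI Ck_on_add Ck_on_sum Ck_on_mult Ck_on_const open_UNIV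
            Ck_on_bounded_linear[OF bounded_linear_inner_left] Ck_on_id)
      moreover have "(x - \<phi> p) \<bullet> (x - \<phi> p) =
          (\<Sum>i\<in>Basis. (x \<bullet> i + (- (\<phi> p \<bullet> i))) * (x \<bullet> i + (- (\<phi> p \<bullet> i))))" for x
        by (subst euclidean_inner) (simp add: inner_diff_left)
      ultimately show ?thesis
        by (simp add: sum_negf)
    qed
    then show ?thesis
      unfolding \<rho>_def by (intro smooth_on_compose[OF _ _ _ smooth_on_flat_exp]) auto
  qed
  have \<rho>0: "\<rho> x = 0 \<longleftrightarrow> x \<notin> ball (\<phi> p) r" for x
  proof -
    have "(x - \<phi> p) \<bullet> (x - \<phi> p) = (dist (\<phi> p) x)\<^sup>2"
      by (simp add: dist_norm power2_norm_eq_inner norm_minus_commute)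
    moreover have "r\<^sup>2 > (dist (\<phi> p) x)\<^sup>2 \<longleftrightarrow> dist (\<phi> p) x < r"
      using r(1) by (auto intro: power_strict_mono dest: power_less_imp_less_base)
    ultimately show ?thesis by (simp add: \<rho>_def flat_exp_def)
  qed
  define b where "b q = (if q \<in> U then \<rho> (\<phi> q) else 0)" for q
  define K where "K = inv_into U \<phi> ` cball (\<phi> p) r"
  have "continuous_on (cball (\<phi> p) r) (inv_into U \<phi>)"
    using chart[OF U(1)] r(2) by (auto simp: homeomorphism_def intro: continuous_on_subset)
  then have "compact K" unfolding K_def by (intro compact_continuous_image compact_cball)
  then have K: "closed K" by (rule compact_imp_closed)
  have KU: "K \<subseteq> U"
    using r(2) chart_inv[OF U(1)] by (force simp: K_def)
  have bK: "b q = 0" if "q \<notin> K" for q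
  proof (rule ccontr)
    assume "b q \<noteq> 0"
    then have "q \<in> U" "\<phi> q \<in> cball (\<phi> p) r"
      using \<rho>0[of "\<phi> q"] by (auto simp: b_def split: if_splits)
    then show False using that chart_inv[OF U(1)] unfolding K_def by force
  qed
  have "b \<in> Cinf"
  proof (rule CinfI, rule smooth_on_local)
    fix V \<psi> x assume V: "(V, \<psi>) \<in> A" and "x \<in> \<psi> ` V"
    then obtain q where q: "q \<in> V" "x = \<psi> q" by auto
    show "\<exists>T. open T \<and> x \<in> T \<and> smooth_on T (\<lambda>y. b (inv_into V \<psi> y))"
    proof (cases "q \<in> U")
      case True
      have op: "open (\<psi> ` (V \<inter> U))"
        using chart_image_open[OF V] chart_open(1)[OF U(1)] .
      have "smooth_on (\<psi> ` (V \<inter> U)) (\<lambda>y. \<rho> ((\<phi> \<circ> inv_into V \<psi>) y))"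
        by (rule smooth_on_compose[OF op open_UNIV _ \<rho> compatible[OF V U(1)]]) simp
      then have "smooth_on (\<psi> ` (V \<inter> U)) (\<lambda>y. b (inv_into V \<psi> y))"
        by (rule smooth_on_cong[OF op, rotated]) (auto simp: b_def chart_inv[OF V])
      then show ?thesis using op q True by blast
    next
      case False
      have op: "open (\<psi> ` (V \<inter> - K))"
        using chart_image_open[OF V] K by blast
      have "smooth_on (\<psi> ` (V \<inter> - K)) (\<lambda>y. b (inv_into V \<psi> y))"
        by (rule smooth_on_cong[OF op _ smooth_on_const[of _ 0]]) (use bK chart_inv[OF V] in fastforce)
      then show ?thesis using op q False KU by blast
    qed
  qed
  moreover have "b p \<noteq> 0" using U r(1) \<rho>0 by (simp add: b_def)
  moreover have "b q = 0" if "q \<notin> O'" for q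
  proof (rule bK, rule notI)
    assume "q \<in> K"
    then show False using that r(2) chart_inv[OF U(1)] by (force simp: K_def)
  qed
  ultimately show ?thesis using that by blast
qed

end

section \<open>Vector fields and local frames\<close>

lemma scaleR_fun_apply [simp]: "(c *\<^sub>R f) x = c *\<^sub>R f x"
  by (simp add: scaleR_fun_def)

lemma fscale_apply [simp]: "(f \<cdot> s) p = f p *\<^sub>R s p"
  by (simp add: fscale_def)

lemma sum_fun_apply: "(\<Sum>i\<in>I. F i) x = (\<Sum>i\<in>I. F i x)"
  by (induction I rule: infinite_finite_induct) auto

lemma linear_fun_apply: "linear (\<lambda>v. v f)"
  by (rule linearI) auto

context smooth_manifold
begin

section \<open>Tangent vectors as derivations, and smooth vector fields\<close>

lemma tangent_add:
  "v \<in> tangent p \<Longrightarrow> f \<in> Cinf \<Longrightarrow> g \<in> Cinf \<Longrightarrow> v (\<lambda>q. f q + g q) = v f + v g"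
  by (simp add: tangent_def plus_fun_def)

lemma tangent_mult:
  "v \<in> tangent p \<Longrightarrow> f \<in> Cinf \<Longrightarrow> g \<in> Cinf \<Longrightarrow> v (\<lambda>q. f q * g q) = v f * g p + f p * v g"
  by (simp add: tangent_def times_fun_def)

lemma tangent_notin: "v \<in> tangent p \<Longrightarrow> f \<notin> Cinf \<Longrightarrow> v f = 0"
  by (simp add: tangent_def)

lemma tangent_cmult: "v \<in> tangent p \<Longrightarrow> f \<in> Cinf \<Longrightarrow> v (\<lambda>q. c * f q) = c * v f"
  by (simp add: tangent_def scaleR_fun_def)

lemma tangent_const:
  assumes "v \<in> tangent p"
  shows "v (\<lambda>q. c) = 0"
proof -
  have "v (\<lambda>q. 1 * 1) = 2 * v (\<lambda>q. 1)"
    using tangent_mult[OF assms Cinf_const[of 1] Cinf_const[of 1]] by simp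
  then have "v (\<lambda>q. 1) = 0" by simp
  then show ?thesis
    using tangent_cmult[OF assms Cinf_const[of 1], of c] by simp
qed

lemma tangent_diff:
  "v \<in> tangent p \<Longrightarrow> f \<in> Cinf \<Longrightarrow> g \<in> Cinf \<Longrightarrow> v (\<lambda>q. f q - g q) = v f - v g"
  using tangent_add[of v p f "\<lambda>q. - 1 * g q"] tangent_cmult[of v p g "-1"] Cinf_uminus[of g] by simp

lemma tangentI:
  assumes "\<And>f g. f \<in> Cinf \<Longrightarrow> g \<in> Cinf \<Longrightarrow> v (\<lambda>q. f q + g q) = v f + v g"
    "\<And>c f. f \<in> Cinf \<Longrightarrow> v (\<lambda>q. c * f q) = c * v f"
    "\<And>f g. f \<in> Cinf \<Longrightarrow> g \<in> Cinf \<Longrightarrow> v (\<lambda>q. f q * g q) = v f * g p + f p * v g"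
    "\<And>f. f \<notin> Cinf \<Longrightarrow> v f = 0"
  shows "v \<in> tangent p"
  using assms by (simp add: tangent_def plus_fun_def times_fun_def scaleR_fun_def)

lemma subspace_tangent: "subspace (tangent p)"
  by (rule subspaceI; rule tangentI)
    (auto simp: tangent_add tangent_mult tangent_notin tangent_cmult algebra_simps)

lemma vfields_tangent: "X \<in> vfields \<Longrightarrow> X p \<in> tangent p"
  by (simp add: vfields_def)

text \<open>For \<open>f\<close> outside \<open>Cinf\<close> the normalisation of tangent vectors
  makes this the zero function, so later applications carry no side condition on
  \<open>f\<close>.\<close>

lemma vfields_Cinf: "X \<in> vfields \<Longrightarrow> (\<lambda>p. X p f) \<in> Cinf"
proof (cases "f \<in> Cinf")
  case False
  assume "X \<in> vfields"
  then have "(\<lambda>p. X p f) = (\<lambda>p. 0)" using False vfields_tangent tangent_notin by blast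
  then show ?thesis using Cinf_const by simp
qed (simp add: vfields_def)

lemma vfieldsI:
  "(\<And>p. X p \<in> tangent p) \<Longrightarrow> (\<And>f. f \<in> Cinf \<Longrightarrow> (\<lambda>p. X p f) \<in> Cinf) \<Longrightarrow> X \<in> vfields"
  by (simp add: vfields_def)

lemma vfields_0: "0 \<in> vfields"
  by (rule vfieldsI) (auto intro: subspace_0[OF subspace_tangent] Cinf_intros)

lemma vfields_add: "X \<in> vfields \<Longrightarrow> Y \<in> vfields \<Longrightarrow> X + Y \<in> vfields"
  by (rule vfieldsI) (auto intro: subspace_add[OF subspace_tangent] vfields_tangent Cinf_intros vfields_Cinf)

lemma vfields_fscale: "f \<in> Cinf \<Longrightarrow> X \<in> vfields \<Longrightarrow> f \<cdot> X \<in> vfields"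
  by (rule vfieldsI) (auto intro: subspace_scale[OF subspace_tangent] vfields_tangent Cinf_intros vfields_Cinf)

lemma vfields_scaleR: "X \<in> vfields \<Longrightarrow> c *\<^sub>R X \<in> vfields"
  by (rule vfieldsI) (auto intro: subspace_scale[OF subspace_tangent] vfields_tangent Cinf_intros vfields_Cinf)

lemma vfields_uminus: "X \<in> vfields \<Longrightarrow> - X \<in> vfields"
  by (rule vfieldsI) (auto intro: subspace_neg[OF subspace_tangent] vfields_tangent Cinf_intros vfields_Cinf)

lemma vfields_diff: "X \<in> vfields \<Longrightarrow> Y \<in> vfields \<Longrightarrow> X - Y \<in> vfields"
  using vfields_add[OF _ vfields_uminus, of X Y] by simp

text \<open>\<open>Cinf_divide_local\<close> applied to the derivative of each \<open>f\<close>.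
  Vector fields that are defined point by point are shown to be smooth in this form.\<close>

lemma vfields_divide_local:
  assumes "\<And>p. Y p \<in> tangent p"
    and "\<And>p. \<exists>b\<in>Cinf. \<exists>Z\<in>vfields. b p \<noteq> 0 \<and> b \<cdot> Y = Z"
  shows "Y \<in> vfields"
proof (rule vfieldsI[OF assms(1)], rule Cinf_divide_local)
  fix f p
  obtain b Z where b: "b \<in> Cinf" "Z \<in> vfields" "b p \<noteq> 0" "b \<cdot> Y = Z"
    using assms(2) by metis
  have "b q * Y q f = Z q f" for q
    by (simp flip: b(4))
  with b show "\<exists>b\<in>Cinf. \<exists>g\<in>Cinf. b p \<noteq> 0 \<and> (\<forall>q. b q * Y q f = g q)"
    using vfields_Cinf[OF b(2)] by (intro bexI[of _ b] bexI[of _ "\<lambda>q. Z q f"]) auto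
qed

subsection \<open>The Lie bracket\<close>

text \<open>In the Leibniz rule the products of first derivatives are symmetric in \<open>X\<close>
  and \<open>Y\<close> and cancel.\<close>

lemma bracket_vfields:
  assumes X: "X \<in> vfields" and Y: "Y \<in> vfields"
  shows "bracket X Y \<in> vfields"
proof (rule vfieldsI)
  note c = vfields_Cinf[OF X] vfields_Cinf[OF Y]
  note t = vfields_tangent[OF X] vfields_tangent[OF Y]
  show "bracket X Y p \<in> tangent p" for p
  proof (rule tangentI)
    fix f g k assume f: "f \<in> Cinf"
    show "bracket X Y p (\<lambda>q. k * f q) = k * bracket X Y p f"
      by (simp add: bracket_def tangent_cmult[OF t(1)] tangent_cmult[OF t(2)] f c algebra_simps)
    assume g: "g \<in> Cinf"
    show "bracket X Y p (\<lambda>q. f q + g q) = bracket X Y p f + bracket X Y p g"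
      by (simp add: bracket_def tangent_add[OF t(1)] tangent_add[OF t(2)] f g c)
    show "bracket X Y p (\<lambda>q. f q * g q) = bracket X Y p f * g p + f p * bracket X Y p g"
      by (simp add: bracket_def tangent_mult[OF t(1)] tangent_mult[OF t(2)] tangent_add[OF t(1)]
          tangent_add[OF t(2)] f g c Cinf_intros algebra_simps)
  next
    fix f assume "f \<notin> Cinf"
    then show "bracket X Y p f = 0"
      by (simp add: bracket_def tangent_notin[OF t(1)] tangent_notin[OF t(2)]
          tangent_const[OF t(1)] tangent_const[OF t(2)])
  qed
  show "(\<lambda>p. bracket X Y p f) \<in> Cinf" for f
    by (simp add: bracket_def Cinf_diff vfields_Cinf[OF X] vfields_Cinf[OF Y])
qed

lemma bracket_swap: "bracket X Y = - bracket Y X"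
  by (simp add: bracket_def fun_eq_iff)

lemma bracket_add_right:
  "X \<in> vfields \<Longrightarrow> Y \<in> vfields \<Longrightarrow> Z \<in> vfields \<Longrightarrow> bracket X (Y + Z) = bracket X Y + bracket X Z"
  by (simp add: bracket_def fun_eq_iff tangent_add[OF vfields_tangent[of X]] vfields_Cinf)

lemma bracket_add_left:
  "X \<in> vfields \<Longrightarrow> Y \<in> vfields \<Longrightarrow> Z \<in> vfields \<Longrightarrow> bracket (Y + Z) X = bracket Y X + bracket Z X"
  using bracket_add_right[of X Y Z] by (simp add: bracket_swap[of _ X])

lemma bracket_diff_right:
  "X \<in> vfields \<Longrightarrow> Y \<in> vfields \<Longrightarrow> Z \<in> vfields \<Longrightarrow> bracket X (Y - Z) = bracket X Y - bracket X Z"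
  by (simp add: bracket_def fun_eq_iff tangent_diff[OF vfields_tangent[of X]] vfields_Cinf)

lemma bracket_diff_left:
  "X \<in> vfields \<Longrightarrow> Y \<in> vfields \<Longrightarrow> Z \<in> vfields \<Longrightarrow> bracket (Y - Z) X = bracket Y X - bracket Z X"
  using bracket_diff_right[of X Y Z] by (simp add: bracket_swap[of _ X])

lemma bracket_fscale_right:
  assumes X: "X \<in> vfields" and Y: "Y \<in> vfields" and f: "f \<in> Cinf"
  shows "bracket X (f \<cdot> Y) = f \<cdot> bracket X Y + (\<lambda>p. X p f) \<cdot> Y"
proof (intro ext)
  fix p g
  show "bracket X (f \<cdot> Y) p g = (f \<cdot> bracket X Y + (\<lambda>p. X p f) \<cdot> Y) p g"
    using tangent_mult[OF vfields_tangent[OF X] f vfields_Cinf[OF Y]]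
    by (simp add: bracket_def algebra_simps)
qed

lemma bracket_fscale_left:
  assumes "X \<in> vfields" "Y \<in> vfields" "f \<in> Cinf"
  shows "bracket (f \<cdot> Y) X = f \<cdot> bracket Y X - (\<lambda>p. X p f) \<cdot> Y"
  using bracket_fscale_right[OF assms] by (simp add: bracket_swap[of _ X] fun_eq_iff)

lemma bracket_0_left: "Y \<in> vfields \<Longrightarrow> bracket 0 Y = 0"
  by (simp add: bracket_def fun_eq_iff tangent_const[OF vfields_tangent])

lemma bracket_0_right: "Y \<in> vfields \<Longrightarrow> bracket Y 0 = 0"
  by (simp add: bracket_def fun_eq_iff tangent_const[OF vfields_tangent])

lemma bracket_Jacobi:
  assumes "X \<in> vfields" "Y \<in> vfields" "Z \<in> vfields"
  shows "bracket (bracket X Y) Z = bracket X (bracket Y Z) - bracket Y (bracket X Z)"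
  using assms
  by (simp add: bracket_def fun_eq_iff tangent_diff[OF vfields_tangent[of X]]
      tangent_diff[OF vfields_tangent[of Y]] tangent_diff[OF vfields_tangent[of Z]] vfields_Cinf)

subsection \<open>Classes modulo a distribution\<close>

lemma cls_add: "cls W (X + Y) = cls W X + cls W Y"
  by (simp add: fun_eq_iff cls_def linear_add[OF linear_quot] del: plus_fun_apply)
    (simp add: linear_add[OF linear_quot])

lemma cls_diff: "cls W (X - Y) = cls W X - cls W Y"
  by (rule ext) (simp add: cls_def linear_diff[OF linear_quot] del: plus_fun_apply)

lemma cls_uminus: "cls W (- X) = - cls W X"
  by (rule ext) (simp add: cls_def linear_neg[OF linear_quot] del: plus_fun_apply)

lemma cls_fscale: "cls W (f \<cdot> X) = f \<cdot> cls W X"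
  by (rule ext) (simp add: cls_def linear_scale[OF linear_quot])

lemma cls_0: "cls W 0 = 0"
  by (rule ext) (simp add: cls_def linear_0[OF linear_quot])

lemma cls_eq_0_at: "subspace (W p) \<Longrightarrow> cls W X p = 0 \<longleftrightarrow> X p \<in> W p"
  using quot_eq_iff[of "W p" "X p" 0] by (simp add: cls_def linear_0[OF linear_quot])

lemma cls_eq_0:
  assumes "\<And>p. subspace (W p)" "X \<in> vfields"
  shows "cls W X = 0 \<longleftrightarrow> X \<in> secs W"
  using cls_eq_0_at[OF assms(1)] assms(2) by (simp add: secs_def fun_eq_iff[of "cls W X"])

lemma cls_eq_iff:
  assumes "\<And>p. subspace (W p)" "X \<in> vfields" "Y \<in> vfields"
  shows "cls W X = cls W Y \<longleftrightarrow> X - Y \<in> secs W"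
  using cls_eq_0[OF assms(1) vfields_diff[OF assms(2,3)]] by (simp add: cls_diff)

lemma secs_vfields: "X \<in> secs W \<Longrightarrow> X \<in> vfields"
  by (simp add: secs_def)

lemma secs_at: "X \<in> secs W \<Longrightarrow> X p \<in> W p"
  by (simp add: secs_def)

lemma secs_closed:
  assumes "\<And>p. subspace (W p)"
  shows "0 \<in> secs W"
    "X \<in> secs W \<Longrightarrow> Y \<in> secs W \<Longrightarrow> X + Y \<in> secs W"
    "X \<in> secs W \<Longrightarrow> Y \<in> secs W \<Longrightarrow> X - Y \<in> secs W"
    "f \<in> Cinf \<Longrightarrow> X \<in> secs W \<Longrightarrow> f \<cdot> X \<in> secs W"
    "X \<in> secs W \<Longrightarrow> - X \<in> secs W"
    "X \<in> secs W \<Longrightarrow> c *\<^sub>R X \<in> secs W"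
  using assms by (auto simp: secs_def subspace_0 subspace_add subspace_diff subspace_scale subspace_neg
      vfields_0 vfields_add vfields_diff vfields_fscale vfields_uminus vfields_scaleR)

lemma cls_qsecs: "X \<in> vfields \<Longrightarrow> cls W X \<in> qsecs W"
  by (simp add: qsecs_def)

lemma qsecsE:
  assumes "s \<in> qsecs W"
  obtains X where "X \<in> vfields" "s = cls W X"
  using assms by (auto simp: qsecs_def)

lemma qsecs_0: "0 \<in> qsecs W"
  using cls_qsecs[OF vfields_0] by (simp add: cls_0)

lemma qsecs_add: "s \<in> qsecs W \<Longrightarrow> t \<in> qsecs W \<Longrightarrow> s + t \<in> qsecs W"
  by (elim qsecsE) (metis cls_add cls_qsecs vfields_add)

lemma qsecs_diff: "s \<in> qsecs W \<Longrightarrow> t \<in> qsecs W \<Longrightarrow> s - t \<in> qsecs W"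
  by (elim qsecsE) (metis cls_diff cls_qsecs vfields_diff)

lemma qsecs_uminus: "s \<in> qsecs W \<Longrightarrow> - s \<in> qsecs W"
  by (elim qsecsE) (metis cls_uminus cls_qsecs vfields_uminus)

lemma qsecs_fscale: "f \<in> Cinf \<Longrightarrow> s \<in> qsecs W \<Longrightarrow> f \<cdot> s \<in> qsecs W"
  by (elim qsecsE) (metis cls_fscale cls_qsecs vfields_fscale)

text \<open>The universal property of the quotient. Additivity alone gives independence of the
  representative; scalar rules are left out because the lemma has to serve derivations of \<ell> as
  well as homomorphisms.\<close>

lemma cls_lift:
  assumes "\<And>p. subspace (W p)"
    and add: "\<And>X Y. X \<in> vfields \<Longrightarrow> Y \<in> vfields \<Longrightarrow> F (X + Y) = F X + F Y"
    and ker: "\<And>X. X \<in> secs W \<Longrightarrow> F X = (0 :: 'c qsec)"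
  shows "\<exists>\<beta>. (\<forall>X\<in>vfields. \<beta> (cls W X) = F X) \<and> (\<forall>s. s \<notin> qsecs W \<longrightarrow> \<beta> s = 0)"
proof -
  define \<beta> where "\<beta> s = (if s \<in> qsecs W then F (SOME X. X \<in> vfields \<and> s = cls W X) else 0)" for s
  have 0: "\<beta> s = 0" if "s \<notin> qsecs W" for s
    using that by (simp add: \<beta>_def)
  have "\<beta> (cls W X) = F X" if X: "X \<in> vfields" for X
  proof -
    define Y where "Y = (SOME Y. Y \<in> vfields \<and> cls W X = cls W Y)"
    have "\<exists>Y. Y \<in> vfields \<and> cls W X = cls W Y"
      using X by blast
    then have Y: "Y \<in> vfields \<and> cls W X = cls W Y"
      unfolding Y_def by (rule someI_ex)
    then have "F ((X - Y) + Y) = F (X - Y) + F Y"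
      using X vfields_diff by (intro add) auto
    moreover have "F (X - Y) = 0"
      using Y X cls_eq_iff[of W X Y] assms(1) by (intro ker) blast
    ultimately show ?thesis
      using cls_qsecs[OF X] by (simp add: \<beta>_def Y_def)
  qed
  with 0 show ?thesis by blast
qed

subsection \<open>Local frames\<close>

text \<open>Gaussian elimination without division, whence the common denominator \<open>b\<close>.\<close>

lemma dual_frame:
  fixes e :: "'i \<Rightarrow> 'c vfield" and M :: "'c vfield set" and \<K> :: "('c vfield \<Rightarrow> 'c \<Rightarrow> real) set"
  assumes M: "0 \<in> M" "\<And>X Y. X \<in> M \<Longrightarrow> Y \<in> M \<Longrightarrow> X + Y \<in> M"
      "\<And>f X. f \<in> Cinf \<Longrightarrow> X \<in> M \<Longrightarrow> f \<cdot> X \<in> M"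
    and lin: "\<And>\<kappa> X. \<kappa> \<in> \<K> \<Longrightarrow> X \<in> M \<Longrightarrow> \<kappa> X \<in> Cinf"
      "\<And>\<kappa> X Y. \<kappa> \<in> \<K> \<Longrightarrow> X \<in> M \<Longrightarrow> Y \<in> M \<Longrightarrow> \<kappa> (X + Y) = \<kappa> X + \<kappa> Y"
      "\<And>\<kappa> f X. \<kappa> \<in> \<K> \<Longrightarrow> f \<in> Cinf \<Longrightarrow> X \<in> M \<Longrightarrow> \<kappa> (f \<cdot> X) = f * \<kappa> X"
    and K: "(\<lambda>X. 0) \<in> \<K>" "\<And>\<kappa> \<kappa>'. \<kappa> \<in> \<K> \<Longrightarrow> \<kappa>' \<in> \<K> \<Longrightarrow> (\<lambda>X. \<kappa> X + \<kappa>' X) \<in> \<K>"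
      "\<And>f \<kappa>. f \<in> Cinf \<Longrightarrow> \<kappa> \<in> \<K> \<Longrightarrow> (\<lambda>X. f * \<kappa> X) \<in> \<K>"
    and sep: "\<And>X. X \<in> M \<Longrightarrow> X p \<noteq> 0 \<Longrightarrow> \<exists>\<kappa>\<in>\<K>. \<kappa> X p \<noteq> 0"
    and "finite I"
  shows "e ` I \<subseteq> M \<Longrightarrow> (\<And>c. (\<Sum>i\<in>I. c i *\<^sub>R e i p) = 0 \<Longrightarrow> \<forall>i\<in>I. c i = 0) \<Longrightarrow>
    \<exists>b\<in>Cinf. \<exists>\<kappa>. b p \<noteq> 0 \<and> (\<forall>i\<in>I. \<kappa> i \<in> \<K> \<and> (\<forall>j\<in>I. \<kappa> i (e j) = (if i = j then b else 0)))"
  using \<open>finite I\<close>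
proof (induction I)
  case empty
  show ?case using Cinf_const[of 1] by (intro bexI[of _ "\<lambda>q. 1"]) auto
next
  case (insert k I)
  have mult: "f * g \<in> Cinf" if "f \<in> Cinf" "g \<in> Cinf" for f g
    using Cinf_mult[OF that] by (simp add: times_fun_def)
  have umin: "- f \<in> Cinf" if "f \<in> Cinf" for f
    using Cinf_uminus[OF that] by (simp add: fun_Compl_def)
  have M_sum: "(\<Sum>j\<in>J. f j \<cdot> e j) \<in> M" if "\<And>j. j \<in> J \<Longrightarrow> f j \<in> Cinf" "J \<subseteq> I" for f J
    using that insert.prems(1)
    by (induction J rule: infinite_finite_induct) (auto intro!: M)
  have lin_sum: "\<kappa> (\<Sum>j\<in>J. f j \<cdot> e j) = (\<Sum>j\<in>J. f j * \<kappa> (e j))"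
    if "\<kappa> \<in> \<K>" "\<And>j. j \<in> J \<Longrightarrow> f j \<in> Cinf" "J \<subseteq> I" for \<kappa> f J
  proof -
    have z: "\<kappa> 0 = 0" using lin(2)[OF that(1) M(1) M(1)] by simp
    show ?thesis
      using that(2,3)
    proof (induction J rule: infinite_finite_induct)
      case (insert j J)
      then have "\<kappa> (f j \<cdot> e j + (\<Sum>j\<in>J. f j \<cdot> e j)) = \<kappa> (f j \<cdot> e j) + \<kappa> (\<Sum>j\<in>J. f j \<cdot> e j)"
        using insert.prems \<open>e ` insert k I \<subseteq> M\<close> by (intro lin(2) that(1) M M_sum) auto
      moreover have "\<kappa> (f j \<cdot> e j) = f j * \<kappa> (e j)"
        using insert.prems \<open>e ` insert k I \<subseteq> M\<close> by (intro lin(3) that(1)) auto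
      moreover have "\<kappa> (\<Sum>j\<in>J. f j \<cdot> e j) = (\<Sum>j\<in>J. f j * \<kappa> (e j))"
        using insert.prems by (intro insert.IH) auto
      ultimately show ?case
        by (simp only: sum.insert[OF insert.hyps])
    qed (simp_all add: z)
  qed
  have K_sum: "(\<lambda>X. \<Sum>j\<in>J. f j * \<kappa> j X) \<in> \<K>"
    if "\<And>j. j \<in> J \<Longrightarrow> f j \<in> Cinf" "\<And>j. j \<in> J \<Longrightarrow> \<kappa> j \<in> \<K>" for f \<kappa> and J :: "'i set"
    using that by (induction J rule: infinite_finite_induct) (auto intro!: K)
  have ind: "\<forall>i\<in>I. c i = 0" if "(\<Sum>i\<in>I. c i *\<^sub>R e i p) = 0" for c
  proof -
    have "(\<Sum>i\<in>insert k I. (if i = k then 0 else c i) *\<^sub>R e i p) = (\<Sum>i\<in>I. c i *\<^sub>R e i p)"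
      using insert.hyps by (auto intro!: sum.cong)
    also have "\<dots> = 0" by (rule that)
    finally have "\<forall>i\<in>insert k I. (if i = k then 0 else c i) = 0"
      by (rule insert.prems(2))
    then show ?thesis
      using insert.hyps(2) by (metis insertI2)
  qed
  have IH: "\<exists>b\<in>Cinf. \<exists>\<kappa>. b p \<noteq> 0 \<and>
      (\<forall>i\<in>I. \<kappa> i \<in> \<K> \<and> (\<forall>j\<in>I. \<kappa> i (e j) = (if i = j then b else 0)))"
    by (rule insert.IH[OF _ ind]) (use insert.prems(1) in blast)+
  obtain b \<kappa> where b: "b \<in> Cinf" "b p \<noteq> 0" and \<kappa>: "\<And>i. i \<in> I \<Longrightarrow> \<kappa> i \<in> \<K>"
    and d: "\<And>i j. i \<in> I \<Longrightarrow> j \<in> I \<Longrightarrow> \<kappa> i (e j) = (if i = j then b else 0)"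
    using IH by metis
  have eM: "e j \<in> M" if "j \<in> insert k I" for j
    using insert.prems(1) that by auto
  \<comment> \<open>The field \<open>X\<close> below is \<open>b \<cdot> e k\<close> stripped of its
    components along the \<open>e j\<close>, without dividing by \<open>b\<close>: each
    \<open>\<kappa> i\<close> kills it. It is nonzero at \<open>p\<close> by independence, its
    coefficient at \<open>e k\<close> being \<open>b p\<close>.\<close>
  define c where "c j = - \<kappa> j (e k)" for j
  have c: "c j \<in> Cinf" if "j \<in> I" for j
    using that \<kappa> eM lin(1) umin by (auto simp: c_def)
  define X where "X = b \<cdot> e k + (\<Sum>j\<in>I. c j \<cdot> e j)"
  have XM: "X \<in> M"
    unfolding X_def by (intro M(2,3) M_sum b eM c) auto
  have "X p \<noteq> 0"
  proof
    assume "X p = 0"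
    moreover have "X p = (\<Sum>i\<in>insert k I. (if i = k then b p else c i p) *\<^sub>R e i p)"
      using insert.hyps by (auto simp: X_def sum_fun_apply intro!: sum.cong)
    ultimately have "(\<Sum>i\<in>insert k I. (if i = k then b p else c i p) *\<^sub>R e i p) = 0"
      by (rule trans[OF sym, rotated])
    then have "\<forall>i\<in>insert k I. (if i = k then b p else c i p) = 0"
      by (rule insert.prems(2))
    then show False
      using b(2) by simp
  qed
  then obtain \<mu> where \<mu>: "\<mu> \<in> \<K>" "\<mu> X p \<noteq> 0"
    using sep XM by blast
  define u where "u = \<mu> X"
  have u: "u \<in> Cinf" using lin(1) \<mu>(1) XM by (simp add: u_def)
  have u_eq: "u = b * \<mu> (e k) + (\<Sum>j\<in>I. c j * \<mu> (e j))"
  proof -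
    have "u = \<mu> (b \<cdot> e k) + \<mu> (\<Sum>j\<in>I. c j \<cdot> e j)"
      unfolding u_def X_def by (intro lin(2) \<mu>(1) M M_sum b(1) eM c) auto
    moreover have "\<mu> (b \<cdot> e k) = b * \<mu> (e k)"
      by (intro lin(3) \<mu>(1) b(1) eM) auto
    moreover have "\<mu> (\<Sum>j\<in>I. c j \<cdot> e j) = (\<Sum>j\<in>I. c j * \<mu> (e j))"
      by (intro lin_sum \<mu>(1) c) auto
    ultimately show ?thesis by (simp only:)
  qed
  define \<nu> where "\<nu> Y = b * \<mu> Y + (\<Sum>j\<in>I. - \<mu> (e j) * \<kappa> j Y)" for Y
  have \<nu>K: "\<nu> \<in> \<K>"
    unfolding \<nu>_def
  proof (rule K(2)[OF K(3)[OF b(1) \<mu>(1)] K_sum])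
    show "- \<mu> (e j) \<in> Cinf" if "j \<in> I" for j
      using that by (intro umin lin(1)[OF \<mu>(1) eM]) simp
  qed (rule \<kappa>)
  have \<nu>k: "\<nu> (e k) = u"
    by (simp add: \<nu>_def u_eq c_def algebra_simps)
  have \<nu>I: "\<nu> (e i) = 0" if "i \<in> I" for i
  proof -
    have "(\<Sum>j\<in>I. - \<mu> (e j) * \<kappa> j (e i)) = (\<Sum>j\<in>I. if j = i then - \<mu> (e i) * b else 0)"
      by (intro sum.cong) (auto simp: d that)
    then show ?thesis
      using insert.hyps(1) that by (simp add: \<nu>_def mult.commute)
  qed
  \<comment> \<open>The old functionals are corrected by \<open>\<nu>\<close> so that they vanish on
    \<open>e k\<close>. The factors \<open>u\<close> and \<open>b\<close> bring all diagonal values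
    to the common value \<open>u * b\<close>.\<close>
  define \<kappa>' where "\<kappa>' i = (if i = k then (\<lambda>Y. b * \<nu> Y) else (\<lambda>Y. u * \<kappa> i Y + c i * \<nu> Y))" for i
  have "u * b \<in> Cinf" "(u * b) p \<noteq> 0"
    using mult u b \<mu>(2) by (auto simp: u_def)
  moreover have "\<kappa>' i \<in> \<K>" if "i \<in> insert k I" for i
    using that K(3)[OF b(1) \<nu>K] K(2)[OF K(3)[OF u \<kappa>[of i]] K(3)[OF c[of i] \<nu>K]]
    unfolding \<kappa>'_def by (cases "i = k") auto
  moreover have "\<kappa>' i (e j) = (if i = j then u * b else 0)" if "i \<in> insert k I" "j \<in> insert k I" for i j
    using that insert.hyps(2) by (auto simp: \<kappa>'_def \<nu>I \<nu>k d c_def mult.commute)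
  ultimately show ?case
    by (intro bexI[of _ "u * b"] exI[of _ \<kappa>']) auto
qed

text \<open>One-forms as pointwise linear functionals on the ambient vector space of all
  \<open>'c tvec\<close>; in this encoding the differential of \<open>f\<close> is plain evaluation
  at \<open>f\<close>.\<close>

definition covector_field :: "('c \<Rightarrow> 'c tvec \<Rightarrow> real) \<Rightarrow> bool" where
  "covector_field a \<longleftrightarrow> (\<forall>q. linear (a q)) \<and> (\<forall>Y\<in>vfields. (\<lambda>q. a q (Y q)) \<in> Cinf)"

lemma covector_field_fscale:
  assumes "covector_field a" "f \<in> Cinf"
  shows "covector_field (\<lambda>q v. f q * a q v)"
proof -
  have "linear (\<lambda>v. f q * a q v)" for q
    using linear_compose_scale_right[of "a q" "f q"] assms(1) by (simp add: covector_field_def)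
  then show ?thesis using assms Cinf_mult by (simp add: covector_field_def)
qed

text \<open>The instance of \<open>dual_frame\<close> whose functionals are all those induced by
  covector fields.\<close>

lemma vfields_dual_frame:
  assumes "finite I" "e ` I \<subseteq> vfields"
    and "\<And>c. (\<Sum>i\<in>I. c i *\<^sub>R e i p) = 0 \<Longrightarrow> \<forall>i\<in>I. c i = 0"
  obtains b \<kappa> where "b \<in> Cinf" "b p \<noteq> 0" "\<And>i. i \<in> I \<Longrightarrow> covector_field (\<kappa> i)"
    "\<And>i j q. i \<in> I \<Longrightarrow> j \<in> I \<Longrightarrow> \<kappa> i q (e j q) = (if i = j then b q else 0)"
proof -
  define \<K> where "\<K> = {\<kappa>. \<exists>a. covector_field a \<and> \<kappa> = (\<lambda>Y q. a q (Y q))}"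
  have KE: "\<exists>a. covector_field a \<and> \<kappa> = (\<lambda>Y q. a q (Y q))" if "\<kappa> \<in> \<K>" for \<kappa>
    using that by (simp add: \<K>_def)
  have l1: "\<kappa> X \<in> Cinf" if "\<kappa> \<in> \<K>" "X \<in> vfields" for \<kappa> X
  proof -
    obtain a where "covector_field a" "\<kappa> = (\<lambda>Y q. a q (Y q))" using KE[OF \<open>\<kappa> \<in> \<K>\<close>] by blast
    then show ?thesis using that(2) unfolding covector_field_def by simp
  qed
  have l2: "\<kappa> (X + Y) = \<kappa> X + \<kappa> Y" if "\<kappa> \<in> \<K>" "X \<in> vfields" "Y \<in> vfields" for \<kappa> X Y
  proof -
    obtain a where "covector_field a" "\<kappa> = (\<lambda>Y q. a q (Y q))" using KE[OF \<open>\<kappa> \<in> \<K>\<close>] by blast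
    then show ?thesis unfolding covector_field_def by (simp add: fun_eq_iff linear_add)
  qed
  have l3: "\<kappa> (f \<cdot> X) = f * \<kappa> X" if "\<kappa> \<in> \<K>" "f \<in> Cinf" "X \<in> vfields" for \<kappa> f X
  proof -
    obtain a where "covector_field a" "\<kappa> = (\<lambda>Y q. a q (Y q))" using KE[OF \<open>\<kappa> \<in> \<K>\<close>] by blast
    then show ?thesis unfolding covector_field_def by (simp add: fun_eq_iff linear_scale)
  qed
  have "covector_field (\<lambda>q v. 0)"
    using Cinf_const by (simp add: covector_field_def linear_zero)
  then have k1: "(\<lambda>X. 0) \<in> \<K>"
    by (auto simp: \<K>_def zero_fun_def)
  have k2: "(\<lambda>X. \<kappa> X + \<kappa>' X) \<in> \<K>" if \<kappa>: "\<kappa> \<in> \<K>" "\<kappa>' \<in> \<K>" for \<kappa> \<kappa>'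
  proof -
    obtain a a' where a: "covector_field a" "\<kappa> = (\<lambda>Y q. a q (Y q))"
      "covector_field a'" "\<kappa>' = (\<lambda>Y q. a' q (Y q))"
      using \<kappa> by (auto simp: \<K>_def)
    then have "covector_field (\<lambda>q v. a q v + a' q v)"
      using Cinf_add by (auto simp: covector_field_def intro: linear_compose_add)
    then show ?thesis using a by (auto simp: \<K>_def plus_fun_def)
  qed
  have k3: "(\<lambda>X. f * \<kappa> X) \<in> \<K>" if "f \<in> Cinf" "\<kappa> \<in> \<K>" for f \<kappa>
    using that covector_field_fscale by (fastforce simp: \<K>_def times_fun_def)
  have sep: "\<exists>\<kappa>\<in>\<K>. \<kappa> X p \<noteq> 0" if "X \<in> vfields" "X p \<noteq> 0" for X
  proof -
    obtain f where f: "X p f \<noteq> 0" using \<open>X p \<noteq> 0\<close> by (auto simp: fun_eq_iff)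
    \<comment> \<open>This is the differential of \<open>f\<close>; differentials separate tangent
      vectors.\<close>
    have "covector_field (\<lambda>q v. v f)"
      using vfields_Cinf linear_fun_apply by (auto simp: covector_field_def)
    then have "(\<lambda>Y q. Y q f) \<in> \<K>" by (auto simp: \<K>_def)
    then show ?thesis using f by (intro bexI[of _ "\<lambda>Y q. Y q f"])
  qed
  have "\<exists>b\<in>Cinf. \<exists>\<kappa>. b p \<noteq> 0 \<and> (\<forall>i\<in>I. \<kappa> i \<in> \<K> \<and> (\<forall>j\<in>I. \<kappa> i (e j) = (if i = j then b else 0)))"
    by (rule dual_frame[where M = vfields and \<K> = \<K> and e = e and p = p and I = I])
      (fact vfields_0 vfields_add vfields_fscale l1 l2 l3 k1 k2 k3 sep assms)+
  then obtain b \<kappa> where b: "b \<in> Cinf" "b p \<noteq> 0" "\<And>i. i \<in> I \<Longrightarrow> \<kappa> i \<in> \<K>"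
    and d: "\<And>i j. i \<in> I \<Longrightarrow> j \<in> I \<Longrightarrow> \<kappa> i (e j) = (if i = j then b else 0)"
    by blast
  have "\<forall>i\<in>I. \<exists>a. covector_field a \<and> \<kappa> i = (\<lambda>Y q. a q (Y q))"
    using KE[OF b(3)] by blast
  then obtain a where a: "\<And>i. i \<in> I \<Longrightarrow> covector_field (a i)" "\<And>i. i \<in> I \<Longrightarrow> \<kappa> i = (\<lambda>Y q. a i q (Y q))"
    using bchoice[of I "\<lambda>i a. covector_field a \<and> \<kappa> i = (\<lambda>Y q. a q (Y q))"] by blast
  have "a i q (e j q) = (if i = j then b q else 0)" if "i \<in> I" "j \<in> I" for i j q
    using fun_cong[OF d[OF that], of q] a(2)[OF that(1)] by (simp split: if_splits)
  then show ?thesis using that b a by blast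
qed

text \<open>Sums indexed by the fields in \<open>B\<close> replace span and independence of the
  image set at \<open>q\<close>; injectivity of evaluation at \<open>q\<close> makes the two
  descriptions agree.\<close>

lemma subbundle_local_frame:
  assumes "subbundle W"
  obtains U B where "open U" "p \<in> U" "finite B" "B \<subseteq> vfields"
    "\<And>q w. q \<in> U \<Longrightarrow> w \<in> W q \<longleftrightarrow> (\<exists>c. w = (\<Sum>X\<in>B. c X *\<^sub>R X q))"
    "\<And>q c. q \<in> U \<Longrightarrow> (\<Sum>X\<in>B. c X *\<^sub>R X q) = 0 \<Longrightarrow> \<forall>X\<in>B. c X = 0"
proof -
  obtain U B where U: "open U" "p \<in> U" "finite B" "B \<subseteq> vfields"
    and F: "\<And>q. q \<in> U \<Longrightarrow> inj_on (\<lambda>X. X q) B \<and> independent ((\<lambda>X. X q) ` B) \<and> span ((\<lambda>X. X q) ` B) = W q"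
    using assms unfolding subbundle_def by metis
  have re: "(\<Sum>v\<in>(\<lambda>X. X q) ` B. u v *\<^sub>R v) = (\<Sum>X\<in>B. u (X q) *\<^sub>R X q)" if "q \<in> U" for q u
    using F[OF that] by (simp add: sum.reindex)
  have "w \<in> W q \<longleftrightarrow> (\<exists>c. w = (\<Sum>X\<in>B. c X *\<^sub>R X q))" if q: "q \<in> U" for q w
  proof
    assume "w \<in> W q"
    then have "w \<in> span ((\<lambda>X. X q) ` B)" using F[OF q] by simp
    then obtain u where "w = (\<Sum>v\<in>(\<lambda>X. X q) ` B. u v *\<^sub>R v)"
      using span_finite[of "(\<lambda>X. X q) ` B"] U(3) by auto
    then show "\<exists>c. w = (\<Sum>X\<in>B. c X *\<^sub>R X q)"
      using re[OF q] by (intro exI[of _ "\<lambda>X. u (X q)"]) simp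
  next
    assume "\<exists>c. w = (\<Sum>X\<in>B. c X *\<^sub>R X q)"
    then show "w \<in> W q"
      using F[OF q] by (auto intro!: span_sum span_scale intro: span_base)
  qed
  moreover have "\<forall>X\<in>B. c X = 0" if q: "q \<in> U" and z: "(\<Sum>X\<in>B. c X *\<^sub>R X q) = 0" for q c
  proof -
    have inj: "inj_on (\<lambda>X. X q) B" using F[OF q] by simp
    define u where "u v = c (inv_into B (\<lambda>X. X q) v)" for v
    have u: "u (X q) = c X" if "X \<in> B" for X
      using inv_into_f_f[OF inj that] by (simp add: u_def)
    have "(\<Sum>v\<in>(\<lambda>X. X q) ` B. u v *\<^sub>R v) = 0"
      using re[OF q, of u] z u by simp
    then have "u (X q) = 0" if "X \<in> B" for X
      using independentD[of "(\<lambda>X. X q) ` B" "(\<lambda>X. X q) ` B" u "X q"] F[OF q] U(3) that by auto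
    then show ?thesis using u by auto
  qed
  ultimately show ?thesis by (rule that[OF U])
qed

lemma subbundle_subspace: "subbundle W \<Longrightarrow> subspace (W p)"
  unfolding subbundle_def by (metis subspace_span)

text \<open>A local frame and its dual, multiplied by a bump function. The expansion then holds at
  every point: outside \<open>U\<close> both sides vanish, as the factor sits in \<open>b\<close>
  and in the \<open>e i\<close>.\<close>

lemma subbundle_frame:
  assumes W: "subbundle W"
  obtains b e \<kappa> and I :: "'c vfield set"
    where "b \<in> Cinf" "b p \<noteq> 0" "finite I" "\<And>i. i \<in> I \<Longrightarrow> e i \<in> secs W"
    "\<And>i. i \<in> I \<Longrightarrow> covector_field (\<kappa> i)"
    "\<And>q w. w \<in> W q \<Longrightarrow> b q *\<^sub>R w = (\<Sum>i\<in>I. \<kappa> i q w *\<^sub>R e i q)"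
    "\<And>i j q. i \<in> I \<Longrightarrow> j \<in> I \<Longrightarrow> \<kappa> i q (e j q) = (if i = j then b q else 0)"
proof -
  obtain U B where U: "open U" "p \<in> U" "finite B" "B \<subseteq> vfields"
    and sp: "\<And>q w. q \<in> U \<Longrightarrow> w \<in> W q \<longleftrightarrow> (\<exists>c. w = (\<Sum>X\<in>B. c X *\<^sub>R X q))"
    and ind: "\<And>q c. q \<in> U \<Longrightarrow> (\<Sum>X\<in>B. c X *\<^sub>R X q) = 0 \<Longrightarrow> \<forall>X\<in>B. c X = 0"
    by (rule subbundle_local_frame[OF W, of p]) blast
  obtain b \<kappa> where b: "b \<in> Cinf" "b p \<noteq> 0" and \<kappa>: "\<And>X. X \<in> B \<Longrightarrow> covector_field (\<kappa> X)"
    and d: "\<And>X Y q. X \<in> B \<Longrightarrow> Y \<in> B \<Longrightarrow> \<kappa> X q (Y q) = (if X = Y then b q else 0)"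
    by (rule vfields_dual_frame[OF U(3), of "\<lambda>X. X" p]) (use U ind in auto)
  obtain \<rho> where \<rho>: "\<rho> \<in> Cinf" "\<rho> p \<noteq> 0" "\<And>q. q \<notin> U \<Longrightarrow> \<rho> q = 0"
    using bump[OF U(1,2)] by blast
  have lin: "linear (\<kappa> X q)" if "X \<in> B" for X q
    using \<kappa>[OF that] by (simp add: covector_field_def)
  have "(\<rho> \<cdot> X) q \<in> W q" if "X \<in> B" for X q
  proof (cases "q \<in> U")
    case True
    have "X q = (\<Sum>Y\<in>B. if Y = X then X q else 0)"
      using U(3) that by simp
    also have "\<dots> = (\<Sum>Y\<in>B. (if Y = X then 1 else 0) *\<^sub>R Y q)"
      by (intro sum.cong) auto
    finally have "X q \<in> W q"
      unfolding sp[OF True] by (rule exI[of _ "\<lambda>Y. if Y = X then 1 else 0"])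
    then show ?thesis using subspace_scale[OF subbundle_subspace[OF W]] by simp
  qed (use \<rho>(3) subspace_0[OF subbundle_subspace[OF W]] in auto)
  then have e: "\<rho> \<cdot> X \<in> secs W" if "X \<in> B" for X
    using that U(4) vfields_fscale[OF \<rho>(1)] by (auto simp: secs_def)
  have "(\<rho> q * b q) *\<^sub>R w = (\<Sum>X\<in>B. \<kappa> X q w *\<^sub>R (\<rho> \<cdot> X) q)" if w: "w \<in> W q" for q w
  proof (cases "q \<in> U")
    case True
    obtain c where c: "w = (\<Sum>X\<in>B. c X *\<^sub>R X q)" using sp[OF True] w by blast
    have "\<kappa> X q w = c X * b q" if X: "X \<in> B" for X
    proof -
      have "\<kappa> X q w = (\<Sum>Y\<in>B. c Y * \<kappa> X q (Y q))"
        using linear_sum[OF lin[OF X, of q], of _ B] linear_scale[OF lin[OF X, of q]] c by simp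
      also have "\<dots> = (\<Sum>Y\<in>B. if Y = X then c X * b q else 0)"
        by (intro sum.cong) (auto simp: d X)
      finally show ?thesis using U(3) X by simp
    qed
    then show ?thesis
      by (simp add: c scaleR_sum_right mult_ac)
  qed (use \<rho>(3) in auto)
  moreover have "\<kappa> X q ((\<rho> \<cdot> Y) q) = (if X = Y then \<rho> q * b q else 0)" if "X \<in> B" "Y \<in> B" for X Y q
    using d[OF that] linear_scale[OF lin[OF that(1)]] by simp
  ultimately show ?thesis
    using that[of "\<lambda>q. \<rho> q * b q" B "\<lambda>X. \<rho> \<cdot> X" \<kappa>] \<rho> b \<kappa> e U(3) Cinf_mult by auto
qed

end

section \<open>The curvature and the characteristic foliation\<close>

context smooth_manifold
begin

lemma bracket_sum_left:
  assumes "Y \<in> vfields" "\<And>i. i \<in> I \<Longrightarrow> e i \<in> vfields"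
  shows "(\<Sum>i\<in>I. e i) \<in> vfields \<and> bracket (\<Sum>i\<in>I. e i) Y = (\<Sum>i\<in>I. bracket (e i) Y)"
  using assms(2)
proof (induction I rule: infinite_finite_induct)
  case (insert i I)
  then have 1: "e i \<in> vfields" "(\<Sum>i\<in>I. e i) \<in> vfields" "bracket (\<Sum>i\<in>I. e i) Y = (\<Sum>i\<in>I. bracket (e i) Y)"
    by blast+
  show ?case
    unfolding sum.insert[OF insert.hyps] bracket_add_left[OF assms(1) 1(1,2)] 1(3)
    using vfields_add[OF 1(1,2)] by blast
qed (auto simp: vfields_0 bracket_0_left[OF assms(1)])

lemma secs_sum:
  assumes "\<And>p. subspace (W p)" "\<And>i. i \<in> I \<Longrightarrow> e i \<in> secs W"
  shows "(\<Sum>i\<in>I. e i) \<in> secs W"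
  using assms(2)
proof (induction I rule: infinite_finite_induct)
  case (insert i I)
  then show ?case
    unfolding sum.insert[OF insert.hyps] using secs_closed(2)[of W, OF assms(1)] by blast
qed (simp_all add: secs_closed(1)[of W, OF assms(1)])

end

context hyperplane_manifold
begin

section \<open>The hyperplane distribution and a local defining one-form\<close>

lemma subbundle_xi: "subbundle \<xi>"
  using hyperplane by (simp add: hyperplane_distribution_def)

lemma subspace_xi: "subspace (\<xi> p)"
  by (rule subbundle_subspace[OF subbundle_xi])

lemma tangent_not_subset_xi: obtains v where "v \<in> tangent p" "v \<notin> \<xi> p"
  using hyperplane unfolding hyperplane_distribution_def by blast

lemma tangent_mod_xi:
  assumes "u \<in> tangent p" "u \<notin> \<xi> p" "w \<in> tangent p"
  obtains a where "w - a *\<^sub>R u \<in> \<xi> p"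
proof -
  obtain v where v: "v \<in> tangent p" "v \<notin> \<xi> p" "tangent p = span (insert v (\<xi> p))"
    using hyperplane unfolding hyperplane_distribution_def by blast
  have sp: "span (\<xi> p) = \<xi> p"
    using subspace_xi span_eq_iff by blast
  obtain c where c: "u - c *\<^sub>R v \<in> \<xi> p"
    using assms(1) v(3) span_breakdown_eq[of u v "\<xi> p"] sp by auto
  obtain d where d: "w - d *\<^sub>R v \<in> \<xi> p"
    using assms(3) v(3) span_breakdown_eq[of w v "\<xi> p"] sp by auto
  have "c \<noteq> 0" using c assms(2) by auto
  have "w - (d / c) *\<^sub>R u = (w - d *\<^sub>R v) - (d / c) *\<^sub>R (u - c *\<^sub>R v)"
    using \<open>c \<noteq> 0\<close> by (simp add: scaleR_diff_right)
  also have "\<dots> \<in> \<xi> p"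
    using subspace_diff[OF subspace_xi d subspace_scale[OF subspace_xi c]] .
  finally show ?thesis by (rule that)
qed

lemma xi_tangent: "w \<in> \<xi> p \<Longrightarrow> w \<in> tangent p"
  using hyperplane unfolding hyperplane_distribution_def by (metis insertCI span_base)

text \<open>Adding \<open>g\<close> to a frame of \<open>\<xi>\<close> near \<open>p\<close> and
  passing to the dual frame, the functional dual to \<open>g\<close> defines \<open>\<xi>\<close>
  there. Up to the factor \<open>b\<close>, \<open>\<alpha>\<close> is the contact form in the
  trivialisation of \<ell> by the class of \<open>g\<close>.\<close>

lemma conormal:
  assumes g: "g \<in> vfields" "g p \<notin> \<xi> p"
  obtains b \<alpha> where "b \<in> Cinf" "b p \<noteq> 0" "covector_field \<alpha>"
    "\<And>q w. w \<in> \<xi> q \<Longrightarrow> \<alpha> q w = 0" "\<And>q. \<alpha> q (g q) = b q"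
    "\<And>q w. w \<in> tangent q \<Longrightarrow> b q *\<^sub>R w - \<alpha> q w *\<^sub>R g q \<in> \<xi> q"
proof -
  obtain U B where U: "open U" "p \<in> U" "finite B" "B \<subseteq> vfields"
    and sp: "\<And>q w. q \<in> U \<Longrightarrow> w \<in> \<xi> q \<longleftrightarrow> (\<exists>c. w = (\<Sum>X\<in>B. c X *\<^sub>R X q))"
    and ind: "\<And>q c. q \<in> U \<Longrightarrow> (\<Sum>X\<in>B. c X *\<^sub>R X q) = 0 \<Longrightarrow> \<forall>X\<in>B. c X = 0"
    by (rule subbundle_local_frame[OF subbundle_xi, of p]) blast
  have "g \<notin> B"
  proof
    assume "g \<in> B"
    have "g p = (\<Sum>Y\<in>B. if Y = g then g p else 0)"
      using U(3) \<open>g \<in> B\<close> by simp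
    also have "\<dots> = (\<Sum>Y\<in>B. (if Y = g then 1 else 0) *\<^sub>R Y p)"
      by (intro sum.cong) auto
    finally have "g p \<in> \<xi> p"
      unfolding sp[OF U(2)] by (rule exI[of _ "\<lambda>Y. if Y = g then 1 else 0"])
    then show False using g(2) by simp
  qed
  have fin: "finite (insert g B)" "(\<lambda>X. X) ` insert g B \<subseteq> vfields"
    using U(3,4) g(1) by auto
  have ind': "\<forall>X\<in>insert g B. c X = 0" if z: "(\<Sum>X\<in>insert g B. c X *\<^sub>R X p) = 0" for c
  proof -
    have s: "c g *\<^sub>R g p + (\<Sum>X\<in>B. c X *\<^sub>R X p) = 0"
      using z unfolding sum.insert[OF U(3) \<open>g \<notin> B\<close>] .
    have x: "(\<Sum>X\<in>B. c X *\<^sub>R X p) \<in> \<xi> p"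
      unfolding sp[OF U(2)] by blast
    have cg: "c g = 0"
    proof (rule ccontr)
      assume "c g \<noteq> 0"
      have "c g *\<^sub>R g p = - (\<Sum>X\<in>B. c X *\<^sub>R X p)"
        using s by (rule eq_neg_iff_add_eq_0[THEN iffD2])
      then have "c g *\<^sub>R g p \<in> \<xi> p"
        using subspace_neg[OF subspace_xi x] by metis
      then have "inverse (c g) *\<^sub>R c g *\<^sub>R g p \<in> \<xi> p"
        by (rule subspace_scale[OF subspace_xi])
      then show False using g(2) \<open>c g \<noteq> 0\<close> by simp
    qed
    have "(\<Sum>X\<in>B. c X *\<^sub>R X p) = 0"
      using s unfolding cg scaleR_zero_left add_0_left .
    then show ?thesis using ind[OF U(2)] cg by blast
  qed
  obtain b \<kappa> where b: "b \<in> Cinf" "b p \<noteq> 0" and \<kappa>: "\<And>X. X \<in> insert g B \<Longrightarrow> covector_field (\<kappa> X)"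
    and d: "\<And>X Y q. X \<in> insert g B \<Longrightarrow> Y \<in> insert g B \<Longrightarrow> \<kappa> X q (Y q) = (if X = Y then b q else 0)"
    by (rule vfields_dual_frame[OF fin ind']) blast+
  obtain \<rho> where \<rho>: "\<rho> \<in> Cinf" "\<rho> p \<noteq> 0" "\<And>q. q \<notin> U \<Longrightarrow> \<rho> q = 0"
    using bump[OF U(1,2)] by blast
  \<comment> \<open>The bump \<open>\<rho>\<close> disposes of points outside \<open>U\<close>. The
    extra factor \<open>b\<close> disposes of points of \<open>U\<close> where \<open>b\<close>
    vanishes: there \<open>g\<close> might be tangent to \<open>\<xi>\<close>, and with this factor
    both \<open>\<alpha>\<close> and \<open>b'\<close> are zero.\<close>
  define \<alpha> where "\<alpha> q w = (\<rho> q * b q) * \<kappa> g q w" for q w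
  define b' where "b' q = (\<rho> q * b q) * b q" for q
  have lin: "linear (\<kappa> g q)" for q
    using \<kappa>[of g] by (simp add: covector_field_def)
  have k0: "\<kappa> g q w = 0" if q: "q \<in> U" and w: "w \<in> \<xi> q" for q w
  proof -
    obtain c where c: "w = (\<Sum>X\<in>B. c X *\<^sub>R X q)" using sp[OF q] w by blast
    have "\<kappa> g q w = (\<Sum>Y\<in>B. c Y * \<kappa> g q (Y q))"
      using linear_sum[OF lin[of q], of _ B] linear_scale[OF lin[of q]] c by simp
    also have "\<dots> = 0"
      using d[of g] \<open>g \<notin> B\<close> by (intro sum.neutral) auto
    finally show ?thesis .
  qed
  show ?thesis
  proof
    show "b' \<in> Cinf" unfolding b'_def[abs_def] by (intro Cinf_mult \<rho> b)
    show "b' p \<noteq> 0" using b \<rho> by (simp add: b'_def)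
    show "covector_field \<alpha>"
      unfolding \<alpha>_def[abs_def] by (intro covector_field_fscale \<kappa> Cinf_mult \<rho> b) simp
    show "\<alpha> q w = 0" if "w \<in> \<xi> q" for q w
      using k0[OF _ that] \<rho>(3) by (cases "q \<in> U") (auto simp: \<alpha>_def)
    show "\<alpha> q (g q) = b' q" for q
      using d[of g g q] by (simp add: \<alpha>_def b'_def)
    show "b' q *\<^sub>R w - \<alpha> q w *\<^sub>R g q \<in> \<xi> q" if w: "w \<in> tangent q" for q w
    proof (cases "q \<in> U \<and> b q \<noteq> 0")
      case True
      have "g q \<notin> \<xi> q"
        using k0[of q "g q"] True d[of g g q] by auto
      then obtain a where a: "w - a *\<^sub>R g q \<in> \<xi> q"
        using tangent_mod_xi[OF vfields_tangent[OF g(1)] _ w] by blast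
      have "\<kappa> g q w = a * b q"
        using k0[OF conjunct1[OF True] a] d[of g g q] by (simp add: linear_diff[OF lin] linear_scale[OF lin])
      then have "b' q *\<^sub>R w - \<alpha> q w *\<^sub>R g q = (\<rho> q * b q * b q) *\<^sub>R (w - a *\<^sub>R g q)"
        by (simp add: \<alpha>_def b'_def scaleR_diff_right mult_ac)
      then show ?thesis using subspace_scale[OF subspace_xi a] by metis
    next
      case False
      then have r: "\<rho> q * b q = 0" using \<rho>(3) by auto
      have "b' q *\<^sub>R w - \<alpha> q w *\<^sub>R g q = 0"
        unfolding \<alpha>_def b'_def r by simp
      then show ?thesis using subspace_0[OF subspace_xi] by metis
    qed
  qed
qed

text \<open>The coefficient of \<open>\<theta> Y\<close> with respect to \<open>\<theta> g\<close>
  is the quotient of \<open>\<alpha>\<close> on \<open>Y\<close> by \<open>b\<close>; this is its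
  division-free form.\<close>

lemma conormal_theta:
  assumes "Y \<in> vfields" "\<And>q w. w \<in> tangent q \<Longrightarrow> b q *\<^sub>R w - \<alpha> q w *\<^sub>R g q \<in> \<xi> q"
  shows "b \<cdot> \<theta> Y = (\<lambda>q. \<alpha> q (Y q)) \<cdot> \<theta> g"
proof
  fix q
  have "quot (\<xi> q) (b q *\<^sub>R Y q) = quot (\<xi> q) (\<alpha> q (Y q) *\<^sub>R g q)"
    using assms(2)[OF vfields_tangent[OF assms(1)]] quot_eq_iff[OF subspace_xi] by blast
  then show "(b \<cdot> \<theta> Y) q = ((\<lambda>q. \<alpha> q (Y q)) \<cdot> \<theta> g) q"
    by (simp add: cls_def linear_scale[OF linear_quot])
qed

lemma theta_eq_0_at: "\<theta> X p = 0 \<longleftrightarrow> X p \<in> \<xi> p"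
  by (rule cls_eq_0_at[of \<xi>, OF subspace_xi])

lemma theta_eq_0: "X \<in> secs \<xi> \<Longrightarrow> \<theta> X = 0"
  using cls_eq_0[of \<xi>, OF subspace_xi secs_vfields] by blast

lemma omega_swap: "\<omega> X Y = - \<omega> Y X"
  unfolding \<omega>_def by (subst bracket_swap) (rule cls_uminus)

lemma omega_add_left:
  "X \<in> vfields \<Longrightarrow> X' \<in> vfields \<Longrightarrow> Y \<in> vfields \<Longrightarrow> \<omega> (X + X') Y = \<omega> X Y + \<omega> X' Y"
  by (simp only: \<omega>_def bracket_add_left cls_add)

lemma omega_diff_left:
  "X \<in> vfields \<Longrightarrow> X' \<in> vfields \<Longrightarrow> Y \<in> vfields \<Longrightarrow> \<omega> (X - X') Y = \<omega> X Y - \<omega> X' Y"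
  by (simp only: \<omega>_def bracket_diff_left cls_diff)

lemma omega_add_right:
  "X \<in> vfields \<Longrightarrow> X' \<in> vfields \<Longrightarrow> Y \<in> vfields \<Longrightarrow> \<omega> Y (X + X') = \<omega> Y X + \<omega> Y X'"
  by (simp only: \<omega>_def bracket_add_right cls_add)

text \<open>The derivative of \<open>f\<close> multiplies \<open>\<theta> X\<close>, which is zero,
  so it is the scaled argument that has to lie in \<open>\<xi>\<close>.\<close>

lemma omega_fscale_left:
  assumes "X \<in> secs \<xi>" "Y \<in> vfields" "f \<in> Cinf"
  shows "\<omega> (f \<cdot> X) Y = f \<cdot> \<omega> X Y"
proof -
  have "(\<lambda>p. Y p f) \<cdot> \<theta> X = 0"
    unfolding theta_eq_0[OF assms(1)] by (rule ext) simp
  then show ?thesis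
    unfolding \<omega>_def bracket_fscale_left[OF assms(2) secs_vfields[OF assms(1)] assms(3)] cls_diff cls_fscale
    by simp
qed

lemma omega_fscale_right:
  assumes "X \<in> secs \<xi>" "Y \<in> vfields" "f \<in> Cinf"
  shows "\<omega> Y (f \<cdot> X) = f \<cdot> \<omega> Y X"
  unfolding omega_swap[of Y] omega_fscale_left[OF assms] by (rule ext) simp

text \<open>In a frame of \<open>\<xi>\<close> the coefficients of \<open>b \<cdot> X\<close> vanish
  at \<open>p\<close>, and \<open>\<omega>\<close> is linear over \<open>Cinf\<close> in this
  argument.\<close>

lemma omega_tensorial:
  assumes X: "X \<in> secs \<xi>" "X p = 0" and Y: "Y \<in> vfields"
  shows "\<omega> X Y p = 0"
proof -
  obtain b e \<kappa> and I :: "'c vfield set" where b: "b \<in> Cinf" "b p \<noteq> 0" "finite I"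
    and e: "\<And>i. i \<in> I \<Longrightarrow> e i \<in> secs \<xi>" and \<kappa>: "\<And>i. i \<in> I \<Longrightarrow> covector_field (\<kappa> i)"
    and fr: "\<And>q w. w \<in> \<xi> q \<Longrightarrow> b q *\<^sub>R w = (\<Sum>i\<in>I. \<kappa> i q w *\<^sub>R e i q)"
    by (rule subbundle_frame[OF subbundle_xi, of p]) blast
  define c where "c i q = \<kappa> i q (X q)" for i q
  have c: "c i \<in> Cinf" "c i p = 0" if "i \<in> I" for i
    using \<kappa>[OF that] secs_vfields[OF X(1)] linear_0[of "\<kappa> i p"]
    unfolding covector_field_def c_def[abs_def] X(2) by auto
  have ce: "c i \<cdot> e i \<in> vfields" if "i \<in> I" for i
    using vfields_fscale c e secs_vfields that by blast
  have bX: "b \<cdot> X = (\<Sum>i\<in>I. c i \<cdot> e i)"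
    using fr[OF secs_at[OF X(1)]] by (intro ext) (simp add: sum_fun_apply c_def)
  have "b p *\<^sub>R \<omega> X Y p = \<omega> (b \<cdot> X) Y p"
    by (simp add: omega_fscale_left[OF X(1) Y b(1)])
  also have "\<dots> = quot (\<xi> p) (\<Sum>i\<in>I. bracket (c i \<cdot> e i) Y p)"
    using bracket_sum_left[OF Y, of I "\<lambda>i. c i \<cdot> e i"] ce
    by (simp add: \<omega>_def bX cls_def sum_fun_apply)
  also have "\<dots> = (\<Sum>i\<in>I. \<omega> (c i \<cdot> e i) Y p)"
    by (simp add: linear_sum[OF linear_quot] \<omega>_def cls_def)
  also have "\<dots> = 0"
    using c e by (intro sum.neutral) (simp add: omega_fscale_left[OF _ Y])
  finally show ?thesis using b(2) by simp
qed

text \<open>By tensoriality the section chosen in the definition of \<open>TF\<close> may be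
  exchanged for any other one with the same value at \<open>p\<close>.\<close>

lemma TF_at:
  assumes "X \<in> secs \<xi>"
  shows "X p \<in> TF p \<longleftrightarrow> (\<forall>Y\<in>secs \<xi>. \<omega> X Y p = 0)"
proof
  assume "X p \<in> TF p"
  then obtain X' where X': "X p = X' p" "X' \<in> secs \<xi>" "\<And>Y. Y \<in> secs \<xi> \<Longrightarrow> \<omega> X' Y p = 0"
    unfolding TF_def by blast
  show "\<forall>Y\<in>secs \<xi>. \<omega> X Y p = 0"
  proof
    fix Y assume Y: "Y \<in> secs \<xi>"
    have "\<omega> (X - X') Y p = 0"
      using X'(1) by (intro omega_tensorial secs_closed(3)[of \<xi>, OF subspace_xi] assms X'(2) secs_vfields[OF Y]) simp
    then show "\<omega> X Y p = 0"
      using omega_diff_left[OF secs_vfields[OF assms] secs_vfields[OF X'(2)] secs_vfields[OF Y]] X'(3)[OF Y]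
      by simp
  qed
qed (use assms in \<open>auto simp: TF_def\<close>)

lemma TF_subset_xi: "w \<in> TF p \<Longrightarrow> w \<in> \<xi> p"
  unfolding TF_def using secs_at by blast

lemma subspace_TF: "subspace (TF p)"
proof (rule subspaceI)
  have "0 \<in> secs \<xi>" by (rule secs_closed(1)[of \<xi>, OF subspace_xi])
  then have "(0 :: 'c vfield) p \<in> TF p"
    using omega_tensorial[OF \<open>0 \<in> secs \<xi>\<close>] secs_vfields by (subst TF_at) auto
  then show "0 \<in> TF p" by simp
next
  fix x y assume "x \<in> TF p" "y \<in> TF p"
  then obtain X Y where X: "x = X p" "X \<in> secs \<xi>" "\<And>Z. Z \<in> secs \<xi> \<Longrightarrow> \<omega> X Z p = 0"
    and Y: "y = Y p" "Y \<in> secs \<xi>" "\<And>Z. Z \<in> secs \<xi> \<Longrightarrow> \<omega> Y Z p = 0"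
    unfolding TF_def by blast
  have XY: "X + Y \<in> secs \<xi>" by (rule secs_closed(2)[of \<xi>, OF subspace_xi X(2) Y(2)])
  have "(X + Y) p \<in> TF p"
    using X Y secs_vfields by (subst TF_at[OF XY]) (simp add: omega_add_left)
  then show "x + y \<in> TF p" using X(1) Y(1) by simp
next
  fix c x assume "x \<in> TF p"
  then obtain X where X: "x = X p" "X \<in> secs \<xi>" "\<And>Z. Z \<in> secs \<xi> \<Longrightarrow> \<omega> X Z p = 0"
    unfolding TF_def by blast
  have cX: "(\<lambda>q. c) \<cdot> X \<in> secs \<xi>" by (rule secs_closed(4)[of \<xi>, OF subspace_xi Cinf_const X(2)])
  have "((\<lambda>q. c) \<cdot> X) p \<in> TF p"
    using X secs_vfields by (subst TF_at[OF cX]) (simp add: omega_fscale_left Cinf_const)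
  then show "c *\<^sub>R x \<in> TF p" using X(1) by simp
qed

lemma GTF_secs_xi: "X \<in> \<Gamma>TF \<Longrightarrow> X \<in> secs \<xi>"
  unfolding secs_def using TF_subset_xi by blast

lemma GTF_iff:
  assumes "X \<in> secs \<xi>"
  shows "X \<in> \<Gamma>TF \<longleftrightarrow> (\<forall>Y\<in>secs \<xi>. \<omega> X Y = 0)"
proof -
  have "X \<in> \<Gamma>TF \<longleftrightarrow> (\<forall>p. X p \<in> TF p)"
    using secs_vfields[OF assms] by (simp add: secs_def[of TF])
  also have "\<dots> \<longleftrightarrow> (\<forall>Y\<in>secs \<xi>. \<forall>p. \<omega> X Y p = 0)"
    using TF_at[OF assms] by blast
  finally show ?thesis
    by (simp add: fun_eq_iff[of "\<omega> _ _"])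
qed

lemma bracket_GTF_xi:
  assumes "X \<in> \<Gamma>TF" "Y \<in> secs \<xi>"
  shows "bracket X Y \<in> secs \<xi>"
  using GTF_iff[OF GTF_secs_xi[OF assms(1)]] assms
    cls_eq_0[of \<xi>, OF subspace_xi bracket_vfields[OF secs_vfields[OF assms(1)] secs_vfields[OF assms(2)]]]
  unfolding \<omega>_def by blast

text \<open>By the Jacobi identity the bracket of \<open>bracket X Y\<close> with a section of
  \<open>\<xi>\<close> is a difference of iterated brackets, and these stay in \<open>\<xi>\<close>
  because \<open>X\<close> and \<open>Y\<close> preserve it.\<close>

lemma GTF_involutive:
  assumes X: "X \<in> \<Gamma>TF" and Y: "Y \<in> \<Gamma>TF"
  shows "bracket X Y \<in> \<Gamma>TF"
proof -
  have XY: "bracket X Y \<in> secs \<xi>"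
    using bracket_GTF_xi[OF X GTF_secs_xi[OF Y]] .
  have "\<omega> (bracket X Y) Z = 0" if Z: "Z \<in> secs \<xi>" for Z
  proof -
    have "bracket X (bracket Y Z) - bracket Y (bracket X Z) \<in> secs \<xi>"
      by (intro secs_closed(3)[of \<xi>, OF subspace_xi] bracket_GTF_xi X Y Z)
    then show ?thesis
      unfolding \<omega>_def bracket_Jacobi[OF secs_vfields[OF X] secs_vfields[OF Y] secs_vfields[OF Z]]
      by (rule theta_eq_0)
  qed
  then show ?thesis using GTF_iff[OF XY] by blast
qed

text \<open>The \<open>THE\<close> in \<open>nabla\<close> is well defined because bracketing with
  \<open>X\<close> preserves the sections of \<open>W\<close>, so two representatives give the same
  class.\<close>

lemma nabla_cls:
  assumes W: "\<And>p. subspace (W p)" and X: "X \<in> \<Gamma>TF"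
    and inv: "\<And>Y. Y \<in> secs W \<Longrightarrow> bracket X Y \<in> secs W" and Y: "Y \<in> vfields"
  shows "nabla W X (cls W Y) = cls W (bracket X Y)"
  unfolding nabla_def
proof (rule the_equality)
  show "\<exists>Y'\<in>vfields. cls W Y = cls W Y' \<and> cls W (bracket X Y) = cls W (bracket X Y')"
    using Y by blast
  fix t assume "\<exists>Y'\<in>vfields. cls W Y = cls W Y' \<and> t = cls W (bracket X Y')"
  then obtain Y' where Y': "Y' \<in> vfields" "cls W Y = cls W Y'" "t = cls W (bracket X Y')"
    by blast
  have "bracket X (Y - Y') \<in> secs W"
    using Y'(2) cls_eq_iff[of W Y Y', OF W Y Y'(1)] inv by blast
  then have "bracket X Y - bracket X Y' \<in> secs W"
    unfolding bracket_diff_right[OF secs_vfields[OF X] Y Y'(1)] .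
  then show "t = cls W (bracket X Y)"
    using cls_eq_iff[of W "bracket X Y" "bracket X Y'", OF W] Y Y' bracket_vfields[OF secs_vfields[OF X]] by metis
qed

lemma nabla_xi: "X \<in> \<Gamma>TF \<Longrightarrow> Y \<in> vfields \<Longrightarrow> nabla \<xi> X (\<theta> Y) = \<theta> (bracket X Y)"
  by (rule nabla_cls[of \<xi>, OF subspace_xi _ bracket_GTF_xi])

lemma nabla_TF: "X \<in> \<Gamma>TF \<Longrightarrow> Y \<in> vfields \<Longrightarrow> nabla TF X (cls TF Y) = cls TF (bracket X Y)"
  by (rule nabla_cls[of TF, OF subspace_TF _ GTF_involutive])

end

section \<open>Duality for the reduced distribution\<close>

locale complemented_manifold = hyperplane_manifold A \<xi>
  for A :: "('c::{t2_space, second_countable_topology}, 'e::euclidean_space) atlas"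
    and \<xi> :: "'c \<Rightarrow> 'c tvec set" +
  fixes G :: "'c \<Rightarrow> 'c tvec set"
  assumes complement_G: "complement G"
begin

abbreviation H :: "'c \<Rightarrow> 'c tvec set" where "H p \<equiv> \<xi> p \<inter> G p"

lemma subbundle_G: "subbundle G"
  using complement_G by (simp add: complement_def)

lemma subspace_G: "subspace (G p)"
  by (rule subbundle_subspace[OF subbundle_G])

lemma subspace_H: "subspace (\<xi> p \<inter> G p)"
  by (rule subspace_inter[OF subspace_xi subspace_G])

lemmas secs_xi = secs_closed[of \<xi>, OF subspace_xi]
lemmas secs_TF = secs_closed[of TF, OF subspace_TF]
lemmas secs_G = secs_closed[of G, OF subspace_G]
lemmas secs_H = secs_closed[of H, OF subspace_H]

lemma secs_HD: "X \<in> secs H \<Longrightarrow> X \<in> secs \<xi>" "X \<in> secs H \<Longrightarrow> X \<in> secs G"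
  by (auto simp: secs_def)

lemma secs_HI: "X \<in> secs \<xi> \<Longrightarrow> X \<in> secs G \<Longrightarrow> X \<in> secs H"
  by (auto simp: secs_def)

lemma TF_G_disjoint: "w \<in> TF p \<Longrightarrow> w \<in> G p \<Longrightarrow> w = 0"
  using complement_G unfolding complement_def by blast

lemma tangent_split:
  assumes "w \<in> tangent p"
  obtains a b where "a \<in> TF p" "b \<in> G p" "w = a + b"
  using complement_G assms unfolding complement_def by blast

lemma GTF_G_disjoint:
  assumes "X \<in> \<Gamma>TF" "X \<in> secs G"
  shows "X = 0"
  using TF_G_disjoint[OF secs_at[OF assms(1)] secs_at[OF assms(2)]] by (intro ext) simp

text \<open>Some member of the frame is transversal to \<open>\<xi>\<close> at \<open>p\<close>:
  otherwise \<open>\<xi> p\<close> would contain \<open>G p\<close> besides \<open>TF p\<close>,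
  hence the whole tangent space.\<close>

lemma G_frame:
  obtains b e \<kappa> g and I :: "'c vfield set"
    where "b \<in> Cinf" "b p \<noteq> 0" "finite I" "\<And>i. i \<in> I \<Longrightarrow> e i \<in> secs G"
    "\<And>i. i \<in> I \<Longrightarrow> covector_field (\<kappa> i)"
    "\<And>q w. w \<in> G q \<Longrightarrow> b q *\<^sub>R w = (\<Sum>i\<in>I. \<kappa> i q w *\<^sub>R e i q)"
    "\<And>i j q. i \<in> I \<Longrightarrow> j \<in> I \<Longrightarrow> \<kappa> i q (e j q) = (if i = j then b q else 0)"
    "g \<in> I" "e g p \<notin> \<xi> p"
proof -
  obtain b e \<kappa> and I :: "'c vfield set" where b: "b \<in> Cinf" "b p \<noteq> 0" "finite I"
    and e: "\<And>i. i \<in> I \<Longrightarrow> e i \<in> secs G" and \<kappa>: "\<And>i. i \<in> I \<Longrightarrow> covector_field (\<kappa> i)"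
    and fr: "\<And>q w. w \<in> G q \<Longrightarrow> b q *\<^sub>R w = (\<Sum>i\<in>I. \<kappa> i q w *\<^sub>R e i q)"
    and d: "\<And>i j q. i \<in> I \<Longrightarrow> j \<in> I \<Longrightarrow> \<kappa> i q (e j q) = (if i = j then b q else 0)"
    by (rule subbundle_frame[OF subbundle_G, of p]) blast
  have "\<exists>g\<in>I. e g p \<notin> \<xi> p"
  proof (rule ccontr)
    assume "\<not> ?thesis"
    then have sum: "(\<Sum>i\<in>I. \<kappa> i p w *\<^sub>R e i p) \<in> \<xi> p" for w
      by (intro subspace_sum[OF subspace_xi] subspace_scale[OF subspace_xi]) blast
    have G\<xi>: "w \<in> \<xi> p" if "w \<in> G p" for w
    proof -
      have "inverse (b p) *\<^sub>R (b p *\<^sub>R w) \<in> \<xi> p"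
        unfolding fr[OF that] by (rule subspace_scale[OF subspace_xi sum])
      then show ?thesis using b(2) by simp
    qed
    obtain v where v: "v \<in> tangent p" "v \<notin> \<xi> p"
      by (rule tangent_not_subset_xi)
    obtain a c where "a \<in> TF p" "c \<in> G p" "v = a + c"
      by (rule tangent_split[OF v(1)])
    then show False
      using v(2) subspace_add[OF subspace_xi TF_subset_xi G\<xi>] by metis
  qed
  then obtain g where g: "g \<in> I" "e g p \<notin> \<xi> p" by blast
  show ?thesis by (rule that[of b I e \<kappa> g]) (fact b e \<kappa> fr d g)+
qed

lemma transversal_section: obtains g where "g \<in> secs G" "g p \<notin> \<xi> p"
proof -
  obtain e g and I :: "'c vfield set" where "\<And>i. i \<in> I \<Longrightarrow> e i \<in> secs G" "g \<in> I" "e g p \<notin> \<xi> p"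
    by (rule G_frame[of p]) blast
  then show ?thesis using that[of "e g"] by simp
qed

text \<open>The fields of a frame of \<open>G\<close> are projected into \<open>\<xi>\<close> along
  the transversal member \<open>e g\<close>, with \<open>b1\<close> as cleared denominator. The
  projection of \<open>e g\<close> itself is zero and is dropped; on vectors of \<open>\<xi>\<close>
  the subtracted term disappears, so the old coefficients remain valid.\<close>

lemma H_frame:
  obtains b h \<kappa> and I :: "'c vfield set"
    where "b \<in> Cinf" "b p \<noteq> 0" "finite I" "\<And>i. i \<in> I \<Longrightarrow> h i \<in> secs H"
    "\<And>i. i \<in> I \<Longrightarrow> covector_field (\<kappa> i)"
    "\<And>q w. w \<in> H q \<Longrightarrow> b q *\<^sub>R w = (\<Sum>i\<in>I. \<kappa> i q w *\<^sub>R h i q)"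
    "\<And>c. (\<Sum>i\<in>I. c i *\<^sub>R h i p) = 0 \<Longrightarrow> \<forall>i\<in>I. c i = 0"
proof -
  obtain b0 e \<kappa> g and I :: "'c vfield set" where b0: "b0 \<in> Cinf" "b0 p \<noteq> 0" "finite I"
    and e: "\<And>i. i \<in> I \<Longrightarrow> e i \<in> secs G" and \<kappa>: "\<And>i. i \<in> I \<Longrightarrow> covector_field (\<kappa> i)"
    and fr: "\<And>q w. w \<in> G q \<Longrightarrow> b0 q *\<^sub>R w = (\<Sum>i\<in>I. \<kappa> i q w *\<^sub>R e i q)"
    and d: "\<And>i j q. i \<in> I \<Longrightarrow> j \<in> I \<Longrightarrow> \<kappa> i q (e j q) = (if i = j then b0 q else 0)"
    and g: "g \<in> I" "e g p \<notin> \<xi> p"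
    by (rule G_frame[of p]) blast
  have ev: "e i \<in> vfields" if "i \<in> I" for i
    by (rule secs_vfields[OF e[OF that]])
  obtain b1 \<alpha> where b1: "b1 \<in> Cinf" "b1 p \<noteq> 0" and \<alpha>: "covector_field \<alpha>"
    and \<alpha>0: "\<And>q w. w \<in> \<xi> q \<Longrightarrow> \<alpha> q w = 0" and \<alpha>g: "\<And>q. \<alpha> q (e g q) = b1 q"
    and \<alpha>\<xi>: "\<And>q w. w \<in> tangent q \<Longrightarrow> b1 q *\<^sub>R w - \<alpha> q w *\<^sub>R e g q \<in> \<xi> q"
    by (rule conormal[OF ev[OF g(1)] g(2)]) blast
  have \<alpha>_Cinf: "(\<lambda>q. \<alpha> q (e i q)) \<in> Cinf" if "i \<in> I" for i
    using \<alpha> ev[OF that] by (simp add: covector_field_def)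
  have \<alpha>_lin: "linear (\<alpha> q)" for q
    using \<alpha> by (simp add: covector_field_def)
  have \<kappa>_lin: "linear (\<kappa> i q)" if "i \<in> I" for i q
    using \<kappa>[OF that] by (simp add: covector_field_def)
  define h where "h i = b1 \<cdot> e i - (\<lambda>q. \<alpha> q (e i q)) \<cdot> e g" for i
  have h_at: "h i q = b1 q *\<^sub>R e i q - \<alpha> q (e i q) *\<^sub>R e g q" for i q
    by (simp add: h_def)
  have hg: "h g q = 0" for q
    by (simp add: h_at \<alpha>g)
  have hH: "h i \<in> secs H" if "i \<in> I" for i
  proof (rule secs_HI)
    show G: "h i \<in> secs G"
      unfolding h_def by (intro secs_G(3,4) b1 \<alpha>_Cinf[OF that] e that g)
    show "h i \<in> secs \<xi>"
      using secs_vfields[OF G] \<alpha>\<xi>[OF vfields_tangent[OF ev[OF that]]] h_at unfolding secs_def by simp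
  qed
  have fin: "finite (I - {g})" using b0(3) by simp
  have frame: "(b1 q * b0 q) *\<^sub>R w = (\<Sum>i\<in>I - {g}. \<kappa> i q w *\<^sub>R h i q)" if w: "w \<in> H q" for q w
  proof -
    have "(\<Sum>i\<in>I - {g}. \<kappa> i q w *\<^sub>R h i q) = (\<Sum>i\<in>I. \<kappa> i q w *\<^sub>R h i q)"
      unfolding sum.remove[OF b0(3) g(1)] hg scaleR_zero_right add_0_left ..
    also have "\<dots> = (\<Sum>i\<in>I. b1 q *\<^sub>R (\<kappa> i q w *\<^sub>R e i q) - \<alpha> q (\<kappa> i q w *\<^sub>R e i q) *\<^sub>R e g q)"
      by (intro sum.cong) (simp_all add: h_at linear_scale[OF \<alpha>_lin] scaleR_diff_right mult_ac)
    also have "\<dots> = b1 q *\<^sub>R (\<Sum>i\<in>I. \<kappa> i q w *\<^sub>R e i q) - \<alpha> q (\<Sum>i\<in>I. \<kappa> i q w *\<^sub>R e i q) *\<^sub>R e g q"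
      unfolding sum_subtractf scaleR_sum_right linear_sum[OF \<alpha>_lin] scaleR_sum_left ..
    also have "\<dots> = b1 q *\<^sub>R (b0 q *\<^sub>R w) - \<alpha> q (b0 q *\<^sub>R w) *\<^sub>R e g q"
      using fr[of w q] w by simp
    also have "\<alpha> q (b0 q *\<^sub>R w) = 0"
      using \<alpha>0[of "b0 q *\<^sub>R w" q] subspace_scale[OF subspace_xi] w by blast
    finally show ?thesis
      by (simp only: scaleR_zero_left diff_zero scaleR_scaleR)
  qed
  have indep: "\<forall>i\<in>I - {g}. c i = 0" if z: "(\<Sum>i\<in>I - {g}. c i *\<^sub>R h i p) = 0" for c
  proof
    fix j assume j: "j \<in> I - {g}"
    then have jI: "j \<in> I" by simp
    \<comment> \<open>As \<open>j\<close> differs from \<open>g\<close>, the functional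
      \<open>\<kappa> j\<close> does not see the correction along \<open>e g\<close>.\<close>
    have kh: "\<kappa> j p (h i p) = (if i = j then b1 p * b0 p else 0)" if "i \<in> I" for i
      using d[OF jI that] d[OF jI g(1)] j
      by (simp add: h_at linear_diff[OF \<kappa>_lin[OF jI]] linear_scale[OF \<kappa>_lin[OF jI]])
    have "0 = \<kappa> j p (\<Sum>i\<in>I - {g}. c i *\<^sub>R h i p)"
      unfolding z linear_0[OF \<kappa>_lin[OF jI]] ..
    also have "\<dots> = (\<Sum>i\<in>I - {g}. c i * \<kappa> j p (h i p))"
      unfolding linear_sum[OF \<kappa>_lin[OF jI]] linear_scale[OF \<kappa>_lin[OF jI]] by simp
    also have "\<dots> = (\<Sum>i\<in>I - {g}. if i = j then c j * (b1 p * b0 p) else 0)"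
      by (intro sum.cong) (simp_all add: kh)
    also have "\<dots> = c j * (b1 p * b0 p)"
      using j fin by simp
    finally show "c j = 0" using b1 b0 by simp
  qed
  have "b1 p * b0 p \<noteq> 0" using b1(2) b0(2) by simp
  then show ?thesis
    by (intro that[of "\<lambda>q. b1 q * b0 q" "I - {g}" h \<kappa>] Cinf_mult b1(1) b0(1) fin hH \<kappa> frame indep)
      simp_all
qed

text \<open>Every vector of \<open>\<xi> p\<close> is a sum of one in \<open>TF p\<close> and one in
  \<open>H p\<close>, and \<open>TF\<close> is orthogonal to all of \<open>\<xi>\<close>; so
  orthogonality to \<open>H\<close> is enough.\<close>

lemma TF_at_H:
  assumes W: "W \<in> secs \<xi>" and 0: "\<And>Z. Z \<in> secs H \<Longrightarrow> \<omega> W Z p = 0"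
  shows "W p \<in> TF p"
  unfolding TF_at[OF W]
proof
  fix Y assume Y: "Y \<in> secs \<xi>"
  obtain a b' where ab: "a \<in> TF p" "b' \<in> G p" "Y p = a + b'"
    by (rule tangent_split[OF vfields_tangent[OF secs_vfields[OF Y]]])
  obtain X where X: "a = X p" "X \<in> secs \<xi>" "\<And>Z. Z \<in> secs \<xi> \<Longrightarrow> \<omega> X Z p = 0"
    using ab(1) unfolding TF_def by blast
  have "b' = Y p - a" using ab(3) by simp
  then have b': "b' \<in> H p"
    using subspace_diff[OF subspace_xi secs_at[OF Y] TF_subset_xi[OF ab(1)]] ab(2) by simp
  obtain b h \<kappa> and I :: "'c vfield set" where b: "b p \<noteq> 0" "finite I"
    and h: "\<And>i. i \<in> I \<Longrightarrow> h i \<in> secs H"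
    and fr: "\<And>q w. w \<in> H q \<Longrightarrow> b q *\<^sub>R w = (\<Sum>i\<in>I. \<kappa> i q w *\<^sub>R h i q)"
    by (rule H_frame[of p]) blast
  \<comment> \<open>A section of \<open>H\<close> through \<open>b'\<close>, with constant
    coefficients read off from the frame at \<open>p\<close>.\<close>
  define Z where "Z = (\<Sum>i\<in>I. (\<kappa> i p b' / b p) *\<^sub>R h i)"
  have Z: "Z \<in> secs H"
    unfolding Z_def by (intro secs_sum[of H, OF subspace_H] secs_H(6) h)
  have "Z p = inverse (b p) *\<^sub>R (\<Sum>i\<in>I. \<kappa> i p b' *\<^sub>R h i p)"
    by (simp add: Z_def sum_fun_apply scaleR_sum_right divide_inverse mult_ac)
  then have Zp: "Z p = b'"
    using fr[OF b'] b(1) by (metis left_inverse scaleR_one scaleR_scaleR)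
  note v = secs_vfields[OF W] secs_vfields[OF Y] secs_vfields[OF X(2)] secs_vfields[OF Z]
  have "Y - X - Z \<in> secs \<xi>" "(Y - X - Z) p = 0"
    using secs_xi(3) Y X(2) secs_HD(1)[OF Z] ab(3) X(1) Zp by auto
  then have "\<omega> (Y - X - Z) W p = 0"
    by (rule omega_tensorial[OF _ _ v(1)])
  then have "\<omega> Y W p - \<omega> X W p - \<omega> Z W p = 0"
    using v by (simp only: omega_diff_left vfields_diff minus_apply)
  then have "\<omega> Y W p = \<omega> X W p + \<omega> Z W p"
    by (simp only: diff_diff_eq right_minus_eq)
  also have "\<dots> = 0"
    using X(3)[OF W] 0[OF Z] by (subst (2) omega_swap) simp
  finally show "\<omega> W Y p = 0"
    by (subst omega_swap) simp
qed

text \<open>A vector of \<open>H\<close> orthogonal to \<open>H\<close> lies in \<open>TF\<close>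
  and in \<open>G\<close>, which meet in zero.\<close>

lemma H_nondegenerate_at:
  assumes "Z \<in> secs H" "\<And>Z'. Z' \<in> secs H \<Longrightarrow> \<omega> Z Z' p = 0"
  shows "Z p = 0"
  using TF_G_disjoint[OF TF_at_H[OF secs_HD(1)[OF assms(1)] assms(2)] secs_at[OF secs_HD(2)[OF assms(1)]]] .

text \<open>\<open>dual_frame\<close> is run inside the module of functionals represented by
  sections \<open>Z\<close> of \<open>H\<close> through \<open>\<omega>\<close>, nondegeneracy being
  the separation hypothesis. The dual functionals thus come with smooth representing sections, and
  no matrix of \<open>\<omega>\<close> has to be inverted.\<close>

lemma omega_H_dual_frame:
  assumes h: "finite I" "h ` I \<subseteq> secs H"
      "\<And>c. (\<Sum>i\<in>I. c i *\<^sub>R h i p) = 0 \<Longrightarrow> \<forall>i\<in>I. c i = 0"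
    and g: "g \<in> vfields"
    and \<alpha>: "covector_field \<alpha>" "\<And>q w. w \<in> \<xi> q \<Longrightarrow> \<alpha> q w = 0"
    and b1: "b1 p \<noteq> 0" "\<And>q w. w \<in> tangent q \<Longrightarrow> b1 q *\<^sub>R w - \<alpha> q w *\<^sub>R g q \<in> \<xi> q"
  shows "\<exists>b\<in>Cinf. \<exists>Z. b p \<noteq> 0 \<and> (\<forall>i\<in>I. Z i \<in> secs H) \<and>
    (\<forall>i\<in>I. \<forall>j\<in>I. \<forall>q. \<alpha> q (bracket (h j) (Z i) q) = (if i = j then b q else 0))"
proof -
  define \<K> where "\<K> = {\<kappa>. \<exists>Z\<in>secs H. \<forall>X\<in>secs H. \<kappa> X = (\<lambda>q. \<alpha> q (bracket X Z q))}"
  have KE: "\<exists>Z\<in>secs H. \<forall>X\<in>secs H. \<kappa> X = (\<lambda>q. \<alpha> q (bracket X Z q))" if "\<kappa> \<in> \<K>" for \<kappa>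
    using that by (simp add: \<K>_def)
  have KI: "\<kappa> \<in> \<K>" if "Z \<in> secs H" "\<And>X. X \<in> secs H \<Longrightarrow> \<kappa> X = (\<lambda>q. \<alpha> q (bracket X Z q))" for Z \<kappa>
    using that unfolding \<K>_def by blast
  have lin: "linear (\<alpha> q)" for q
    using \<alpha> by (simp add: covector_field_def)
  note v = secs_vfields[of _ H]
  have \<alpha>H: "\<alpha> q (X q) = 0" if "X \<in> secs H" for X q
    using \<alpha>(2)[OF secs_at[OF secs_HD(1)[OF that]]] .
  have l1: "\<kappa> X \<in> Cinf" if "\<kappa> \<in> \<K>" "X \<in> secs H" for \<kappa> X
  proof -
    obtain Z where Z: "Z \<in> secs H" "\<And>X. X \<in> secs H \<Longrightarrow> \<kappa> X = (\<lambda>q. \<alpha> q (bracket X Z q))"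
      using KE[OF \<open>\<kappa> \<in> \<K>\<close>] by blast
    show ?thesis
      unfolding Z(2)[OF that(2)]
      using \<alpha>(1) bracket_vfields[OF v[OF that(2)] v[OF Z(1)]] unfolding covector_field_def by blast
  qed
  have l2: "\<kappa> (X + Y) = \<kappa> X + \<kappa> Y" if "\<kappa> \<in> \<K>" "X \<in> secs H" "Y \<in> secs H" for \<kappa> X Y
  proof -
    obtain Z where Z: "Z \<in> secs H" "\<And>X. X \<in> secs H \<Longrightarrow> \<kappa> X = (\<lambda>q. \<alpha> q (bracket X Z q))"
      using KE[OF \<open>\<kappa> \<in> \<K>\<close>] by blast
    show ?thesis
      unfolding Z(2)[OF that(2)] Z(2)[OF that(3)] Z(2)[OF secs_H(2)[OF that(2,3)]]
        bracket_add_left[OF v[OF Z(1)] v[OF that(2)] v[OF that(3)]]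
      by (rule ext) (simp add: linear_add[OF lin])
  qed
  have l3: "\<kappa> (f \<cdot> X) = f * \<kappa> X" if "\<kappa> \<in> \<K>" "f \<in> Cinf" "X \<in> secs H" for \<kappa> f X
  proof -
    obtain Z where Z: "Z \<in> secs H" "\<And>X. X \<in> secs H \<Longrightarrow> \<kappa> X = (\<lambda>q. \<alpha> q (bracket X Z q))"
      using KE[OF \<open>\<kappa> \<in> \<K>\<close>] by blast
    show ?thesis
      unfolding Z(2)[OF that(3)] Z(2)[OF secs_H(4)[OF that(2,3)]]
        bracket_fscale_left[OF v[OF Z(1)] v[OF that(3)] that(2)]
      by (rule ext) (simp add: linear_diff[OF lin] linear_scale[OF lin] \<alpha>H[OF that(3)])
  qed
  have k1: "(\<lambda>X. 0) \<in> \<K>"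
  proof (rule KI[OF secs_H(1)])
    show "0 = (\<lambda>q. \<alpha> q (bracket X 0 q))" if "X \<in> secs H" for X
      unfolding bracket_0_right[OF v[OF that]] by (rule ext) (simp add: linear_0[OF lin])
  qed
  have k2: "(\<lambda>X. \<kappa> X + \<kappa>' X) \<in> \<K>" if "\<kappa> \<in> \<K>" "\<kappa>' \<in> \<K>" for \<kappa> \<kappa>'
  proof -
    obtain Z where Z: "Z \<in> secs H" "\<And>X. X \<in> secs H \<Longrightarrow> \<kappa> X = (\<lambda>q. \<alpha> q (bracket X Z q))"
      using KE[OF \<open>\<kappa> \<in> \<K>\<close>] by blast
    obtain Z' where Z': "Z' \<in> secs H" "\<And>X. X \<in> secs H \<Longrightarrow> \<kappa>' X = (\<lambda>q. \<alpha> q (bracket X Z' q))"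
      using KE[OF \<open>\<kappa>' \<in> \<K>\<close>] by blast
    show ?thesis
    proof (rule KI[OF secs_H(2)[OF Z(1) Z'(1)]])
      fix X assume X: "X \<in> secs H"
      show "\<kappa> X + \<kappa>' X = (\<lambda>q. \<alpha> q (bracket X (Z + Z') q))"
        unfolding Z(2)[OF X] Z'(2)[OF X] bracket_add_right[OF v[OF X] v[OF Z(1)] v[OF Z'(1)]]
        by (rule ext) (simp add: linear_add[OF lin])
    qed
  qed
  have k3: "(\<lambda>X. f * \<kappa> X) \<in> \<K>" if "f \<in> Cinf" "\<kappa> \<in> \<K>" for f \<kappa>
  proof -
    obtain Z where Z: "Z \<in> secs H" "\<And>X. X \<in> secs H \<Longrightarrow> \<kappa> X = (\<lambda>q. \<alpha> q (bracket X Z q))"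
      using KE[OF \<open>\<kappa> \<in> \<K>\<close>] by blast
    show ?thesis
    proof (rule KI[OF secs_H(4)[OF that(1) Z(1)]])
      fix X assume X: "X \<in> secs H"
      show "f * \<kappa> X = (\<lambda>q. \<alpha> q (bracket X (f \<cdot> Z) q))"
        unfolding Z(2)[OF X] bracket_fscale_right[OF v[OF X] v[OF Z(1)] that(1)]
        by (rule ext) (simp add: linear_add[OF lin] linear_scale[OF lin] \<alpha>H[OF Z(1)])
    qed
  qed
  have sep: "\<exists>\<kappa>\<in>\<K>. \<kappa> X p \<noteq> 0" if X: "X \<in> secs H" "X p \<noteq> 0" for X
  proof -
    obtain Z where Z: "Z \<in> secs H" "\<omega> X Z p \<noteq> 0"
      using H_nondegenerate_at[OF X(1)] X(2) by blast
    have "bracket X Z p \<notin> \<xi> p"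
      using Z(2) unfolding \<omega>_def theta_eq_0_at .
    \<comment> \<open>If \<open>\<alpha>\<close> vanished on this bracket, division by
      \<open>b1 p\<close> would put the bracket into \<open>\<xi> p\<close>.\<close>
    moreover have "b1 p *\<^sub>R bracket X Z p - \<alpha> p (bracket X Z p) *\<^sub>R g p \<in> \<xi> p"
      by (intro b1(2) vfields_tangent bracket_vfields v X Z)
    ultimately have "\<alpha> p (bracket X Z p) \<noteq> 0"
      using subspace_scale[OF subspace_xi, of "b1 p *\<^sub>R bracket X Z p" p "inverse (b1 p)"] b1(1) by auto
    moreover have "(\<lambda>X q. \<alpha> q (bracket X Z q)) \<in> \<K>"
      by (rule KI[OF Z(1)]) simp
    ultimately show ?thesis by (intro bexI[of _ "\<lambda>X q. \<alpha> q (bracket X Z q)"])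
  qed
  have "\<exists>b\<in>Cinf. \<exists>\<kappa>. b p \<noteq> 0 \<and> (\<forall>i\<in>I. \<kappa> i \<in> \<K> \<and> (\<forall>j\<in>I. \<kappa> i (h j) = (if i = j then b else 0)))"
    by (rule dual_frame[where M = "secs H" and \<K> = \<K> and e = h and p = p and I = I])
      (fact secs_H(1,2,4) l1 l2 l3 k1 k2 k3 sep h)+
  then obtain b \<kappa> where b: "b \<in> Cinf" "b p \<noteq> 0" "\<And>i. i \<in> I \<Longrightarrow> \<kappa> i \<in> \<K>"
    and d: "\<And>i j. i \<in> I \<Longrightarrow> j \<in> I \<Longrightarrow> \<kappa> i (h j) = (if i = j then b else 0)"
    by blast
  have "\<forall>i\<in>I. \<exists>Z. Z \<in> secs H \<and> (\<forall>X\<in>secs H. \<kappa> i X = (\<lambda>q. \<alpha> q (bracket X Z q)))"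
    using KE[OF b(3)] by blast
  then obtain Z where Z: "\<And>i. i \<in> I \<Longrightarrow> Z i \<in> secs H"
    "\<And>i X. i \<in> I \<Longrightarrow> X \<in> secs H \<Longrightarrow> \<kappa> i X = (\<lambda>q. \<alpha> q (bracket X (Z i) q))"
    using bchoice[of I "\<lambda>i Z. Z \<in> secs H \<and> (\<forall>X\<in>secs H. \<kappa> i X = (\<lambda>q. \<alpha> q (bracket X Z q)))"] by blast
  have "\<alpha> q (bracket (h j) (Z i) q) = (if i = j then b q else 0)" if "i \<in> I" "j \<in> I" for i j q
  proof -
    have "\<kappa> i (h j) q = \<alpha> q (bracket (h j) (Z i) q)"
      using Z(2)[OF that(1), of "h j"] h(2) that(2) by auto
    then show ?thesis using fun_cong[OF d[OF that], of q] by (simp split: if_splits)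
  qed
  with b(1,2) Z(1) show ?thesis by (intro bexI[of _ b] exI[of _ Z]) blast+
qed

end

lemma diff_add_eq_diff_diff_if:
  fixes x y z x1 x2 :: "'a::ab_group_add"
  assumes "x - z = x1 + x2"
  shows "y - (z + x2) = x1 - (x - y)"
proof -
  have "x = x1 + x2 + z" using assms by (simp only: diff_eq_eq)
  then show ?thesis by (simp add: algebra_simps)
qed

context smooth_manifold
begin

lemma secs_hom_sum:
  fixes D :: "'c vfield \<Rightarrow> 'c \<Rightarrow> 'v::real_vector"
  assumes W: "\<And>p. subspace (W p)"
    and add: "\<And>X Y. X \<in> secs W \<Longrightarrow> Y \<in> secs W \<Longrightarrow> D (X + Y) = D X + D Y"
    and scale: "\<And>f X. f \<in> Cinf \<Longrightarrow> X \<in> secs W \<Longrightarrow> D (f \<cdot> X) = f \<cdot> D X"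
    and fe: "\<And>i. i \<in> I \<Longrightarrow> f i \<in> Cinf" "\<And>i. i \<in> I \<Longrightarrow> e i \<in> secs W"
  shows "D (\<Sum>i\<in>I. f i \<cdot> e i) = (\<Sum>i\<in>I. f i \<cdot> D (e i))"
proof -
  have z: "D 0 = 0"
    using add[OF secs_closed(1)[of W, OF W] secs_closed(1)[of W, OF W]] by simp
  show ?thesis
    using fe
  proof (induction I rule: infinite_finite_induct)
    case (insert i I)
    have 1: "f i \<in> Cinf" "e i \<in> secs W" using insert.prems by blast+
    have 2: "(\<Sum>i\<in>I. f i \<cdot> e i) \<in> secs W"
      using insert.prems by (intro secs_sum[of W, OF W] secs_closed(4)[of W, OF W]) auto
    have 3: "D (\<Sum>i\<in>I. f i \<cdot> e i) = (\<Sum>i\<in>I. f i \<cdot> D (e i))"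
      using insert.prems by (intro insert.IH) auto
    show ?case
      unfolding sum.insert[OF insert.hyps]
        add[OF secs_closed(4)[of W, OF W 1] 2] scale[OF 1] 3 ..
  next
    case (infinite I)
    show ?case unfolding sum.infinite[OF infinite(1)] by (rule z)
  next
    case empty
    show ?case unfolding sum.empty by (rule z)
  qed
qed

end

context complemented_manifold
begin

text \<open>With a frame \<open>h\<close> of \<open>H\<close> and fields \<open>Z i\<close> dual to
  it under \<open>\<omega>\<close>, the combination of the \<open>Z i\<close> whose coefficients
  come from the values of \<open>\<mu>\<close> on \<open>h\<close> solves the equation near
  \<open>p\<close>, up to the denominators of the two frames.\<close>

lemma omega_H_duality_local:
  fixes \<mu> :: "'c vfield \<Rightarrow> 'c qsec"
  assumes range: "\<And>Z. Z \<in> secs H \<Longrightarrow> \<mu> Z \<in> \<Gamma>L"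
    and add: "\<And>Z Z'. Z \<in> secs H \<Longrightarrow> Z' \<in> secs H \<Longrightarrow> \<mu> (Z + Z') = \<mu> Z + \<mu> Z'"
    and scale: "\<And>f Z. f \<in> Cinf \<Longrightarrow> Z \<in> secs H \<Longrightarrow> \<mu> (f \<cdot> Z) = f \<cdot> \<mu> Z"
  shows "\<exists>V\<in>secs H. \<exists>c\<in>Cinf. c p \<noteq> 0 \<and> (\<forall>Z\<in>secs H. \<omega> V Z = c \<cdot> \<mu> Z)"
proof -
  obtain g where g: "g \<in> secs G" "g p \<notin> \<xi> p" by (rule transversal_section)
  obtain b1 \<alpha> where b1: "b1 \<in> Cinf" "b1 p \<noteq> 0" and \<alpha>: "covector_field \<alpha>"
    and \<alpha>0: "\<And>q w. w \<in> \<xi> q \<Longrightarrow> \<alpha> q w = 0"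
    and \<alpha>\<xi>: "\<And>q w. w \<in> tangent q \<Longrightarrow> b1 q *\<^sub>R w - \<alpha> q w *\<^sub>R g q \<in> \<xi> q"
    by (rule conormal[OF secs_vfields[OF g(1)] g(2)]) blast
  obtain bH h \<kappa> and I :: "'c vfield set" where bH: "bH \<in> Cinf" "bH p \<noteq> 0" and I: "finite I"
    and h: "\<And>i. i \<in> I \<Longrightarrow> h i \<in> secs H" and \<kappa>: "\<And>i. i \<in> I \<Longrightarrow> covector_field (\<kappa> i)"
    and fr: "\<And>q w. w \<in> H q \<Longrightarrow> bH q *\<^sub>R w = (\<Sum>i\<in>I. \<kappa> i q w *\<^sub>R h i q)"
    and indep: "\<And>c. (\<Sum>i\<in>I. c i *\<^sub>R h i p) = 0 \<Longrightarrow> \<forall>i\<in>I. c i = 0"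
    by (rule H_frame[of p]) blast
  have hI: "h ` I \<subseteq> secs H" using h by blast
  obtain b Z where b: "b \<in> Cinf" "b p \<noteq> 0" and Z: "\<And>i. i \<in> I \<Longrightarrow> Z i \<in> secs H"
    and d: "\<And>i j q. i \<in> I \<Longrightarrow> j \<in> I \<Longrightarrow> \<alpha> q (bracket (h j) (Z i) q) = (if i = j then b q else 0)"
    using omega_H_dual_frame[where I = I and h = h and p = p and g = g and \<alpha> = \<alpha> and ?b1.0 = b1,
        OF I hI indep secs_vfields[OF g(1)] \<alpha> \<alpha>0 b1(2) \<alpha>\<xi>] by blast
  have "\<forall>i\<in>I. \<exists>M. M \<in> vfields \<and> \<mu> (h i) = \<theta> M"
    using range[OF h] unfolding qsecs_def by blast
  then obtain M where M: "\<And>i. i \<in> I \<Longrightarrow> M i \<in> vfields" "\<And>i. i \<in> I \<Longrightarrow> \<mu> (h i) = \<theta> (M i)"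
    using bchoice[of I "\<lambda>i M. M \<in> vfields \<and> \<mu> (h i) = \<theta> M"] by blast
  \<comment> \<open>The sign compensates for \<open>\<omega> (Z i) (h j)\<close> being minus the
    normalised pairing of \<open>h j\<close> with \<open>Z i\<close>.\<close>
  define m where "m i q = - \<alpha> q (M i q)" for i q
  have m: "m i \<in> Cinf" if "i \<in> I" for i
    using \<alpha> M(1)[OF that] Cinf_uminus unfolding m_def[abs_def] covector_field_def by blast
  define V where "V = (\<Sum>i\<in>I. m i \<cdot> Z i)"
  have V: "V \<in> secs H"
    unfolding V_def by (intro secs_sum[of H, OF subspace_H] secs_H(4) m Z)
  note v = secs_vfields[of _ H] secs_HD(1)
  \<comment> \<open>The defect of the desired identity. It is linear over \<open>Cinf\<close>, so
    its vanishing on the frame, up to a factor, carries over to all sections of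
    \<open>H\<close>.\<close>
  define D where "D Z' = \<omega> V Z' - b \<cdot> \<mu> Z'" for Z'
  have Dh: "b1 q *\<^sub>R D (h j) q = 0" if j: "j \<in> I" for j q
  proof -
    have "\<omega> V (h j) = (\<Sum>i\<in>I. m i \<cdot> \<omega> (Z i) (h j))"
      unfolding V_def
      by (rule secs_hom_sum[where W = H and D = "\<lambda>X. \<omega> X (h j)"])
        (use m Z h[OF j] subspace_H v in \<open>blast intro: omega_add_left omega_fscale_left\<close>)+
    then have "b1 q *\<^sub>R \<omega> V (h j) q = (\<Sum>i\<in>I. m i q *\<^sub>R (b1 q *\<^sub>R \<omega> (Z i) (h j) q))"
      by (simp add: sum_fun_apply scaleR_sum_right mult_ac)
    also have "\<dots> = (\<Sum>i\<in>I. if i = j then (- m j q * b q) *\<^sub>R \<theta> g q else 0)"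
    proof (rule sum.cong[OF refl])
      fix i assume i: "i \<in> I"
      have "(b1 \<cdot> \<omega> (h j) (Z i)) q = ((\<lambda>q. \<alpha> q (bracket (h j) (Z i) q)) \<cdot> \<theta> g) q"
        unfolding \<omega>_def
        by (subst conormal_theta[OF _ \<alpha>\<xi>]) (use v h[OF j] Z[OF i] in \<open>auto intro: bracket_vfields\<close>)
      then have "b1 q *\<^sub>R \<omega> (h j) (Z i) q = (if i = j then b q else 0) *\<^sub>R \<theta> g q"
        using d[OF i j] by simp
      then have "b1 q *\<^sub>R \<omega> (Z i) (h j) q = - ((if i = j then b q else 0) *\<^sub>R \<theta> g q)"
        by (subst omega_swap) (simp only: uminus_apply scaleR_minus_right)
      then show "m i q *\<^sub>R (b1 q *\<^sub>R \<omega> (Z i) (h j) q) = (if i = j then (- m j q * b q) *\<^sub>R \<theta> g q else 0)"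
        by (cases "i = j") (simp_all only: scaleR_minus_right scaleR_scaleR if_True if_False
            scaleR_zero_left scaleR_zero_right minus_zero scaleR_minus_left mult_minus_left simp_thms)
    qed
    also have "\<dots> = b q *\<^sub>R ((\<lambda>q. \<alpha> q (M j q)) \<cdot> \<theta> g) q"
      using j I by (simp add: m_def mult_ac)
    also have "\<dots> = b q *\<^sub>R (b1 \<cdot> \<theta> (M j)) q"
      by (subst conormal_theta[OF M(1)[OF j] \<alpha>\<xi>]) simp_all
    also have "\<dots> = b1 q *\<^sub>R (b \<cdot> \<mu> (h j)) q"
      by (simp add: M(2)[OF j] mult_ac)
    finally show ?thesis
      by (simp only: D_def minus_apply scaleR_diff_right right_minus_eq)
  qed
  have D_add: "D (X + Y) = D X + D Y" if "X \<in> secs H" "Y \<in> secs H" for X Y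
    unfolding D_def omega_add_right[OF v(1)[OF that(1)] v(1)[OF that(2)] v(1)[OF V]] add[OF that]
    by (rule ext) (simp add: scaleR_add_right)
  have D_scale: "D (f \<cdot> X) = f \<cdot> D X" if "f \<in> Cinf" "X \<in> secs H" for f X
    unfolding D_def omega_fscale_right[OF v(2)[OF that(2)] v(1)[OF V] that(1)] scale[OF that]
    by (rule ext) (simp add: scaleR_diff_right mult_ac)
  have D0: "(b1 q * bH q) *\<^sub>R D X q = 0" if X: "X \<in> secs H" for X q
  proof -
    have kX: "(\<lambda>q. \<kappa> i q (X q)) \<in> Cinf" if "i \<in> I" for i
      using \<kappa>[OF that] v(1)[OF X] unfolding covector_field_def by blast
    have "bH \<cdot> X = (\<Sum>i\<in>I. (\<lambda>q. \<kappa> i q (X q)) \<cdot> h i)"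
      using fr[OF secs_at[OF X]] by (intro ext) (simp only: fscale_apply sum_fun_apply)
    then have "D (bH \<cdot> X) = (\<Sum>i\<in>I. (\<lambda>q. \<kappa> i q (X q)) \<cdot> D (h i))"
      using secs_hom_sum[of H D I "\<lambda>i q. \<kappa> i q (X q)" h, OF subspace_H D_add D_scale kX h] by (simp only:)
    then have "(bH \<cdot> D X) q = (\<Sum>i\<in>I. (\<lambda>q. \<kappa> i q (X q)) \<cdot> D (h i)) q"
      unfolding D_scale[OF bH(1) X] by (rule fun_cong)
    then have "bH q *\<^sub>R D X q = (\<Sum>i\<in>I. \<kappa> i q (X q) *\<^sub>R D (h i) q)"
      by (simp only: fscale_apply sum_fun_apply)
    then have "b1 q *\<^sub>R (bH q *\<^sub>R D X q) = (\<Sum>i\<in>I. \<kappa> i q (X q) *\<^sub>R (b1 q *\<^sub>R D (h i) q))"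
      by (simp only: scaleR_sum_right scaleR_left_commute)
    also have "\<dots> = 0"
      by (intro sum.neutral ballI) (simp only: Dh scaleR_zero_right)
    finally show ?thesis by (simp only: scaleR_scaleR)
  qed
  \<comment> \<open>The defect is known to vanish after multiplication by \<open>b1\<close> and
    \<open>bH\<close>; putting this factor into \<open>V\<close> gives an identity valid
    everywhere.\<close>
  define s where "s q = b1 q * bH q" for q
  have s: "s \<in> Cinf" unfolding s_def[abs_def] by (intro Cinf_mult b1 bH)
  have "\<omega> (s \<cdot> V) X = (\<lambda>q. s q * b q) \<cdot> \<mu> X" if X: "X \<in> secs H" for X
  proof
    fix q
    have "s q *\<^sub>R \<omega> V X q - s q *\<^sub>R (b q *\<^sub>R \<mu> X q) = 0"
      using D0[OF X, of q] by (simp only: D_def minus_apply fscale_apply scaleR_diff_right s_def)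
    then show "\<omega> (s \<cdot> V) X q = ((\<lambda>q. s q * b q) \<cdot> \<mu> X) q"
      unfolding omega_fscale_left[OF v(2)[OF V] v(1)[OF X] s]
      by (simp only: fscale_apply scaleR_scaleR right_minus_eq)
  qed
  moreover have "s p * b p \<noteq> 0" using b b1 bH by (simp add: s_def)
  ultimately show ?thesis
    using secs_H(4)[OF s V] Cinf_mult[OF s b(1)]
    by (intro bexI[of _ "s \<cdot> V"] bexI[of _ "\<lambda>q. s q * b q"] conjI ballI)
qed

text \<open>Local solutions \<open>U p\<close> carry denominators \<open>c p\<close>. By
  nondegeneracy \<open>c p \<cdot> U r\<close> and \<open>c r \<cdot> U p\<close> have the same
  pairings, hence are equal, so all quotients agree and define one field.\<close>

lemma omega_H_duality:
  fixes \<mu> :: "'c vfield \<Rightarrow> 'c qsec"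
  assumes range: "\<And>Z. Z \<in> secs H \<Longrightarrow> \<mu> Z \<in> \<Gamma>L"
    and add: "\<And>Z Z'. Z \<in> secs H \<Longrightarrow> Z' \<in> secs H \<Longrightarrow> \<mu> (Z + Z') = \<mu> Z + \<mu> Z'"
    and scale: "\<And>f Z. f \<in> Cinf \<Longrightarrow> Z \<in> secs H \<Longrightarrow> \<mu> (f \<cdot> Z) = f \<cdot> \<mu> Z"
  shows "\<exists>V\<in>secs H. \<forall>Z\<in>secs H. \<omega> V Z = \<mu> Z"
proof -
  have "\<forall>p. \<exists>Vc. fst Vc \<in> secs H \<and> snd Vc \<in> Cinf \<and> snd Vc p \<noteq> 0 \<and>
      (\<forall>Z\<in>secs H. \<omega> (fst Vc) Z = snd Vc \<cdot> \<mu> Z)"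
  proof
    fix p
    obtain V c where "V \<in> secs H" "c \<in> Cinf" "c p \<noteq> 0" "\<forall>Z\<in>secs H. \<omega> V Z = c \<cdot> \<mu> Z"
      using omega_H_duality_local[of \<mu> p, OF range add scale] by blast
    then show "\<exists>Vc. fst Vc \<in> secs H \<and> snd Vc \<in> Cinf \<and> snd Vc p \<noteq> 0 \<and>
        (\<forall>Z\<in>secs H. \<omega> (fst Vc) Z = snd Vc \<cdot> \<mu> Z)"
      by (intro exI[of _ "(V, c)"]) simp
  qed
  then obtain Vc where Vc: "\<And>p. fst (Vc p) \<in> secs H" "\<And>p. snd (Vc p) \<in> Cinf" "\<And>p. snd (Vc p) p \<noteq> 0"
      "\<And>p Z. Z \<in> secs H \<Longrightarrow> \<omega> (fst (Vc p)) Z = snd (Vc p) \<cdot> \<mu> Z"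
    using choice[of "\<lambda>p Vc. fst Vc \<in> secs H \<and> snd Vc \<in> Cinf \<and> snd Vc p \<noteq> 0 \<and>
      (\<forall>Z\<in>secs H. \<omega> (fst Vc) Z = snd Vc \<cdot> \<mu> Z)"] by blast
  define U where "U p = fst (Vc p)" for p
  define c where "c p = snd (Vc p)" for p
  have U: "U p \<in> secs H" and c: "c p \<in> Cinf" "c p p \<noteq> 0"
    and UZ: "Z \<in> secs H \<Longrightarrow> \<omega> (U p) Z = c p \<cdot> \<mu> Z" for p Z
    using Vc unfolding U_def c_def by blast+
  note v = secs_vfields[of _ H] secs_HD(1)
  have eq: "c p q *\<^sub>R U r q = c r q *\<^sub>R U p q" for p q r
  proof -
    have D: "c p \<cdot> U r - c r \<cdot> U p \<in> secs H"
      by (intro secs_H(3,4) c U)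
    have "\<omega> (c p \<cdot> U r - c r \<cdot> U p) Z q = 0" if Z: "Z \<in> secs H" for Z
    proof -
      have "\<omega> (c p \<cdot> U r - c r \<cdot> U p) Z = c p \<cdot> c r \<cdot> \<mu> Z - c r \<cdot> c p \<cdot> \<mu> Z"
        unfolding omega_diff_left[OF vfields_fscale[OF c(1) v(1)[OF U]] vfields_fscale[OF c(1) v(1)[OF U]] v(1)[OF Z]]
          omega_fscale_left[OF v(2)[OF U] v(1)[OF Z] c(1)] UZ[OF Z] ..
      then show ?thesis
        by (simp only: minus_apply fscale_apply scaleR_left_commute diff_self)
    qed
    then have "(c p \<cdot> U r - c r \<cdot> U p) q = 0"
      by (rule H_nondegenerate_at[OF D])
    then show ?thesis by (simp only: minus_apply fscale_apply right_minus_eq)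
  qed
  \<comment> \<open>At \<open>q\<close> the solution made for \<open>q\<close> itself is used, the
    one whose denominator is known to be nonzero there.\<close>
  define V where "V q = inverse (c q q) *\<^sub>R U q q" for q
  have cV: "c p \<cdot> V = U p" for p
  proof
    fix q
    have "(c p \<cdot> V) q = inverse (c q q) *\<^sub>R (c p q *\<^sub>R U q q)"
      by (simp only: fscale_apply V_def scaleR_left_commute)
    then show "(c p \<cdot> V) q = U p q"
      unfolding eq[of p q q] using c(2)[of q] by simp
  qed
  have VH: "V q \<in> H q" for q
    unfolding V_def by (rule subspace_scale[OF subspace_H secs_at[OF U]])
  have "V \<in> vfields"
  proof (rule vfields_divide_local)
    show "V p \<in> tangent p" for p using VH xi_tangent by blast
    show "\<exists>b\<in>Cinf. \<exists>Z\<in>vfields. b p \<noteq> 0 \<and> b \<cdot> V = Z" for p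
      using c cV v(1)[OF U] by blast
  qed
  then have V: "V \<in> secs H" using VH by (simp add: secs_def)
  have "\<omega> V Z = \<mu> Z" if Z: "Z \<in> secs H" for Z
  proof
    fix p
    have "c p \<cdot> \<omega> V Z = c p \<cdot> \<mu> Z"
      using omega_fscale_left[OF v(2)[OF V] v(1)[OF Z] c(1)] UZ[OF Z] cV by metis
    then have "c p p *\<^sub>R \<omega> V Z p = c p p *\<^sub>R \<mu> Z p"
      by (metis fscale_apply)
    then show "\<omega> V Z p = \<mu> Z p"
      by (rule scaleR_left_imp_eq[OF c(2)[of p]])
  qed
  then show ?thesis using V by blast
qed

subsection \<open>Splitting vector fields\<close>

lemma omega_GL: "X \<in> vfields \<Longrightarrow> Y \<in> vfields \<Longrightarrow> \<omega> X Y \<in> \<Gamma>L"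
  unfolding \<omega>_def by (intro cls_qsecs bracket_vfields)

text \<open>The component in \<open>H\<close> is the \<open>\<omega>\<close>-dual of the functional
  of \<open>X\<close> on \<open>H\<close>. The rest is orthogonal to \<open>H\<close>, hence lies in
  \<open>TF\<close>, and it is smooth as a difference of smooth fields.\<close>

lemma xi_split:
  assumes X: "X \<in> secs \<xi>"
  obtains X1 X2 where "X1 \<in> \<Gamma>TF" "X2 \<in> secs H" "X = X1 + X2"
proof -
  note v = secs_vfields[of _ H] secs_HD(1) secs_vfields[OF X]
  have 1: "\<omega> X Z \<in> \<Gamma>L" if "Z \<in> secs H" for Z
    by (rule omega_GL[OF v(3) v(1)[OF that]])
  have 2: "\<omega> X (Z + Z') = \<omega> X Z + \<omega> X Z'" if "Z \<in> secs H" "Z' \<in> secs H" for Z Z'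
    by (rule omega_add_right[OF v(1)[OF that(1)] v(1)[OF that(2)] v(3)])
  have 3: "\<omega> X (f \<cdot> Z) = f \<cdot> \<omega> X Z" if "f \<in> Cinf" "Z \<in> secs H" for f Z
    by (rule omega_fscale_right[OF v(2)[OF that(2)] v(3) that(1)])
  obtain V where V: "V \<in> secs H" "\<And>Z. Z \<in> secs H \<Longrightarrow> \<omega> V Z = \<omega> X Z"
    using omega_H_duality[of "\<omega> X", OF 1 2 3] by blast
  have XV: "X - V \<in> secs \<xi>"
    by (rule secs_xi(3)[OF X secs_HD(1)[OF V(1)]])
  have "(X - V) p \<in> TF p" for p
  proof (rule TF_at_H[OF XV])
    fix Z assume Z: "Z \<in> secs H"
    show "\<omega> (X - V) Z p = 0"
      unfolding omega_diff_left[OF v(3) v(1)[OF V(1)] v(1)[OF Z]] V(2)[OF Z] by simp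
  qed
  then have "X - V \<in> \<Gamma>TF"
    using secs_vfields[OF XV] by (simp only: secs_def mem_Collect_eq simp_thms)
  then show ?thesis using that[of "X - V" V] V(1) by simp
qed

text \<open>The splitting exists pointwise. For its smoothness near \<open>p\<close>, subtract a
  multiple of a section \<open>g\<close> of \<open>G\<close> transversal to \<open>\<xi>\<close>:
  what is left of \<open>b \<cdot> X\<close> lies in \<open>\<xi>\<close>, where
  \<open>xi_split\<close> applies.\<close>

lemma vfields_split:
  assumes X: "X \<in> vfields"
  obtains X1 X2 where "X1 \<in> \<Gamma>TF" "X2 \<in> secs G" "X = X1 + X2"
proof -
  have "\<forall>q. \<exists>w. w \<in> G q \<and> X q - w \<in> TF q"
    using tangent_split[OF vfields_tangent[OF X]] by (metis add_diff_cancel_right')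
  then obtain Y where Y: "\<And>q. Y q \<in> G q" "\<And>q. X q - Y q \<in> TF q"
    by metis
  have Yt: "Y q \<in> tangent q" for q
    using subspace_diff[OF subspace_tangent vfields_tangent[OF X] xi_tangent[OF TF_subset_xi[OF Y(2)]]]
    by (metis diff_diff_eq2 add_diff_cancel_left')
  have "Y \<in> vfields"
  proof (rule vfields_divide_local[OF Yt])
    fix p
    obtain g where g: "g \<in> secs G" "g p \<notin> \<xi> p" by (rule transversal_section)
    obtain b \<alpha> where b: "b \<in> Cinf" "b p \<noteq> 0" and \<alpha>: "covector_field \<alpha>"
      and \<alpha>\<xi>: "\<And>q w. w \<in> tangent q \<Longrightarrow> b q *\<^sub>R w - \<alpha> q w *\<^sub>R g q \<in> \<xi> q"
      by (rule conormal[OF secs_vfields[OF g(1)] g(2)]) blast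
    define a where "a q = \<alpha> q (X q)" for q
    have a: "a \<in> Cinf" using \<alpha> X unfolding covector_field_def a_def[abs_def] by blast
    have "b \<cdot> X - a \<cdot> g \<in> vfields"
      by (intro vfields_diff vfields_fscale a b X secs_vfields[OF g(1)])
    then have "b \<cdot> X - a \<cdot> g \<in> secs \<xi>"
      using \<alpha>\<xi>[OF vfields_tangent[OF X]] unfolding secs_def a_def by simp
    then obtain X1 X2 where X12: "X1 \<in> \<Gamma>TF" "X2 \<in> secs H" "b \<cdot> X - a \<cdot> g = X1 + X2"
      by (rule xi_split)
    have Z: "a \<cdot> g + X2 \<in> secs G"
      by (intro secs_G a g secs_HD(2) X12)
    \<comment> \<open>Both sides are the part of \<open>b \<cdot> X\<close> in \<open>G\<close>:
      their difference lies in \<open>G\<close> and in \<open>TF\<close>.\<close>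
    have "b \<cdot> Y = a \<cdot> g + X2"
    proof
      fix q
      have e: "b q *\<^sub>R X q - a q *\<^sub>R g q = X1 q + X2 q"
        using fun_cong[OF X12(3), of q] by (simp only: minus_apply plus_fun_apply fscale_apply)
      have 1: "b q *\<^sub>R Y q - (a \<cdot> g + X2) q \<in> G q"
        by (intro subspace_diff[OF subspace_G] subspace_scale[OF subspace_G] Y secs_at[OF Z])
      have "b q *\<^sub>R Y q - (a \<cdot> g + X2) q = X1 q - b q *\<^sub>R (X q - Y q)"
      proof -
        show ?thesis
          using diff_add_eq_diff_diff_if[OF e, of "b q *\<^sub>R Y q"] by (simp only: scaleR_diff_right plus_fun_apply fscale_apply)
      qed
      then have 2: "b q *\<^sub>R Y q - (a \<cdot> g + X2) q \<in> TF q"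
        using subspace_diff[OF subspace_TF secs_at[OF X12(1)] subspace_scale[OF subspace_TF Y(2)]] by metis
      show "(b \<cdot> Y) q = (a \<cdot> g + X2) q"
        using TF_G_disjoint[OF 2 1] by (simp only: fscale_apply right_minus_eq)
    qed
    then show "\<exists>b\<in>Cinf. \<exists>Z\<in>vfields. b p \<noteq> 0 \<and> b \<cdot> Y = Z"
      using b secs_vfields[OF Z] by blast
  qed
  then have "Y \<in> secs G" "X - Y \<in> \<Gamma>TF"
    using Y vfields_diff[OF X] unfolding secs_def by simp_all
  then show ?thesis using that[of "X - Y" Y] by simp
qed

text \<open>The projection of vector fields onto \<open>TF\<close> along \<open>G\<close>, which on
  symbols is the effect of \<open>prK\<close>. The choice is harmless by
  \<open>TF_part_eqI\<close>.\<close>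

definition TF_part :: "'c vfield \<Rightarrow> 'c vfield" where
  "TF_part X = (SOME X1. X1 \<in> \<Gamma>TF \<and> X - X1 \<in> secs G)"

lemma TF_part:
  assumes "X \<in> vfields"
  shows "TF_part X \<in> \<Gamma>TF" "X - TF_part X \<in> secs G"
proof -
  obtain X1 X2 where "X1 \<in> \<Gamma>TF" "X2 \<in> secs G" "X = X1 + X2"
    by (rule vfields_split[OF assms])
  then have "X1 \<in> \<Gamma>TF \<and> X - X1 \<in> secs G" by simp
  then have "TF_part X \<in> \<Gamma>TF \<and> X - TF_part X \<in> secs G"
    unfolding TF_part_def by (rule someI[of "\<lambda>X1. X1 \<in> \<Gamma>TF \<and> X - X1 \<in> secs G"])
  then show "TF_part X \<in> \<Gamma>TF" "X - TF_part X \<in> secs G" by auto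
qed

lemma TF_part_eqI:
  assumes "X1 \<in> \<Gamma>TF" "X - X1 \<in> secs G"
  shows "TF_part X = X1"
proof -
  have X: "X \<in> vfields"
    using vfields_add[OF secs_vfields[OF assms(2)] secs_vfields[OF assms(1)]] by simp
  have "(X - X1) - (X - TF_part X) \<in> secs G"
    by (intro secs_G(3) assms TF_part X)
  then have G: "TF_part X - X1 \<in> secs G" by simp
  have "TF_part X - X1 \<in> \<Gamma>TF"
    by (intro secs_TF(3) assms TF_part X)
  from GTF_G_disjoint[OF this G] show ?thesis by simp
qed

lemma TF_part_G: "X \<in> secs G \<Longrightarrow> TF_part X = 0"
  by (intro TF_part_eqI secs_TF(1)) simp

lemma TF_part_add:
  assumes "X \<in> vfields" "Y \<in> vfields"
  shows "TF_part (X + Y) = TF_part X + TF_part Y"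
proof (rule TF_part_eqI)
  have "(X - TF_part X) + (Y - TF_part Y) \<in> secs G"
    by (intro secs_G(2) TF_part assms)
  then show "X + Y - (TF_part X + TF_part Y) \<in> secs G"
    by (simp only: add_diff_add)
qed (intro secs_TF TF_part assms)

lemma TF_part_fscale:
  assumes "X \<in> vfields" "f \<in> Cinf"
  shows "TF_part (f \<cdot> X) = f \<cdot> TF_part X"
proof (rule TF_part_eqI)
  have "f \<cdot> (X - TF_part X) \<in> secs G"
    by (intro secs_G(4) TF_part assms)
  moreover have "f \<cdot> (X - TF_part X) = f \<cdot> X - f \<cdot> TF_part X"
    by (rule ext) (simp only: fscale_apply minus_apply scaleR_diff_right)
  ultimately show "f \<cdot> X - f \<cdot> TF_part X \<in> secs G" by (simp only:)
qed (intro secs_TF TF_part assms)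

end

section \<open>Derivations of the line bundle\<close>

context complemented_manifold
begin

lemma cls_GL: "Y \<in> vfields \<Longrightarrow> \<theta> Y \<in> \<Gamma>L"
  by (rule cls_qsecs)

lemma nonvanishing_section: obtains s where "s \<in> \<Gamma>L" "s p \<noteq> 0"
proof -
  obtain g where g: "g \<in> secs G" "g p \<notin> \<xi> p" by (rule transversal_section)
  show ?thesis
    by (rule that[of "\<theta> g"]) (use g cls_GL[OF secs_vfields[OF g(1)]] theta_eq_0_at in auto)
qed

text \<open>At each point some section of \<ell> is nonzero, and the Leibniz rule for it determines
  the derivative of \<open>f\<close> there.\<close>

lemma symbol_rel_unique:
  assumes "symbol_rel \<Delta> X" "symbol_rel \<Delta> X'"
  shows "X = X'"
proof (intro ext)
  fix p f
  have v: "X \<in> vfields" "X' \<in> vfields" using assms by (simp_all add: symbol_rel_def)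
  show "X p f = X' p f"
  proof (cases "f \<in> Cinf")
    case True
    obtain s where s: "s \<in> \<Gamma>L" "s p \<noteq> 0" by (rule nonvanishing_section)
    have "(\<lambda>p. X p f) \<cdot> s + f \<cdot> \<Delta> s = (\<lambda>p. X' p f) \<cdot> s + f \<cdot> \<Delta> s"
      using assms True s(1) unfolding symbol_rel_def by metis
    then have "(\<lambda>p. X p f) \<cdot> s = (\<lambda>p. X' p f) \<cdot> s"
      by (rule add_right_imp_eq)
    then have "X p f *\<^sub>R s p = X' p f *\<^sub>R s p"
      by (metis fscale_apply)
    then show ?thesis using s(2) by (metis scaleR_right_imp_eq)
  next
    case False
    then show ?thesis
      using tangent_notin[OF vfields_tangent[OF v(1)]] tangent_notin[OF vfields_tangent[OF v(2)]] by metis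
  qed
qed

lemma symbol_eq: "symbol_rel \<Delta> X \<Longrightarrow> \<sigma> \<Delta> = X"
  unfolding \<sigma>_def by (rule the_equality) (auto dest: symbol_rel_unique)

lemma GD_symbol: "\<Delta> \<in> \<Gamma>D \<Longrightarrow> symbol_rel \<Delta> (\<sigma> \<Delta>)"
  unfolding \<Gamma>D_def using symbol_eq by blast

lemma GD_symbol_vfields: "\<Delta> \<in> \<Gamma>D \<Longrightarrow> \<sigma> \<Delta> \<in> vfields"
  using GD_symbol unfolding symbol_rel_def by blast

lemma GD_Leibniz:
  "\<Delta> \<in> \<Gamma>D \<Longrightarrow> f \<in> Cinf \<Longrightarrow> s \<in> \<Gamma>L \<Longrightarrow> \<Delta> (f \<cdot> s) = (\<lambda>p. \<sigma> \<Delta> p f) \<cdot> s + f \<cdot> \<Delta> s"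
  using GD_symbol unfolding symbol_rel_def by blast

lemma GD_range: "\<Delta> \<in> \<Gamma>D \<Longrightarrow> s \<in> \<Gamma>L \<Longrightarrow> \<Delta> s \<in> \<Gamma>L"
  unfolding \<Gamma>D_def by blast

lemma GD_outside: "\<Delta> \<in> \<Gamma>D \<Longrightarrow> s \<notin> \<Gamma>L \<Longrightarrow> \<Delta> s = 0"
  unfolding \<Gamma>D_def by blast

lemma GD_add: "\<Delta> \<in> \<Gamma>D \<Longrightarrow> s \<in> \<Gamma>L \<Longrightarrow> t \<in> \<Gamma>L \<Longrightarrow> \<Delta> (s + t) = \<Delta> s + \<Delta> t"
  unfolding \<Gamma>D_def by blast

lemma GD_0: "\<Delta> \<in> \<Gamma>D \<Longrightarrow> \<Delta> 0 = 0"
  using GD_add[of \<Delta> 0 0] qsecs_0 by simp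

text \<open>Real homogeneity follows from the Leibniz rule for constant functions, which vector
  fields annihilate.\<close>

lemma GD_I:
  assumes "\<And>s. s \<in> \<Gamma>L \<Longrightarrow> \<Delta> s \<in> \<Gamma>L" "\<And>s. s \<notin> \<Gamma>L \<Longrightarrow> \<Delta> s = 0"
    and "\<And>s t. s \<in> \<Gamma>L \<Longrightarrow> t \<in> \<Gamma>L \<Longrightarrow> \<Delta> (s + t) = \<Delta> s + \<Delta> t"
    and X: "X \<in> vfields"
    and L: "\<And>f s. f \<in> Cinf \<Longrightarrow> s \<in> \<Gamma>L \<Longrightarrow> \<Delta> (f \<cdot> s) = (\<lambda>p. X p f) \<cdot> s + f \<cdot> \<Delta> s"
  shows "\<Delta> \<in> \<Gamma>D \<and> \<sigma> \<Delta> = X"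
proof
  have sr: "symbol_rel \<Delta> X"
    using X L unfolding symbol_rel_def by blast
  have "\<Delta> (c *\<^sub>R s) = c *\<^sub>R \<Delta> s" if s: "s \<in> \<Gamma>L" for c s
  proof -
    have 1: "(\<lambda>p. c) \<cdot> t = c *\<^sub>R t" for t :: "'c qsec"
      by (rule ext) simp
    have "(\<lambda>p. X p (\<lambda>q. c)) \<cdot> s = 0"
      by (rule ext) (simp add: tangent_const[OF vfields_tangent[OF X]])
    then show ?thesis
      using L[OF Cinf_const[of c] s] unfolding 1 by (simp only: add_0_left)
  qed
  then show "\<Delta> \<in> \<Gamma>D"
    unfolding \<Gamma>D_def using assms(1-3) sr by blast
  show "\<sigma> \<Delta> = X" by (rule symbol_eq[OF sr])
qed

section \<open>Existence of derivations\<close>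

lemma GD_construct:
  assumes range: "\<And>Y. Y \<in> vfields \<Longrightarrow> F Y \<in> \<Gamma>L"
    and add: "\<And>Y Y'. Y \<in> vfields \<Longrightarrow> Y' \<in> vfields \<Longrightarrow> F (Y + Y') = F Y + F Y'"
    and ker: "\<And>Y. Y \<in> secs \<xi> \<Longrightarrow> F Y = 0"
    and X: "X \<in> vfields"
    and L: "\<And>f Y. f \<in> Cinf \<Longrightarrow> Y \<in> vfields \<Longrightarrow> F (f \<cdot> Y) = (\<lambda>p. X p f) \<cdot> \<theta> Y + f \<cdot> F Y"
  shows "\<exists>\<Delta>\<in>\<Gamma>D. \<sigma> \<Delta> = X \<and> (\<forall>Y\<in>vfields. \<Delta> (\<theta> Y) = F Y)"
proof -
  obtain \<Delta> where \<Delta>: "\<And>Y. Y \<in> vfields \<Longrightarrow> \<Delta> (\<theta> Y) = F Y" "\<And>s. s \<notin> \<Gamma>L \<Longrightarrow> \<Delta> s = 0"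
    using cls_lift[of \<xi> F, OF subspace_xi add ker] by blast
  have 1: "\<Delta> s \<in> \<Gamma>L" if "s \<in> \<Gamma>L" for s
    using that by (elim qsecsE) (metis \<Delta>(1) range)
  have 2: "\<Delta> (s + t) = \<Delta> s + \<Delta> t" if "s \<in> \<Gamma>L" "t \<in> \<Gamma>L" for s t
  proof -
    obtain Y Y' where Y: "Y \<in> vfields" "s = \<theta> Y" "Y' \<in> vfields" "t = \<theta> Y'"
      using \<open>s \<in> \<Gamma>L\<close> \<open>t \<in> \<Gamma>L\<close> by (elim qsecsE)
    show ?thesis
      unfolding Y(2,4) cls_add[symmetric] \<Delta>(1)[OF Y(1)] \<Delta>(1)[OF Y(3)] \<Delta>(1)[OF vfields_add[OF Y(1,3)]]
      by (rule add[OF Y(1,3)])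
  qed
  have 3: "\<Delta> (f \<cdot> s) = (\<lambda>p. X p f) \<cdot> s + f \<cdot> \<Delta> s" if f: "f \<in> Cinf" and "s \<in> \<Gamma>L" for f s
  proof -
    obtain Y where Y: "Y \<in> vfields" "s = \<theta> Y"
      using \<open>s \<in> \<Gamma>L\<close> by (elim qsecsE)
    show ?thesis
      unfolding Y(2) cls_fscale[symmetric] \<Delta>(1)[OF Y(1)] \<Delta>(1)[OF vfields_fscale[OF f Y(1)]]
      unfolding L[OF f Y(1)] cls_fscale ..
  qed
  show ?thesis
    using GD_I[of \<Delta> X, OF 1 \<Delta>(2) 2 X 3] \<Delta>(1) by blast
qed

text \<open>The identity of \<open>\<Gamma>L\<close>, normalised to zero elsewhere as
  \<open>\<Gamma>D\<close> demands. Pairing with it under \<open>varpi\<close> gives minus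
  \<open>\<theta>\<close> of the symbol, which is how symbols are shown to lie in
  \<open>\<xi>\<close>.\<close>

lemma GD_identity: "\<exists>\<Delta>\<in>\<Gamma>D. \<sigma> \<Delta> = 0 \<and> (\<forall>Y\<in>vfields. \<Delta> (\<theta> Y) = \<theta> Y)"
proof (rule GD_construct)
  show "\<theta> (f \<cdot> Y) = (\<lambda>p. (0 :: 'c vfield) p f) \<cdot> \<theta> Y + f \<cdot> \<theta> Y" for f Y
    unfolding cls_fscale by (rule ext) simp
qed (simp_all only: cls_GL cls_add theta_eq_0 vfields_0)

text \<open>Where \<open>b\<close> is nonzero, \<open>\<theta> g\<close> trivialises \<ell> and
  defines a flat connection for which it is parallel. A factor clears the denominators and makes the
  resulting derivations global.\<close>

lemma GD_local_connection:
  "\<exists>b\<in>Cinf. b p \<noteq> 0 \<and> (\<forall>Z\<in>vfields. \<exists>\<Delta>\<in>\<Gamma>D. \<sigma> \<Delta> = b \<cdot> Z)"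
proof -
  obtain g where g: "g \<in> secs G" "g p \<notin> \<xi> p" by (rule transversal_section)
  obtain b \<alpha> where b: "b \<in> Cinf" "b p \<noteq> 0" and \<alpha>: "covector_field \<alpha>"
    and \<alpha>0: "\<And>q w. w \<in> \<xi> q \<Longrightarrow> \<alpha> q w = 0"
    and \<alpha>\<xi>: "\<And>q w. w \<in> tangent q \<Longrightarrow> b q *\<^sub>R w - \<alpha> q w *\<^sub>R g q \<in> \<xi> q"
    by (rule conormal[OF secs_vfields[OF g(1)] g(2)]) blast
  have lin: "linear (\<alpha> q)" for q using \<alpha> by (simp add: covector_field_def)
  define a where "a Y q = \<alpha> q (Y q)" for Y q
  have a: "a Y \<in> Cinf" if "Y \<in> vfields" for Y
    using \<alpha> that unfolding covector_field_def a_def[abs_def] by blast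
  have ath: "b q *\<^sub>R \<theta> Y q = a Y q *\<^sub>R \<theta> g q" if "Y \<in> vfields" for Y q
    using fun_cong[OF conormal_theta[OF that \<alpha>\<xi>], of q] by (simp add: a_def)
  have "\<exists>\<Delta>\<in>\<Gamma>D. \<sigma> \<Delta> = (\<lambda>q. b q * b q) \<cdot> Z" if Z: "Z \<in> vfields" for Z
  proof -
    \<comment> \<open>By the quotient rule this is b^2 times the derivative along \<open>Z\<close>
      of the coefficient \<open>a Y / b\<close> of \<open>\<theta> Y\<close>; hence the symbol b^2
      Z.\<close>
    define F where "F Y = (\<lambda>q. b q * Z q (a Y) - Z q b * a Y q) \<cdot> \<theta> g" for Y
    have "\<exists>\<Delta>\<in>\<Gamma>D. \<sigma> \<Delta> = (\<lambda>q. b q * b q) \<cdot> Z \<and> (\<forall>Y\<in>vfields. \<Delta> (\<theta> Y) = F Y)"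
    proof (rule GD_construct)
      show "F Y \<in> \<Gamma>L" if "Y \<in> vfields" for Y
        unfolding F_def
        by (intro qsecs_fscale Cinf_diff Cinf_mult b a that vfields_Cinf[OF Z] cls_GL secs_vfields[OF g(1)])
      show "F (Y + Y') = F Y + F Y'" if "Y \<in> vfields" "Y' \<in> vfields" for Y Y'
      proof -
        have "a (Y + Y') = (\<lambda>q. a Y q + a Y' q)"
          by (simp add: a_def[abs_def] linear_add[OF lin])
        then show ?thesis
          unfolding F_def
          by (intro ext) (simp add: tangent_add[OF vfields_tangent[OF Z] a a] that algebra_simps)
      qed
      show "F Y = 0" if "Y \<in> secs \<xi>" for Y
      proof -
        have "a Y = (\<lambda>q. 0)"
          using \<alpha>0[OF secs_at[OF that]] by (simp add: a_def[abs_def])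
        then show ?thesis
          unfolding F_def by (intro ext) (simp add: tangent_const[OF vfields_tangent[OF Z]])
      qed
      show "(\<lambda>q. b q * b q) \<cdot> Z \<in> vfields"
        by (intro vfields_fscale Cinf_mult b Z)
      show "F (f \<cdot> Y) = (\<lambda>p. ((\<lambda>q. b q * b q) \<cdot> Z) p f) \<cdot> \<theta> Y + f \<cdot> F Y"
        if f: "f \<in> Cinf" and Y: "Y \<in> vfields" for f Y
      proof (intro ext)
        fix q x
        have "a (f \<cdot> Y) = (\<lambda>q. f q * a Y q)"
          by (simp add: a_def[abs_def] linear_scale[OF lin])
        then have "F (f \<cdot> Y) q x =
            (b q * (Z q f * a Y q + f q * Z q (a Y)) - Z q b * (f q * a Y q)) * \<theta> g q x"
          by (simp only: F_def fscale_apply scaleR_fun_apply real_scaleR_def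
              tangent_mult[OF vfields_tangent[OF Z] f a[OF Y]])
        also have "\<dots> = b q * Z q f * (a Y q * \<theta> g q x) + f q * F Y q x"
          by (simp add: F_def algebra_simps)
        also have "a Y q * \<theta> g q x = b q * \<theta> Y q x"
          using fun_cong[OF ath[OF Y, of q], of x] by simp
        finally have e: "F (f \<cdot> Y) q x = b q * Z q f * (b q * \<theta> Y q x) + f q * F Y q x" .
        show "F (f \<cdot> Y) q x = ((\<lambda>p. ((\<lambda>q. b q * b q) \<cdot> Z) p f) \<cdot> \<theta> Y + f \<cdot> F Y) q x"
          unfolding e by (simp only: fscale_apply plus_fun_apply scaleR_fun_apply real_scaleR_def mult_ac)
      qed
    qed
    then show ?thesis by blast
  qed
  then show ?thesis
    using Cinf_mult[OF b(1) b(1)] b(2) by (intro bexI[of _ "\<lambda>q. b q * b q"]) auto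
qed

section \<open>Differences and commutators of derivations, and a formula for
  \<open>varpi\<close>\<close>

lemma GD_diff:
  assumes D: "\<Delta> \<in> \<Gamma>D" and D': "\<Delta>' \<in> \<Gamma>D"
  shows "\<Delta> - \<Delta>' \<in> \<Gamma>D" "\<sigma> (\<Delta> - \<Delta>') = \<sigma> \<Delta> - \<sigma> \<Delta>'"
proof -
  have c: "(\<Delta> - \<Delta>') s = \<Delta> s - \<Delta>' s" for s
    by (rule minus_apply)
  have "\<Delta> - \<Delta>' \<in> \<Gamma>D \<and> \<sigma> (\<Delta> - \<Delta>') = \<sigma> \<Delta> - \<sigma> \<Delta>'"
  proof (rule GD_I)
    fix f s assume "f \<in> Cinf" "s \<in> \<Gamma>L"
    then show "(\<Delta> - \<Delta>') (f \<cdot> s) = (\<lambda>p. (\<sigma> \<Delta> - \<sigma> \<Delta>') p f) \<cdot> s + f \<cdot> (\<Delta> - \<Delta>') s"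
      unfolding c GD_Leibniz[OF D \<open>f \<in> Cinf\<close> \<open>s \<in> \<Gamma>L\<close>] GD_Leibniz[OF D' \<open>f \<in> Cinf\<close> \<open>s \<in> \<Gamma>L\<close>]
      by (intro ext) (simp add: algebra_simps)
  next
    fix s t assume "s \<in> \<Gamma>L" "t \<in> \<Gamma>L"
    then show "(\<Delta> - \<Delta>') (s + t) = (\<Delta> - \<Delta>') s + (\<Delta> - \<Delta>') t"
      unfolding c GD_add[OF D \<open>s \<in> \<Gamma>L\<close> \<open>t \<in> \<Gamma>L\<close>] GD_add[OF D' \<open>s \<in> \<Gamma>L\<close> \<open>t \<in> \<Gamma>L\<close>]
      by (intro ext) simp
  next
    fix s assume "s \<in> \<Gamma>L"
    then show "(\<Delta> - \<Delta>') s \<in> \<Gamma>L"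
      unfolding c by (intro qsecs_diff GD_range[OF D] GD_range[OF D'])
  next
    fix s assume "s \<notin> \<Gamma>L"
    then show "(\<Delta> - \<Delta>') s = 0"
      using GD_outside[OF D] GD_outside[OF D'] unfolding c by simp
  qed (intro vfields_diff GD_symbol_vfields assms)
  then show "\<Delta> - \<Delta>' \<in> \<Gamma>D" "\<sigma> (\<Delta> - \<Delta>') = \<sigma> \<Delta> - \<sigma> \<Delta>'" by auto
qed

lemma GD_comm:
  assumes D: "\<Delta> \<in> \<Gamma>D" and D': "\<Delta>' \<in> \<Gamma>D"
  shows "comm \<Delta> \<Delta>' \<in> \<Gamma>D" "\<sigma> (comm \<Delta> \<Delta>') = bracket (\<sigma> \<Delta>) (\<sigma> \<Delta>')"
proof -
  have c: "comm \<Delta> \<Delta>' s = \<Delta> (\<Delta>' s) - \<Delta>' (\<Delta> s)" for s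
    by (simp add: comm_def)
  note r = GD_range[OF D] GD_range[OF D']
  note v = GD_symbol_vfields[OF D] GD_symbol_vfields[OF D']
  have "comm \<Delta> \<Delta>' \<in> \<Gamma>D \<and> \<sigma> (comm \<Delta> \<Delta>') = bracket (\<sigma> \<Delta>) (\<sigma> \<Delta>')"
  proof (rule GD_I)
    fix f s assume f: "f \<in> Cinf" and s: "s \<in> \<Gamma>L"
    have 1: "E (E' (f \<cdot> s)) = (\<lambda>p. \<sigma> E p (\<lambda>q. \<sigma> E' q f)) \<cdot> s + (\<lambda>p. \<sigma> E' p f) \<cdot> E s
        + ((\<lambda>p. \<sigma> E p f) \<cdot> E' s + f \<cdot> E (E' s))"
      if E: "E \<in> \<Gamma>D" and E': "E' \<in> \<Gamma>D" for E E'
    proof -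
      note x = vfields_Cinf[OF GD_symbol_vfields[OF E'], of f]
      show ?thesis
        unfolding GD_Leibniz[OF E' f s]
          GD_add[OF E qsecs_fscale[OF x s] qsecs_fscale[OF f GD_range[OF E' s]]]
          GD_Leibniz[OF E x s] GD_Leibniz[OF E f GD_range[OF E' s]] ..
    qed
    show "comm \<Delta> \<Delta>' (f \<cdot> s) = (\<lambda>p. bracket (\<sigma> \<Delta>) (\<sigma> \<Delta>') p f) \<cdot> s + f \<cdot> comm \<Delta> \<Delta>' s"
      unfolding c 1[OF D D'] 1[OF D' D] bracket_def
      by (intro ext) (simp add: algebra_simps)
  next
    fix s t assume s: "s \<in> \<Gamma>L" "t \<in> \<Gamma>L"
    show "comm \<Delta> \<Delta>' (s + t) = comm \<Delta> \<Delta>' s + comm \<Delta> \<Delta>' t"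
      unfolding c GD_add[OF D s] GD_add[OF D' s] GD_add[OF D r(2)[OF s(1)] r(2)[OF s(2)]]
        GD_add[OF D' r(1)[OF s(1)] r(1)[OF s(2)]]
      by (intro ext) simp
  next
    fix s assume "s \<in> \<Gamma>L"
    then show "comm \<Delta> \<Delta>' s \<in> \<Gamma>L"
      unfolding c by (intro qsecs_diff r)
  next
    fix s assume "s \<notin> \<Gamma>L"
    then show "comm \<Delta> \<Delta>' s = 0"
      unfolding c GD_outside[OF D \<open>s \<notin> \<Gamma>L\<close>] GD_outside[OF D' \<open>s \<notin> \<Gamma>L\<close>] GD_0[OF D] GD_0[OF D'] by simp
  qed (intro bracket_vfields v)
  then show "comm \<Delta> \<Delta>' \<in> \<Gamma>D" "\<sigma> (comm \<Delta> \<Delta>') = bracket (\<sigma> \<Delta>) (\<sigma> \<Delta>')" by auto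
qed

lemma varpi_eq:
  assumes "\<Delta> \<in> \<Gamma>D" "\<Delta>' \<in> \<Gamma>D"
  shows "varpi \<Delta> \<Delta>' = \<Delta> (\<theta> (\<sigma> \<Delta>')) - \<Delta>' (\<theta> (\<sigma> \<Delta>)) - \<theta> (bracket (\<sigma> \<Delta>) (\<sigma> \<Delta>'))"
  unfolding varpi_def dD_def GD_comm(2)[OF assms] ..

text \<open>Agreement of a derivation and a Lie derivative can be tested on symbols of derivations, by
  cutting off.\<close>

lemma GD_eq_bracket_local:
  assumes D: "\<Delta> \<in> \<Gamma>D" and W: "\<And>p. subspace (W p)" and Y: "Y \<in> secs W"
    and lin: "\<And>f. f \<in> Cinf \<Longrightarrow> B (f \<cdot> Y) = f \<cdot> B Y"
    and eq: "\<And>\<Delta>'. \<Delta>' \<in> \<Gamma>D \<Longrightarrow> \<sigma> \<Delta>' \<in> secs W \<Longrightarrow>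
      \<Delta> (\<theta> (\<sigma> \<Delta>')) = \<theta> (bracket (\<sigma> \<Delta>) (\<sigma> \<Delta>')) + B (\<sigma> \<Delta>')"
  shows "\<Delta> (\<theta> Y) = \<theta> (bracket (\<sigma> \<Delta>) Y) + B Y"
proof (intro ext)
  fix p x
  note v = secs_vfields[OF Y] GD_symbol_vfields[OF D]
  obtain b where b: "b \<in> Cinf" "b p \<noteq> 0" "\<forall>Z\<in>vfields. \<exists>\<Delta>\<in>\<Gamma>D. \<sigma> \<Delta> = b \<cdot> Z"
    using GD_local_connection[of p] by blast
  obtain \<Delta>' where D': "\<Delta>' \<in> \<Gamma>D" "\<sigma> \<Delta>' = b \<cdot> Y" using b(3) v(1) by blast
  have bY: "b \<cdot> Y \<in> secs W" by (rule secs_closed(4)[of W, OF W b(1) Y])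
  have "(\<lambda>p. \<sigma> \<Delta> p b) \<cdot> \<theta> Y + b \<cdot> \<Delta> (\<theta> Y) =
      b \<cdot> \<theta> (bracket (\<sigma> \<Delta>) Y) + (\<lambda>p. \<sigma> \<Delta> p b) \<cdot> \<theta> Y + b \<cdot> B Y"
    using eq[OF D'(1)] bY
    unfolding D'(2) cls_fscale GD_Leibniz[OF D b(1) cls_GL[OF v(1)]]
      bracket_fscale_right[OF v(2,1) b(1)] cls_add lin[OF b(1)]
    by (simp only: simp_thms)
  then have "((\<lambda>p. \<sigma> \<Delta> p b) \<cdot> \<theta> Y + b \<cdot> \<Delta> (\<theta> Y)) p x =
      (b \<cdot> \<theta> (bracket (\<sigma> \<Delta>) Y) + (\<lambda>p. \<sigma> \<Delta> p b) \<cdot> \<theta> Y + b \<cdot> B Y) p x"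
    by (rule fun_cong[OF fun_cong])
  then have "b p * \<Delta> (\<theta> Y) p x = b p * (\<theta> (bracket (\<sigma> \<Delta>) Y) p x + B Y p x)"
    by (simp add: algebra_simps)
  then show "\<Delta> (\<theta> Y) p x = (\<theta> (bracket (\<sigma> \<Delta>) Y) + B Y) p x"
    using b(2) by simp
qed

subsection \<open>The kernel of \<open>\<varpi>\<close>\<close>

text \<open>Elements of the kernel are Lie derivatives along \<open>TF\<close>. Pairing with the
  identity puts the symbol into \<open>\<xi>\<close>; the other pairings then say that the
  derivation is the Lie derivative along its symbol. As it is well defined on classes, its symbol
  must preserve \<open>\<xi>\<close>.\<close>

lemma GK_D:
  assumes K: "\<Delta> \<in> \<Gamma>K"
  shows "\<Delta> \<in> \<Gamma>D" "\<sigma> \<Delta> \<in> \<Gamma>TF" "\<And>Y. Y \<in> vfields \<Longrightarrow> \<Delta> (\<theta> Y) = \<theta> (bracket (\<sigma> \<Delta>) Y)"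
proof -
  show D: "\<Delta> \<in> \<Gamma>D" using K by (simp add: \<Gamma>K_def)
  have 0: "varpi \<Delta> \<Delta>' = 0" if "\<Delta>' \<in> \<Gamma>D" for \<Delta>'
    using K that by (simp add: \<Gamma>K_def)
  note v = GD_symbol_vfields[OF D]
  obtain E where E: "E \<in> \<Gamma>D" "\<sigma> E = 0" "\<forall>Y\<in>vfields. E (\<theta> Y) = \<theta> Y"
    using GD_identity by blast
  have "\<theta> (\<sigma> \<Delta>) = 0"
    using 0[OF E(1)] E(3) v unfolding varpi_eq[OF D E(1)] E(2) bracket_0_right[OF v] cls_0 GD_0[OF D] by simp
  then have X: "\<sigma> \<Delta> \<in> secs \<xi>"
    using cls_eq_0[of \<xi>, OF subspace_xi v] by blast
  show br: "\<Delta> (\<theta> Y) = \<theta> (bracket (\<sigma> \<Delta>) Y)" if Y: "Y \<in> vfields" for Y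
  proof -
    \<comment> \<open>The zero term matches \<open>GD_eq_bracket_local\<close>, here with
      \<open>B\<close> zero and \<open>W\<close> the full tangent bundle.\<close>
    have "\<Delta> (\<theta> Y) = \<theta> (bracket (\<sigma> \<Delta>) Y) + (\<lambda>Y. 0) Y"
    proof (rule GD_eq_bracket_local[where W = tangent, OF D subspace_tangent])
      show "Y \<in> secs tangent" using Y vfields_tangent[OF Y] by (simp add: secs_def)
      show "0 = f \<cdot> (0 :: 'c qsec)" for f by (rule ext) simp
      show "\<Delta> (\<theta> (\<sigma> \<Delta>')) = \<theta> (bracket (\<sigma> \<Delta>) (\<sigma> \<Delta>')) + 0" if D': "\<Delta>' \<in> \<Gamma>D" for \<Delta>'
        using 0[OF D'] unfolding varpi_eq[OF D D'] theta_eq_0[OF X] GD_0[OF D'] by simp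
    qed
    then show ?thesis by (simp only: add_0_right)
  qed
  show "\<sigma> \<Delta> \<in> \<Gamma>TF"
    unfolding GTF_iff[OF X]
  proof
    fix Y assume Y: "Y \<in> secs \<xi>"
    show "\<omega> (\<sigma> \<Delta>) Y = 0"
      unfolding \<omega>_def br[OF secs_vfields[OF Y], symmetric] theta_eq_0[OF Y] by (rule GD_0[OF D])
  qed
qed

lemma GK_I:
  assumes D: "\<Delta> \<in> \<Gamma>D" and X: "\<sigma> \<Delta> \<in> \<Gamma>TF"
    and br: "\<And>Y. Y \<in> vfields \<Longrightarrow> \<Delta> (\<theta> Y) = \<theta> (bracket (\<sigma> \<Delta>) Y)"
  shows "\<Delta> \<in> \<Gamma>K"
proof -
  have "varpi \<Delta> \<Delta>' = 0" if D': "\<Delta>' \<in> \<Gamma>D" for \<Delta>'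
    unfolding varpi_eq[OF D D'] br[OF GD_symbol_vfields[OF D']] theta_eq_0[OF GTF_secs_xi[OF X]] GD_0[OF D']
    by simp
  then show ?thesis using D by (simp add: \<Gamma>K_def)
qed

text \<open>The Lie derivative along a section of \<open>TF\<close> descends to \<ell> because it
  preserves \<open>\<xi>\<close>.\<close>

lemma GK_exists:
  assumes X: "X \<in> \<Gamma>TF"
  obtains \<Delta> where "\<Delta> \<in> \<Gamma>K" "\<sigma> \<Delta> = X"
proof -
  note v = secs_vfields[OF X]
  have "\<exists>\<Delta>\<in>\<Gamma>D. \<sigma> \<Delta> = X \<and> (\<forall>Y\<in>vfields. \<Delta> (\<theta> Y) = \<theta> (bracket X Y))"
  proof (rule GD_construct[OF _ _ _ v])
    show "\<theta> (bracket X Y) \<in> \<Gamma>L" if "Y \<in> vfields" for Y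
      by (intro cls_GL bracket_vfields v that)
    show "\<theta> (bracket X (Y + Y')) = \<theta> (bracket X Y) + \<theta> (bracket X Y')" if "Y \<in> vfields" "Y' \<in> vfields" for Y Y'
      unfolding bracket_add_right[OF v that] cls_add ..
    show "\<theta> (bracket X Y) = 0" if "Y \<in> secs \<xi>" for Y
      by (rule theta_eq_0[OF bracket_GTF_xi[OF X that]])
    show "\<theta> (bracket X (f \<cdot> Y)) = (\<lambda>p. X p f) \<cdot> \<theta> Y + f \<cdot> \<theta> (bracket X Y)"
      if "f \<in> Cinf" "Y \<in> vfields" for f Y
      unfolding bracket_fscale_right[OF v that(2,1)] cls_add cls_fscale by (rule add.commute)
  qed
  then obtain \<Delta> where "\<Delta> \<in> \<Gamma>D" "\<sigma> \<Delta> = X" "\<forall>Y\<in>vfields. \<Delta> (\<theta> Y) = \<theta> (bracket X Y)"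
    by blast
  then show ?thesis using that GK_I X by blast
qed

lemma GK_eqI:
  assumes K: "\<Delta> \<in> \<Gamma>K" "\<Delta>' \<in> \<Gamma>K" and eq: "\<sigma> \<Delta> = \<sigma> \<Delta>'"
  shows "\<Delta> = \<Delta>'"
proof
  fix s
  show "\<Delta> s = \<Delta>' s"
  proof (cases "s \<in> \<Gamma>L")
    case True
    then obtain Y where Y: "Y \<in> vfields" "s = \<theta> Y" by (rule qsecsE)
    show ?thesis unfolding Y(2) GK_D(3)[OF K(1) Y(1)] GK_D(3)[OF K(2) Y(1)] eq ..
  next
    case False
    then show ?thesis
      using GD_outside[OF GK_D(1)[OF K(1)]] GD_outside[OF GK_D(1)[OF K(2)]] by simp
  qed
qed

text \<open>The symbol is injective on \<open>\<Gamma>K\<close> and maps it onto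
  \<open>\<Gamma>TF\<close>, while \<open>\<Gamma>Gt G\<close> consists of the derivations with
  symbol in \<open>G\<close>. So a derivation splits exactly as its symbol does.\<close>

lemma prK:
  assumes D: "\<Delta> \<in> \<Gamma>D"
  shows "prK G \<Delta> \<in> \<Gamma>K" "\<sigma> (prK G \<Delta>) = TF_part (\<sigma> \<Delta>)"
proof -
  note v = GD_symbol_vfields[OF D]
  obtain \<Delta>1 where K: "\<Delta>1 \<in> \<Gamma>K" "\<sigma> \<Delta>1 = TF_part (\<sigma> \<Delta>)"
    by (rule GK_exists[OF TF_part(1)[OF v]])
  have "prK G \<Delta> = \<Delta>1"
    unfolding prK_def
  proof (rule the_equality)
    show "\<Delta>1 \<in> \<Gamma>K \<and> \<Delta> - \<Delta>1 \<in> \<Gamma>Gt G"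
      using K GD_diff[OF D GK_D(1)[OF K(1)]] TF_part(2)[OF v] by (simp add: \<Gamma>Gt_def)
  next
    fix \<Delta>' assume D': "\<Delta>' \<in> \<Gamma>K \<and> \<Delta> - \<Delta>' \<in> \<Gamma>Gt G"
    then have "\<sigma> \<Delta> - \<sigma> \<Delta>' \<in> secs G"
      using GD_diff(2)[OF D GK_D(1)[OF conjunct1[OF D']]] by (simp add: \<Gamma>Gt_def)
    then have "TF_part (\<sigma> \<Delta>) = \<sigma> \<Delta>'"
      using D' GK_D(2) by (intro TF_part_eqI) auto
    then show "\<Delta>' = \<Delta>1"
      using D' K by (intro GK_eqI) auto
  qed
  then show "prK G \<Delta> \<in> \<Gamma>K" "\<sigma> (prK G \<Delta>) = TF_part (\<sigma> \<Delta>)" using K by auto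
qed

subsection \<open>The inverse of \<open>\<varpi>\<close> on the complement\<close>

lemma bundle_homD:
  assumes "h \<in> bundle_hom M N"
  shows "s \<in> M \<Longrightarrow> h s \<in> N" "s \<notin> M \<Longrightarrow> h s = 0" "s \<in> M \<Longrightarrow> t \<in> M \<Longrightarrow> h (s + t) = h s + h t"
    "f \<in> Cinf \<Longrightarrow> s \<in> M \<Longrightarrow> h (f \<cdot> s) = f \<cdot> h s"
  using assms unfolding bundle_hom_def by blast+

lemma bundle_hom_0:
  assumes "h \<in> bundle_hom M N" "0 \<in> M"
  shows "h 0 = 0"
  using bundle_homD(3)[OF assms(1) assms(2) assms(2)] by simp

lemma bundle_hom_uminus:
  assumes "h \<in> bundle_hom M N" "s \<in> M"
  shows "h (- s) = - h s"
proof -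
  have 1: "(\<lambda>p. - 1) \<cdot> t = - t" for t :: "'c \<Rightarrow> 'w::real_vector"
    by (rule ext) simp
  show ?thesis
    using bundle_homD(4)[OF assms(1) Cinf_const[of "-1"] assms(2)] unfolding 1 .
qed

text \<open>For a derivation with symbol \<open>Z\<close> in \<open>\<xi>\<close>, the equation says
  that it is the Lie derivative along \<open>Z\<close> plus \<open>\<beta>\<close>. Such a formula
  descends to \<ell> if it kills \<open>\<xi>\<close>: on \<open>TF\<close> this is automatic, and
  on \<open>H\<close> it says that \<open>\<omega> Z\<close> is minus \<open>\<beta>\<close>, which
  duality solves.\<close>

lemma sharp_exists:
  assumes \<beta>: "\<beta> \<in> bundle_hom \<Gamma>NF \<Gamma>L"
  shows "symbol_pullback G \<beta> \<in> varpi_flat G ` \<Gamma>Gt G"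
proof -
  note \<beta>' = bundle_homD[OF \<beta>]
  define \<mu> where "\<mu> Z = - \<beta> (cls TF Z)" for Z
  have m1: "\<mu> Z \<in> \<Gamma>L" if "Z \<in> secs H" for Z
    unfolding \<mu>_def by (intro qsecs_uminus \<beta>' cls_qsecs secs_vfields[OF that])
  have m2: "\<mu> (Z + Z') = \<mu> Z + \<mu> Z'" if "Z \<in> secs H" "Z' \<in> secs H" for Z Z'
    unfolding \<mu>_def cls_add \<beta>'(3)[OF cls_qsecs[OF secs_vfields[OF that(1)]] cls_qsecs[OF secs_vfields[OF that(2)]]]
    by (rule minus_add_distrib)
  have m3: "\<mu> (f \<cdot> Z) = f \<cdot> \<mu> Z" if "f \<in> Cinf" "Z \<in> secs H" for f Z
    unfolding \<mu>_def cls_fscale \<beta>'(4)[OF that(1) cls_qsecs[OF secs_vfields[OF that(2)]]] by (rule ext) simp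
  obtain Z where Z: "Z \<in> secs H" "\<And>Z'. Z' \<in> secs H \<Longrightarrow> \<omega> Z Z' = \<mu> Z'"
    using omega_H_duality[of \<mu>, OF m1 m2 m3] by blast
  note v = secs_vfields[OF Z(1)]
  define F where "F Y = \<theta> (bracket Z Y) + \<beta> (cls TF Y)" for Y
  have F_TF: "F Y = 0" if "Y \<in> \<Gamma>TF" for Y
  proof -
    have "bracket Z Y \<in> secs \<xi>"
      unfolding bracket_swap[of Z] by (intro secs_xi(5) bracket_GTF_xi that secs_HD(1) Z)
    moreover have "cls TF Y = 0"
      using cls_eq_0[of TF, OF subspace_TF secs_vfields[OF that]] that by blast
    ultimately show ?thesis
      unfolding F_def using theta_eq_0 bundle_hom_0[OF \<beta> qsecs_0] by simp
  qed
  have F_H: "F Y = 0" if "Y \<in> secs H" for Y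
    using Z(2)[OF that] unfolding F_def \<omega>_def \<mu>_def by simp
  have F_add: "F (Y + Y') = F Y + F Y'" if "Y \<in> vfields" "Y' \<in> vfields" for Y Y'
    unfolding F_def bracket_add_right[OF v that] cls_add \<beta>'(3)[OF cls_qsecs[OF that(1)] cls_qsecs[OF that(2)]]
    by (simp only: add_ac)
  have "\<exists>\<Delta>\<in>\<Gamma>D. \<sigma> \<Delta> = Z \<and> (\<forall>Y\<in>vfields. \<Delta> (\<theta> Y) = F Y)"
  proof (rule GD_construct[OF _ F_add _ v])
    show "F Y \<in> \<Gamma>L" if "Y \<in> vfields" for Y
      unfolding F_def by (intro qsecs_add cls_GL bracket_vfields v that \<beta>'(1) cls_qsecs)
    show "F Y = 0" if Y: "Y \<in> secs \<xi>" for Y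
    proof -
      obtain X1 X2 where X: "X1 \<in> \<Gamma>TF" "X2 \<in> secs H" "Y = X1 + X2" by (rule xi_split[OF Y])
      show ?thesis
        unfolding X(3) F_add[OF secs_vfields[OF X(1)] secs_vfields[OF X(2)]] F_TF[OF X(1)] F_H[OF X(2)]
        by simp
    qed
    show "F (f \<cdot> Y) = (\<lambda>p. Z p f) \<cdot> \<theta> Y + f \<cdot> F Y" if "f \<in> Cinf" "Y \<in> vfields" for f Y
      unfolding F_def bracket_fscale_right[OF v that(2,1)] cls_add cls_fscale
        \<beta>'(4)[OF that(1) cls_qsecs[OF that(2)]]
      by (rule ext) (simp add: scaleR_add_right)
  qed
  then obtain \<Delta> where D: "\<Delta> \<in> \<Gamma>D" "\<sigma> \<Delta> = Z" "\<forall>Y\<in>vfields. \<Delta> (\<theta> Y) = F Y"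
    by blast
  have "varpi \<Delta> \<Delta>' = \<beta> (cls TF (\<sigma> \<Delta>'))" if D': "\<Delta>' \<in> \<Gamma>D" for \<Delta>'
    using D(3) GD_symbol_vfields[OF D']
    unfolding varpi_eq[OF D(1) D'] D(2) theta_eq_0[OF secs_HD(1)[OF Z(1)]] GD_0[OF D'] by (simp add: F_def)
  then have "varpi_flat G \<Delta> = symbol_pullback G \<beta>"
    unfolding varpi_flat_def symbol_pullback_def by (intro ext) (simp add: \<Gamma>Gt_def)
  moreover have "\<Delta> \<in> \<Gamma>Gt G"
    using D(1,2) secs_HD(2)[OF Z(1)] by (simp add: \<Gamma>Gt_def)
  ultimately show ?thesis by (metis imageI)
qed

text \<open>Everything is read off from the equation that the preimage satisfies, so it holds for
  whichever preimage \<open>inv_into\<close> picks.\<close>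

lemma sharp:
  assumes \<beta>: "\<beta> \<in> bundle_hom \<Gamma>NF \<Gamma>L"
  shows "sharp G \<beta> \<in> \<Gamma>D" "\<sigma> (sharp G \<beta>) \<in> secs H"
    "\<And>Y. Y \<in> vfields \<Longrightarrow> sharp G \<beta> (\<theta> Y) = \<theta> (bracket (\<sigma> (sharp G \<beta>)) Y) + \<beta> (cls TF Y)"
proof -
  note \<beta>' = bundle_homD[OF \<beta>]
  define S where "S = sharp G \<beta>"
  define Z where "Z = \<sigma> S"
  have "S \<in> \<Gamma>Gt G"
    unfolding S_def sharp_def by (rule inv_into_into[OF sharp_exists[OF \<beta>]])
  then have S: "S \<in> \<Gamma>D" "Z \<in> secs G" by (simp_all add: \<Gamma>Gt_def Z_def)
  note v = secs_vfields[OF S(2)]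
  have "varpi_flat G S = symbol_pullback G \<beta>"
    unfolding S_def sharp_def by (rule f_inv_into_f[OF sharp_exists[OF \<beta>]])
  then have vp: "varpi S \<Delta>' = \<beta> (cls TF (\<sigma> \<Delta>'))" if "\<Delta>' \<in> \<Gamma>D" "\<sigma> \<Delta>' \<in> secs G" for \<Delta>'
  proof -
    have "varpi_flat G S \<Delta>' = symbol_pullback G \<beta> \<Delta>'"
      using \<open>varpi_flat G S = symbol_pullback G \<beta>\<close> by (rule fun_cong)
    then show ?thesis
      using that by (simp add: varpi_flat_def symbol_pullback_def \<Gamma>Gt_def)
  qed
  obtain E where E: "E \<in> \<Gamma>D" "\<sigma> E = 0" "\<forall>Y\<in>vfields. E (\<theta> Y) = \<theta> Y"
    using GD_identity by blast
  \<comment> \<open>The identity has symbol zero and so belongs to \<open>\<Gamma>Gt G\<close>;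
    testing with it shows that \<open>\<theta> Z\<close> vanishes.\<close>
  have "varpi S E = 0"
    unfolding vp[OF E(1), unfolded E(2), OF secs_G(1)] cls_0 by (rule bundle_hom_0[OF \<beta> qsecs_0])
  then have "\<theta> Z = 0"
    using E(3) v unfolding varpi_eq[OF S(1) E(1)] E(2) Z_def[symmetric] bracket_0_right[OF v] cls_0 GD_0[OF S(1)]
    by simp
  then have Z\<xi>: "Z \<in> secs \<xi>"
    using cls_eq_0[of \<xi>, OF subspace_xi v] by blast
  have G: "S (\<theta> Y) = \<theta> (bracket Z Y) + \<beta> (cls TF Y)" if Y: "Y \<in> secs G" for Y
    unfolding Z_def
  proof (rule GD_eq_bracket_local[where W = G and B = "\<lambda>Y. \<beta> (cls TF Y)", OF S(1) subspace_G Y])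
    show "\<beta> (cls TF (f \<cdot> Y)) = f \<cdot> \<beta> (cls TF Y)" if "f \<in> Cinf" for f
      unfolding cls_fscale by (rule \<beta>'(4)[OF that cls_qsecs[OF secs_vfields[OF Y]]])
    fix \<Delta>' assume D': "\<Delta>' \<in> \<Gamma>D" "\<sigma> \<Delta>' \<in> secs G"
    show "S (\<theta> (\<sigma> \<Delta>')) = \<theta> (bracket (\<sigma> S) (\<sigma> \<Delta>')) + \<beta> (cls TF (\<sigma> \<Delta>'))"
      using vp[OF D']
      unfolding varpi_eq[OF S(1) D'(1)] theta_eq_0[OF Z\<xi>, unfolded Z_def] GD_0[OF D'(1)]
      by (simp only: diff_0_right diff_eq_eq add.commute)
  qed
  \<comment> \<open>The equation was tested on \<open>G\<close>; on \<open>TF\<close> both sides are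
    zero since \<open>Z\<close> lies in \<open>\<xi>\<close>.\<close>
  have "S (\<theta> Y) = \<theta> (bracket Z Y) + \<beta> (cls TF Y)" if Y: "Y \<in> vfields" for Y
  proof -
    obtain X1 X2 where X: "X1 \<in> \<Gamma>TF" "X2 \<in> secs G" "Y = X1 + X2" by (rule vfields_split[OF Y])
    note w = secs_vfields[OF X(1)] secs_vfields[OF X(2)]
    have "bracket Z X1 \<in> secs \<xi>"
      unfolding bracket_swap[of Z] by (intro secs_xi(5) bracket_GTF_xi X Z\<xi>)
    moreover have "cls TF X1 = 0"
      using cls_eq_0[of TF, OF subspace_TF w(1)] X(1) by blast
    ultimately show ?thesis
      unfolding X(3) bracket_add_right[OF v w] cls_add
      by (simp only: theta_eq_0[OF GTF_secs_xi[OF X(1)]] theta_eq_0 add_0_left G[OF X(2)])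
  qed
  then show "S \<in> \<Gamma>D" "\<sigma> S \<in> secs H" "\<And>Y. Y \<in> vfields \<Longrightarrow> S (\<theta> Y) = \<theta> (bracket (\<sigma> S) Y) + \<beta> (cls TF Y)"
    using S secs_HI[OF Z\<xi> S(2)] unfolding Z_def by blast+
qed

text \<open>The symbol of \<open>sharp G \<beta>\<close> lies in \<open>G\<close>, so its
  \<open>K\<close>-part has symbol zero and the first term of \<open>dD\<close> drops out;
  \<open>prK\<close> preserves the symbol of \<open>\<Delta>\<close>.\<close>

lemma Phi_integrand:
  assumes \<beta>: "\<beta> \<in> bundle_hom \<Gamma>NF \<Gamma>L" and \<eta>: "\<eta> \<in> Omega1 \<xi>" and K: "\<Delta> \<in> \<Gamma>K"
  shows "dD (\<lambda>\<Delta>'. \<eta> (\<sigma> (prK G \<Delta>'))) \<Delta> (sharp G \<beta>) =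
    - sharp G \<beta> (\<eta> (\<sigma> \<Delta>)) - \<eta> (TF_part (bracket (\<sigma> \<Delta>) (\<sigma> (sharp G \<beta>))))"
proof -
  note S = sharp[OF \<beta>] and D = GK_D[OF K]
  have \<eta>0: "\<eta> 0 = 0"
    using \<eta> unfolding Omega1_def by (rule bundle_hom_0) (rule secs_TF(1))
  have 1: "\<sigma> (prK G (sharp G \<beta>)) = 0"
    unfolding prK(2)[OF S(1)] by (rule TF_part_G[OF secs_HD(2)[OF S(2)]])
  have 2: "\<sigma> (prK G \<Delta>) = \<sigma> \<Delta>"
    unfolding prK(2)[OF D(1)] by (rule TF_part_eqI[OF D(2)]) (simp add: secs_G(1))
  show ?thesis
    unfolding dD_def 1 2 prK(2)[OF GD_comm(1)[OF D(1) S(1)]] GD_comm(2)[OF D(1) S(1)] \<eta>0 GD_0[OF D(1)]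
    by (simp only: diff_0)
qed

end

section \<open>The map on one-forms\<close>

lemma diff_diff_cancel_left: "(a - b) - (a - c) = c - (b :: 'a::ab_group_add)"
  by (simp add: algebra_simps)

context complemented_manifold
begin

section \<open>Homomorphisms from NF to \<ell>, and separation of \<open>\<Gamma>NF\<close> by
  them\<close>

lemma GNF_hom_construct:
  assumes range: "\<And>Y. Y \<in> vfields \<Longrightarrow> F Y \<in> \<Gamma>L"
    and add: "\<And>Y Y'. Y \<in> vfields \<Longrightarrow> Y' \<in> vfields \<Longrightarrow> F (Y + Y') = F Y + F Y'"
    and ker: "\<And>Y. Y \<in> \<Gamma>TF \<Longrightarrow> F Y = 0"
    and scale: "\<And>f Y. f \<in> Cinf \<Longrightarrow> Y \<in> vfields \<Longrightarrow> F (f \<cdot> Y) = f \<cdot> F Y"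
  shows "\<exists>\<beta>\<in>bundle_hom \<Gamma>NF \<Gamma>L. \<forall>Y\<in>vfields. \<beta> (cls TF Y) = F Y"
proof -
  obtain \<beta> where \<beta>: "\<And>Y. Y \<in> vfields \<Longrightarrow> \<beta> (cls TF Y) = F Y" "\<And>s. s \<notin> \<Gamma>NF \<Longrightarrow> \<beta> s = 0"
    using cls_lift[of TF F, OF subspace_TF add ker] by blast
  have "\<beta> s \<in> \<Gamma>L" if "s \<in> \<Gamma>NF" for s
    using that by (elim qsecsE) (simp only: \<beta>(1) range)
  moreover have "\<beta> (s + t) = \<beta> s + \<beta> t" if "s \<in> \<Gamma>NF" "t \<in> \<Gamma>NF" for s t
  proof -
    obtain Y Y' where Y: "Y \<in> vfields" "s = cls TF Y" "Y' \<in> vfields" "t = cls TF Y'"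
      using \<open>s \<in> \<Gamma>NF\<close> \<open>t \<in> \<Gamma>NF\<close> by (elim qsecsE)
    show ?thesis
      unfolding Y(2,4) cls_add[symmetric] \<beta>(1)[OF Y(1)] \<beta>(1)[OF Y(3)] \<beta>(1)[OF vfields_add[OF Y(1,3)]]
      by (rule add[OF Y(1,3)])
  qed
  moreover have "\<beta> (f \<cdot> s) = f \<cdot> \<beta> s" if f: "f \<in> Cinf" and "s \<in> \<Gamma>NF" for f s
  proof -
    obtain Y where Y: "Y \<in> vfields" "s = cls TF Y"
      using \<open>s \<in> \<Gamma>NF\<close> by (elim qsecsE)
    show ?thesis
      unfolding Y(2) cls_fscale[symmetric] \<beta>(1)[OF Y(1)] \<beta>(1)[OF vfields_fscale[OF f Y(1)]]
      by (rule scale[OF f Y(1)])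
  qed
  ultimately have "\<beta> \<in> bundle_hom \<Gamma>NF \<Gamma>L"
    unfolding bundle_hom_def using \<beta>(2) by blast
  then show ?thesis using \<beta>(1) by blast
qed

lemma theta_bar: "\<exists>\<beta>\<in>bundle_hom \<Gamma>NF \<Gamma>L. \<forall>Y\<in>vfields. \<beta> (cls TF Y) = \<theta> Y"
  by (rule GNF_hom_construct) (simp_all only: cls_GL cls_add cls_fscale theta_eq_0 GTF_secs_xi)

lemma bundle_hom_qsecs_diff:
  assumes "h \<in> bundle_hom (qsecs W) N" "s \<in> qsecs W" "t \<in> qsecs W"
  shows "h (s - t) = h s - h t"
  using bundle_homD(3)[OF assms(1,2) qsecs_uminus[OF assms(3)]] bundle_hom_uminus[OF assms(1,3)]
  by (simp only: diff_conv_add_uminus)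

text \<open>For a derivation \<open>\<Delta>\<close> with symbol in \<open>\<xi>\<close>, the difference of \<open>\<Delta>\<close> and the Lie derivative along its
  symbol is a section of \<open>N\<^sup>*F \<otimes> \<ell>\<close>; on \<open>\<xi>\<close> these sections detect the kernel of \<open>\<omega>\<close>.\<close>

lemma GNF_separated:
  assumes s: "s \<in> \<Gamma>NF" and 0: "\<And>\<beta>. \<beta> \<in> bundle_hom \<Gamma>NF \<Gamma>L \<Longrightarrow> \<beta> s = 0"
  shows "s = 0"
proof -
  obtain Y where Y: "Y \<in> vfields" "s = cls TF Y" using s by (rule qsecsE)
  obtain \<beta> where \<beta>: "\<beta> \<in> bundle_hom \<Gamma>NF \<Gamma>L" "\<forall>Y\<in>vfields. \<beta> (cls TF Y) = \<theta> Y"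
    using theta_bar by blast
  have "\<theta> Y = 0" using 0[OF \<beta>(1)] \<beta>(2) Y by metis
  then have Y\<xi>: "Y \<in> secs \<xi>" using cls_eq_0[of \<xi>, OF subspace_xi Y(1)] by blast
  have "\<omega> Y W p = 0" if W: "W \<in> secs \<xi>" for W p
  proof -
    note w = secs_vfields[OF W]
    \<comment> \<open>A derivation is available with symbol \<open>b \<cdot> W\<close>, not
      \<open>W\<close> itself; since \<open>b p\<close> is nonzero this suffices at
      \<open>p\<close>.\<close>
    obtain b where b: "b \<in> Cinf" "b p \<noteq> 0" "\<forall>Z\<in>vfields. \<exists>\<Delta>\<in>\<Gamma>D. \<sigma> \<Delta> = b \<cdot> Z"
      using GD_local_connection[of p] by blast
    obtain \<Delta> where D: "\<Delta> \<in> \<Gamma>D" "\<sigma> \<Delta> = b \<cdot> W" using b(3) w by blast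
    have bW: "b \<cdot> W \<in> secs \<xi>" by (rule secs_xi(4)[OF b(1) W])
    note bv = secs_vfields[OF bW]
    define F where "F Y = \<Delta> (\<theta> Y) - \<theta> (bracket (b \<cdot> W) Y)" for Y
    have "\<exists>\<beta>\<in>bundle_hom \<Gamma>NF \<Gamma>L. \<forall>Y\<in>vfields. \<beta> (cls TF Y) = F Y"
    proof (rule GNF_hom_construct)
      show "F Y \<in> \<Gamma>L" if "Y \<in> vfields" for Y
        unfolding F_def by (intro qsecs_diff GD_range[OF D(1)] cls_GL bracket_vfields bv that)
      show "F (Y + Y') = F Y + F Y'" if "Y \<in> vfields" "Y' \<in> vfields" for Y Y'
        unfolding F_def cls_add GD_add[OF D(1) cls_GL[OF that(1)] cls_GL[OF that(2)]]
          bracket_add_right[OF bv that] by (rule add_diff_add)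
      show "F Y = 0" if "Y \<in> \<Gamma>TF" for Y
      proof -
        have "bracket (b \<cdot> W) Y \<in> secs \<xi>"
          unfolding bracket_swap[of _ Y] by (intro secs_xi(5) bracket_GTF_xi that bW)
        then have "\<theta> (bracket (b \<cdot> W) Y) = 0" by (rule theta_eq_0)
        then show ?thesis
          unfolding F_def theta_eq_0[OF GTF_secs_xi[OF that]] GD_0[OF D(1)] by (simp only: diff_self)
      qed
      show "F (f \<cdot> Y) = f \<cdot> F Y" if "f \<in> Cinf" "Y \<in> vfields" for f Y
        unfolding F_def cls_fscale GD_Leibniz[OF D(1) that(1) cls_GL[OF that(2)]]
          bracket_fscale_right[OF bv that(2,1)] cls_add D(2)
        by (intro ext) (simp add: algebra_simps)
    qed
    then obtain \<gamma> where \<gamma>: "\<gamma> \<in> bundle_hom \<Gamma>NF \<Gamma>L" "\<forall>Y\<in>vfields. \<gamma> (cls TF Y) = F Y" by blast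
    \<comment> \<open>As \<open>\<theta> Y\<close> is zero, \<open>F Y\<close> reduces to
      \<open>- \<omega> (b \<cdot> W) Y\<close>.\<close>
    have "F Y = 0" using 0[OF \<gamma>(1)] \<gamma>(2) Y by metis
    then have "\<omega> (b \<cdot> W) Y = 0"
      unfolding F_def theta_eq_0[OF Y\<xi>] GD_0[OF D(1)] \<omega>_def by (simp only: diff_0 neg_equal_0_iff_equal)
    then have "b \<cdot> \<omega> W Y = 0"
      unfolding omega_fscale_left[OF W Y(1) b(1)] .
    then have "b p *\<^sub>R \<omega> W Y p = 0"
      by (metis fscale_apply zero_fun_apply)
    then have "\<omega> W Y p = 0" using b(2) by (simp only: scaleR_eq_0_iff simp_thms)
    then show ?thesis by (subst omega_swap) (simp only: uminus_apply minus_zero)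
  qed
  then have "Y \<in> \<Gamma>TF"
    unfolding GTF_iff[OF Y\<xi>] by (intro ballI ext) (simp only: zero_fun_apply)
  then show ?thesis
    using cls_eq_0[of TF, OF subspace_TF Y(1)] Y(2) by blast
qed

lemma GNF_eqI:
  assumes "s \<in> \<Gamma>NF" "t \<in> \<Gamma>NF" and eq: "\<And>\<beta>. \<beta> \<in> bundle_hom \<Gamma>NF \<Gamma>L \<Longrightarrow> \<beta> s = \<beta> t"
  shows "s = t"
proof -
  have "s - t = 0"
  proof (rule GNF_separated)
    show "s - t \<in> \<Gamma>NF" by (rule qsecs_diff[OF assms(1,2)])
    show "\<beta> (s - t) = 0" if "\<beta> \<in> bundle_hom \<Gamma>NF \<Gamma>L" for \<beta>
      unfolding bundle_hom_qsecs_diff[OF that assms(1,2)] eq[OF that] by (rule diff_self)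
  qed
  then show ?thesis by (simp only: right_minus_eq)
qed

section \<open>The image under \<open>\<Phi> G\<close> of a fixed one-form\<close>

context
  fixes \<eta> :: "'c vfield \<Rightarrow> 'c qsec"
  assumes \<eta>: "\<eta> \<in> Omega1 \<xi>"
begin

lemma eta_hom:
  "X \<in> \<Gamma>TF \<Longrightarrow> \<eta> X \<in> \<Gamma>L" "X \<in> \<Gamma>TF \<Longrightarrow> Y \<in> \<Gamma>TF \<Longrightarrow> \<eta> (X + Y) = \<eta> X + \<eta> Y"
  "f \<in> Cinf \<Longrightarrow> X \<in> \<Gamma>TF \<Longrightarrow> \<eta> (f \<cdot> X) = f \<cdot> \<eta> X"
  using bundle_homD[OF \<eta>[unfolded Omega1_def]] by blast+

text \<open>The prescribed value of \<open>\<beta>\<close> on the image of \<open>X\<close>,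
  rewritten by \<open>Phi_integrand\<close> in terms of the symbol \<open>X\<close> instead of the
  derivation.\<close>

definition contraction :: "('c qsec \<Rightarrow> 'c qsec) \<Rightarrow> 'c vfield \<Rightarrow> 'c qsec" where
  "contraction \<beta> X = - sharp G \<beta> (\<eta> X) - \<eta> (TF_part (bracket X (\<sigma> (sharp G \<beta>))))"

lemma contraction_add:
  assumes \<beta>: "\<beta> \<in> bundle_hom \<Gamma>NF \<Gamma>L" and X: "X \<in> \<Gamma>TF" "Y \<in> \<Gamma>TF"
  shows "contraction \<beta> (X + Y) = contraction \<beta> X + contraction \<beta> Y"
proof -
  note v = secs_vfields[OF X(1)] secs_vfields[OF X(2)] secs_vfields[OF sharp(2)[OF \<beta>]]
  show ?thesis
    unfolding contraction_def bracket_add_left[OF v(3,1,2)] eta_hom(2)[OF X]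
      TF_part_add[OF bracket_vfields[OF v(1,3)] bracket_vfields[OF v(2,3)]]
      GD_add[OF sharp(1)[OF \<beta>] eta_hom(1)[OF X(1)] eta_hom(1)[OF X(2)]]
      eta_hom(2)[OF TF_part(1)[OF bracket_vfields[OF v(1,3)]] TF_part(1)[OF bracket_vfields[OF v(2,3)]]]
    by (intro ext) simp
qed

text \<open>Two derivative terms cancel: with \<open>Z\<close> the symbol of
  \<open>sharp G \<beta>\<close>, the Leibniz rule of the first summand contributes minus the
  derivative of \<open>f\<close> along \<open>Z\<close> times \<open>\<eta> X\<close>, and the
  bracket in the second contributes the opposite.\<close>

lemma contraction_fscale:
  assumes \<beta>: "\<beta> \<in> bundle_hom \<Gamma>NF \<Gamma>L" and f: "f \<in> Cinf" and X: "X \<in> \<Gamma>TF"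
  shows "contraction \<beta> (f \<cdot> X) = f \<cdot> contraction \<beta> X"
proof -
  define Z where "Z = \<sigma> (sharp G \<beta>)"
  note v = secs_vfields[OF X] secs_vfields[OF sharp(2)[OF \<beta>], folded Z_def]
  define k where "k p = - Z p f" for p
  have k: "k \<in> Cinf" unfolding k_def[abs_def] by (intro Cinf_uminus vfields_Cinf v)
  note XZ = bracket_vfields[OF v]
  have br: "bracket (f \<cdot> X) Z = f \<cdot> bracket X Z + k \<cdot> X"
    unfolding bracket_fscale_left[OF v(2,1) f] k_def by (intro ext) simp
  have tX: "TF_part X = X"
    by (rule TF_part_eqI[OF X]) (simp only: diff_self secs_G(1))
  show ?thesis
    unfolding contraction_def Z_def[symmetric] br eta_hom(3)[OF f X]
      TF_part_add[OF vfields_fscale[OF f XZ] vfields_fscale[OF k v(1)]]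
      TF_part_fscale[OF XZ f] TF_part_fscale[OF v(1) k] tX
      eta_hom(2)[OF secs_TF(4)[OF f TF_part(1)[OF XZ]] secs_TF(4)[OF k X]]
      eta_hom(3)[OF f TF_part(1)[OF XZ]] eta_hom(3)[OF k X]
      GD_Leibniz[OF sharp(1)[OF \<beta>] f eta_hom(1)[OF X]]
    by (intro ext) (simp add: k_def algebra_simps)
qed

text \<open>The dependence on \<open>\<beta>\<close> has to become evaluation at one section. With
  \<open>\<eta> X = \<theta> Y\<close>, the action of \<open>sharp G \<beta>\<close> on it is
  \<open>\<beta>\<close> of the class of \<open>Y\<close> plus a term in the symbol
  \<open>Z\<close>; all terms in \<open>Z\<close> together are linear over \<open>Cinf\<close> on
  \<open>H\<close>, and duality represents them by a field \<open>V\<close>.\<close>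

lemma contraction_represented:
  assumes X: "X \<in> \<Gamma>TF"
  shows "\<exists>s\<in>\<Gamma>NF. \<forall>\<beta>\<in>bundle_hom \<Gamma>NF \<Gamma>L. \<beta> s = contraction \<beta> X"
proof -
  note v = secs_vfields[OF X]
  obtain Y0 where Y0: "Y0 \<in> vfields" "\<eta> X = \<theta> Y0"
    using eta_hom(1)[OF X] by (rule qsecsE)
  define Y where "Y = Y0 - TF_part Y0"
  have Y: "Y \<in> secs G" unfolding Y_def by (rule TF_part(2)[OF Y0(1)])
  note y = secs_vfields[OF Y]
  have \<eta>Y: "\<eta> X = \<theta> Y"
    unfolding Y_def cls_diff theta_eq_0[OF GTF_secs_xi[OF TF_part(1)[OF Y0(1)]]] Y0(2) by (simp only: diff_0_right)
  \<comment> \<open>Each summand satisfies \<open>f\<close>-linearity on \<open>H\<close>: the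
    derivative of \<open>f\<close> multiplies \<open>\<theta> Z\<close> in the first, and in the
    second the part of \<open>Z\<close> in \<open>TF\<close>; both are zero.\<close>
  define \<mu> where "\<mu> Z = \<theta> (bracket Z Y) + \<eta> (TF_part (bracket X Z))" for Z
  have m1: "\<mu> Z \<in> \<Gamma>L" if "Z \<in> secs H" for Z
    unfolding \<mu>_def
    by (intro qsecs_add cls_GL eta_hom(1) TF_part(1) bracket_vfields y v secs_vfields[OF that])
  have m2: "\<mu> (Z + Z') = \<mu> Z + \<mu> Z'" if "Z \<in> secs H" "Z' \<in> secs H" for Z Z'
  proof -
    note z = secs_vfields[OF that(1)] secs_vfields[OF that(2)]
    note b = bracket_vfields[OF v z(1)] bracket_vfields[OF v z(2)]
    show ?thesis
      unfolding \<mu>_def bracket_add_left[OF y z] bracket_add_right[OF v z] cls_add TF_part_add[OF b]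
        eta_hom(2)[OF TF_part(1)[OF b(1)] TF_part(1)[OF b(2)]]
      by (simp only: add_ac)
  qed
  have m3: "\<mu> (f \<cdot> Z) = f \<cdot> \<mu> Z" if "f \<in> Cinf" "Z \<in> secs H" for f Z
  proof -
    note z = secs_vfields[OF that(2)]
    note b = bracket_vfields[OF v z]
    have k: "(\<lambda>p. X p f) \<in> Cinf" by (rule vfields_Cinf[OF v])
    have t: "TF_part (bracket X (f \<cdot> Z)) = f \<cdot> TF_part (bracket X Z)"
      unfolding bracket_fscale_right[OF v z that(1)]
        TF_part_add[OF vfields_fscale[OF that(1) b] vfields_fscale[OF k z]]
        TF_part_fscale[OF b that(1)] TF_part_fscale[OF z k] TF_part_G[OF secs_HD(2)[OF that(2)]]
      by (intro ext) simp
    show ?thesis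
      unfolding \<mu>_def t bracket_fscale_left[OF y z that(1)] cls_diff cls_fscale
        theta_eq_0[OF secs_HD(1)[OF that(2)]] eta_hom(3)[OF that(1) TF_part(1)[OF b]]
      by (intro ext) (simp add: algebra_simps)
  qed
  obtain V where V: "V \<in> secs H" "\<And>Z. Z \<in> secs H \<Longrightarrow> \<omega> V Z = \<mu> Z"
    using omega_H_duality[of \<mu>, OF m1 m2 m3] by blast
  note w = secs_vfields[OF V(1)]
  define s where "s = - cls TF Y - cls TF V"
  have s: "s \<in> \<Gamma>NF" unfolding s_def by (intro qsecs_diff qsecs_uminus cls_qsecs y w)
  have "\<beta> s = contraction \<beta> X" if \<beta>: "\<beta> \<in> bundle_hom \<Gamma>NF \<Gamma>L" for \<beta>
  proof -
    note S = sharp[OF \<beta>]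
    define Z where "Z = \<sigma> (sharp G \<beta>)"
    have "\<beta> s = - \<beta> (cls TF Y) - \<beta> (cls TF V)"
      unfolding s_def bundle_hom_qsecs_diff[OF \<beta> qsecs_uminus[OF cls_qsecs[OF y]] cls_qsecs[OF w]]
        bundle_hom_uminus[OF \<beta> cls_qsecs[OF y]] ..
    moreover have "\<beta> (cls TF Y) = sharp G \<beta> (\<eta> X) - \<theta> (bracket Z Y)"
      unfolding \<eta>Y S(3)[OF y] Z_def by (simp only: add_diff_cancel_left')
    \<comment> \<open>As \<open>\<theta> V\<close> is zero, the formula for
      \<open>sharp G \<beta>\<close> on it expresses \<open>\<beta>\<close> of the class of
      \<open>V\<close> through \<open>\<omega>\<close> alone.\<close>
    moreover have "\<beta> (cls TF V) = \<mu> Z"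
    proof -
      have "\<theta> (bracket Z V) + \<beta> (cls TF V) = 0"
        using S(3)[OF w] unfolding theta_eq_0[OF secs_HD(1)[OF V(1)]] GD_0[OF S(1)] Z_def by (rule sym)
      then have "\<beta> (cls TF V) = - \<omega> Z V"
        unfolding \<omega>_def by (simp only: eq_neg_iff_add_eq_0 add.commute)
      then show ?thesis
        using V(2)[OF S(2)] omega_swap[of V Z] unfolding Z_def by (simp only:)
    qed
    ultimately show ?thesis
      unfolding contraction_def \<mu>_def Z_def[symmetric] by (intro ext) simp
  qed
  then show ?thesis using s by blast
qed

lemma Phi_spec:
  "\<Phi> G \<eta> \<in> Omega1 TF"
  "\<And>\<beta> X. \<beta> \<in> bundle_hom \<Gamma>NF \<Gamma>L \<Longrightarrow> X \<in> \<Gamma>TF \<Longrightarrow> \<beta> (\<Phi> G \<eta> X) = contraction \<beta> X"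
proof -
  have integrand: "dD (\<lambda>\<Delta>'. \<eta> (\<sigma> (prK G \<Delta>'))) \<Delta> (sharp G \<beta>) = contraction \<beta> (\<sigma> \<Delta>)"
    if "\<beta> \<in> bundle_hom \<Gamma>NF \<Gamma>L" "\<Delta> \<in> \<Gamma>K" for \<beta> \<Delta>
    unfolding contraction_def by (rule Phi_integrand[OF that(1) \<eta> that(2)])
  define P where "P \<phi> \<longleftrightarrow> \<phi> \<in> Omega1 TF \<and> (\<forall>\<beta>\<in>bundle_hom \<Gamma>NF \<Gamma>L. \<forall>\<Delta>\<in>\<Gamma>K.
      \<beta> (\<phi> (\<sigma> \<Delta>)) = dD (\<lambda>\<Delta>'. \<eta> (\<sigma> (prK G \<Delta>'))) \<Delta> (sharp G \<beta>))" for \<phi>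
  \<comment> \<open>The symbol maps \<open>\<Gamma>K\<close> onto \<open>\<Gamma>TF\<close>, and the
    integrand depends on \<open>\<Delta>\<close> through its symbol, so the condition can be read on
    \<open>X \<in> \<Gamma>TF\<close>.\<close>
  have P_iff: "P \<phi> \<longleftrightarrow> \<phi> \<in> Omega1 TF \<and>
      (\<forall>\<beta>\<in>bundle_hom \<Gamma>NF \<Gamma>L. \<forall>X\<in>\<Gamma>TF. \<beta> (\<phi> X) = contraction \<beta> X)" for \<phi>
  proof -
    have "(\<forall>\<Delta>\<in>\<Gamma>K. \<beta> (\<phi> (\<sigma> \<Delta>)) = dD (\<lambda>\<Delta>'. \<eta> (\<sigma> (prK G \<Delta>'))) \<Delta> (sharp G \<beta>)) \<longleftrightarrow>
        (\<forall>X\<in>\<Gamma>TF. \<beta> (\<phi> X) = contraction \<beta> X)" if "\<beta> \<in> bundle_hom \<Gamma>NF \<Gamma>L" for \<beta>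
    proof
      assume L: "\<forall>\<Delta>\<in>\<Gamma>K. \<beta> (\<phi> (\<sigma> \<Delta>)) = dD (\<lambda>\<Delta>'. \<eta> (\<sigma> (prK G \<Delta>'))) \<Delta> (sharp G \<beta>)"
      show "\<forall>X\<in>\<Gamma>TF. \<beta> (\<phi> X) = contraction \<beta> X"
      proof
        fix X assume "X \<in> \<Gamma>TF"
        then obtain \<Delta> where D: "\<Delta> \<in> \<Gamma>K" "\<sigma> \<Delta> = X" by (rule GK_exists)
        have "\<beta> (\<phi> (\<sigma> \<Delta>)) = contraction \<beta> (\<sigma> \<Delta>)"
          using L D(1) integrand[OF \<open>\<beta> \<in> bundle_hom \<Gamma>NF \<Gamma>L\<close> D(1)] by (simp only:)
        then show "\<beta> (\<phi> X) = contraction \<beta> X" unfolding D(2) .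
      qed
    next
      assume R: "\<forall>X\<in>\<Gamma>TF. \<beta> (\<phi> X) = contraction \<beta> X"
      show "\<forall>\<Delta>\<in>\<Gamma>K. \<beta> (\<phi> (\<sigma> \<Delta>)) = dD (\<lambda>\<Delta>'. \<eta> (\<sigma> (prK G \<Delta>'))) \<Delta> (sharp G \<beta>)"
      proof
        fix \<Delta> assume D: "\<Delta> \<in> \<Gamma>K"
        show "\<beta> (\<phi> (\<sigma> \<Delta>)) = dD (\<lambda>\<Delta>'. \<eta> (\<sigma> (prK G \<Delta>'))) \<Delta> (sharp G \<beta>)"
          unfolding integrand[OF \<open>\<beta> \<in> bundle_hom \<Gamma>NF \<Gamma>L\<close> D] using R GK_D(2)[OF D] by blast
      qed
    qed
    then show ?thesis unfolding P_def by blast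
  qed
  have uniq: "\<phi> = \<phi>'" if "P \<phi>" "P \<phi>'" for \<phi> \<phi>'
  proof
    fix X
    have \<phi>: "\<phi> \<in> bundle_hom \<Gamma>TF \<Gamma>NF" "\<phi>' \<in> bundle_hom \<Gamma>TF \<Gamma>NF"
      using that unfolding P_iff Omega1_def by blast+
    show "\<phi> X = \<phi>' X"
    proof (cases "X \<in> \<Gamma>TF")
      case True
      show ?thesis
      proof (rule GNF_eqI)
        show "\<phi> X \<in> \<Gamma>NF" "\<phi>' X \<in> \<Gamma>NF"
          using bundle_homD(1)[OF \<phi>(1) True] bundle_homD(1)[OF \<phi>(2) True] by blast+
        fix \<beta> assume \<beta>: "\<beta> \<in> bundle_hom \<Gamma>NF \<Gamma>L"
        have "\<beta> (\<phi> X) = contraction \<beta> X" "\<beta> (\<phi>' X) = contraction \<beta> X"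
          using that \<beta> True unfolding P_iff by blast+
        then show "\<beta> (\<phi> X) = \<beta> (\<phi>' X)" by (simp only:)
      qed
    next
      case False
      show ?thesis unfolding bundle_homD(2)[OF \<phi>(1) False] bundle_homD(2)[OF \<phi>(2) False] ..
    qed
  qed
  \<comment> \<open>Values are chosen separately for each \<open>X\<close>. Linearity over
    \<open>Cinf\<close> is then inherited from \<open>contraction\<close>, because the pairings
    separate \<open>\<Gamma>NF\<close>.\<close>
  have "\<exists>\<phi>. \<forall>X. (X \<in> \<Gamma>TF \<longrightarrow> \<phi> X \<in> \<Gamma>NF \<and> (\<forall>\<beta>\<in>bundle_hom \<Gamma>NF \<Gamma>L. \<beta> (\<phi> X) = contraction \<beta> X)) \<and>
      (X \<notin> \<Gamma>TF \<longrightarrow> \<phi> X = 0)"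
    by (rule choice) (use contraction_represented in blast)
  then obtain \<phi> where \<phi>: "\<And>X. X \<in> \<Gamma>TF \<Longrightarrow> \<phi> X \<in> \<Gamma>NF"
      "\<And>X \<beta>. X \<in> \<Gamma>TF \<Longrightarrow> \<beta> \<in> bundle_hom \<Gamma>NF \<Gamma>L \<Longrightarrow> \<beta> (\<phi> X) = contraction \<beta> X"
      "\<And>X. X \<notin> \<Gamma>TF \<Longrightarrow> \<phi> X = 0"
    by blast
  have "\<phi> (X + Y) = \<phi> X + \<phi> Y" if "X \<in> \<Gamma>TF" "Y \<in> \<Gamma>TF" for X Y
  proof (rule GNF_eqI)
    have XY: "X + Y \<in> \<Gamma>TF" by (rule secs_TF(2)[OF that])
    show "\<phi> (X + Y) \<in> \<Gamma>NF" by (rule \<phi>(1)[OF XY])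
    show "\<phi> X + \<phi> Y \<in> \<Gamma>NF" by (intro qsecs_add \<phi>(1) that)
    fix \<beta> assume \<beta>: "\<beta> \<in> bundle_hom \<Gamma>NF \<Gamma>L"
    show "\<beta> (\<phi> (X + Y)) = \<beta> (\<phi> X + \<phi> Y)"
      unfolding bundle_homD(3)[OF \<beta> \<phi>(1)[OF that(1)] \<phi>(1)[OF that(2)]] \<phi>(2)[OF XY \<beta>]
        \<phi>(2)[OF that(1) \<beta>] \<phi>(2)[OF that(2) \<beta>] by (rule contraction_add[OF \<beta> that])
  qed
  moreover have "\<phi> (f \<cdot> X) = f \<cdot> \<phi> X" if "f \<in> Cinf" "X \<in> \<Gamma>TF" for f X
  proof (rule GNF_eqI)
    have fX: "f \<cdot> X \<in> \<Gamma>TF" by (rule secs_TF(4)[OF that])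
    show "\<phi> (f \<cdot> X) \<in> \<Gamma>NF" by (rule \<phi>(1)[OF fX])
    show "f \<cdot> \<phi> X \<in> \<Gamma>NF" by (intro qsecs_fscale \<phi>(1) that)
    fix \<beta> assume \<beta>: "\<beta> \<in> bundle_hom \<Gamma>NF \<Gamma>L"
    show "\<beta> (\<phi> (f \<cdot> X)) = \<beta> (f \<cdot> \<phi> X)"
      unfolding bundle_homD(4)[OF \<beta> that(1) \<phi>(1)[OF that(2)]] \<phi>(2)[OF fX \<beta>] \<phi>(2)[OF that(2) \<beta>]
      by (rule contraction_fscale[OF \<beta> that])
  qed
  ultimately have "\<phi> \<in> Omega1 TF"
    unfolding Omega1_def bundle_hom_def using \<phi>(1,3) by blast
  then have "P \<phi>"
    unfolding P_iff using \<phi>(2) by blast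
  moreover have "\<Phi> G \<eta> = (THE \<phi>. P \<phi>)"
    unfolding \<Phi>_def P_def ..
  ultimately have "P (\<Phi> G \<eta>)"
    using uniq theI[of P \<phi>] by metis
  then show "\<Phi> G \<eta> \<in> Omega1 TF"
    "\<And>\<beta> X. \<beta> \<in> bundle_hom \<Gamma>NF \<Gamma>L \<Longrightarrow> X \<in> \<Gamma>TF \<Longrightarrow> \<beta> (\<Phi> G \<eta> X) = contraction \<beta> X"
    unfolding P_iff by blast+
qed

lemma theta_bar_Phi:
  assumes \<beta>: "\<beta> \<in> bundle_hom \<Gamma>NF \<Gamma>L" "\<forall>Y\<in>vfields. \<beta> (cls TF Y) = \<theta> Y" and X: "X \<in> \<Gamma>TF"
  shows "\<beta> (\<Phi> G \<eta> X) = - \<eta> X"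
proof -
  note S = sharp[OF \<beta>(1)]
  define Z where "Z = \<sigma> (sharp G \<beta>)"
  have ZH: "Z \<in> secs H" unfolding Z_def by (rule S(2))
  \<comment> \<open>For \<open>Y\<close> in \<open>H\<close> both \<open>\<theta> Y\<close> and its
    image under \<open>\<beta>\<close> vanish, so the formula for \<open>sharp G \<beta>\<close>
    leaves \<open>\<omega> Z Y = 0\<close>.\<close>
  have Z0: "Z = 0"
  proof
    fix p
    have "Z p = 0"
    proof (rule H_nondegenerate_at[OF ZH])
      fix Y assume Y: "Y \<in> secs H"
      note y = secs_vfields[OF Y]
      have "0 = \<theta> (bracket Z Y) + 0"
        using S(3)[OF y] bspec[OF \<beta>(2) y] unfolding theta_eq_0[OF secs_HD(1)[OF Y]] GD_0[OF S(1)] Z_def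
        by (simp only:)
      then show "\<omega> Z Y p = 0" unfolding \<omega>_def by (metis add_0_right zero_fun_apply)
    qed
    then show "Z p = 0 p" by (simp only: zero_fun_apply)
  qed
  obtain Y where Y: "Y \<in> vfields" "\<eta> X = \<theta> Y"
    using eta_hom(1)[OF X] by (rule qsecsE)
  have "sharp G \<beta> (\<eta> X) = \<eta> X"
    unfolding Y(2) S(3)[OF Y(1)] Z_def[symmetric] Z0 bracket_0_left[OF Y(1)] cls_0 bspec[OF \<beta>(2) Y(1)]
    by (rule add_0_left)
  moreover have "\<eta> (TF_part (bracket X Z)) = 0"
    unfolding Z0 bracket_0_right[OF secs_vfields[OF X]] TF_part_G[OF secs_G(1)]
    using \<eta> unfolding Omega1_def by (rule bundle_hom_0) (rule secs_TF(1))
  ultimately show ?thesis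
    unfolding Phi_spec(2)[OF \<beta>(1) X] contraction_def Z_def[symmetric] by (simp only: diff_0_right)
qed

end

section \<open>Injectivity in cohomology\<close>

lemma d0_xi: "Y \<in> vfields \<Longrightarrow> X \<in> \<Gamma>TF \<Longrightarrow> d0 \<xi> (\<theta> Y) X = \<theta> (bracket X Y)"
  unfolding d0_def by (simp only: nabla_xi if_True)

lemma d0_TF: "Y \<in> vfields \<Longrightarrow> X \<in> \<Gamma>TF \<Longrightarrow> d0 TF (cls TF Y) X = cls TF (bracket X Y)"
  unfolding d0_def by (simp only: nabla_TF if_True)

lemma d0_outside: "X \<notin> \<Gamma>TF \<Longrightarrow> d0 W s X = 0"
  unfolding d0_def by (simp only: if_False)

text \<open>The hypothesis is the common shape of \<open>d0_xi\<close> and \<open>d0_TF\<close>, so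
  one proof serves both bundles.\<close>

lemma zero_B1:
  assumes W: "\<And>X Y. Y \<in> vfields \<Longrightarrow> X \<in> \<Gamma>TF \<Longrightarrow> d0 W (cls W Y) X = cls W (bracket X Y)"
  shows "0 \<in> B1 W"
proof -
  have "d0 W (cls W 0) = 0"
  proof
    fix X
    show "d0 W (cls W 0) X = 0 X"
    proof (cases "X \<in> \<Gamma>TF")
      case True
      show ?thesis
        unfolding W[OF vfields_0 True] bracket_0_right[OF secs_vfields[OF True]] by (simp only: cls_0 zero_fun_apply)
    next
      case False
      show ?thesis unfolding d0_outside[OF False] by (simp only: zero_fun_apply)
    qed
  qed
  then show ?thesis unfolding B1_def using cls_qsecs[OF vfields_0, of W] by (metis imageI)
qed

lemma B1_diff:
  assumes "a \<in> B1 \<xi>" "b \<in> B1 \<xi>"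
  shows "a - b \<in> B1 \<xi>"
proof -
  obtain Y Y' where Y: "Y \<in> vfields" "a = d0 \<xi> (\<theta> Y)" "Y' \<in> vfields" "b = d0 \<xi> (\<theta> Y')"
    using assms unfolding B1_def by (elim imageE qsecsE) blast
  have "a - b = d0 \<xi> (\<theta> (Y - Y'))"
  proof
    fix X
    have ab: "(a - b) X = a X - b X" by (rule minus_apply)
    show "(a - b) X = d0 \<xi> (\<theta> (Y - Y')) X"
    proof (cases "X \<in> \<Gamma>TF")
      case True
      show ?thesis
        unfolding ab
        unfolding Y(2,4) d0_xi[OF Y(1) True] d0_xi[OF Y(3) True] d0_xi[OF vfields_diff[OF Y(1,3)] True]
        unfolding bracket_diff_right[OF secs_vfields[OF True] Y(1,3)] cls_diff ..
    next
      case False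
      show ?thesis
        unfolding ab
        unfolding Y(2,4) d0_outside[OF False] by (rule diff_self)
    qed
  qed
  then show ?thesis
    unfolding B1_def using cls_qsecs[OF vfields_diff[OF Y(1,3)], of \<xi>] by blast
qed

lemma B1_Omega1:
  assumes "a \<in> B1 \<xi>"
  shows "a \<in> Omega1 \<xi>"
proof -
  obtain Y where Y: "Y \<in> vfields" "a = d0 \<xi> (\<theta> Y)"
    using assms unfolding B1_def by (elim imageE qsecsE) blast
  have e: "a X = \<theta> (bracket X Y)" if "X \<in> \<Gamma>TF" for X
    unfolding Y(2) by (rule d0_xi[OF Y(1) that])
  have "a X \<in> \<Gamma>L" if "X \<in> \<Gamma>TF" for X
    unfolding e[OF that] by (intro cls_GL bracket_vfields Y secs_vfields[OF that])
  moreover have "a (X + X') = a X + a X'" if "X \<in> \<Gamma>TF" "X' \<in> \<Gamma>TF" for X X'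
    unfolding e[OF that(1)] e[OF that(2)] e[OF secs_TF(2)[OF that]]
      bracket_add_left[OF Y(1) secs_vfields[OF that(1)] secs_vfields[OF that(2)]] cls_add ..
  moreover have "a (f \<cdot> X) = f \<cdot> a X" if "f \<in> Cinf" "X \<in> \<Gamma>TF" for f X
    unfolding e[OF that(2)] e[OF secs_TF(4)[OF that]]
    using omega_fscale_left[OF GTF_secs_xi[OF that(2)] Y(1) that(1)] unfolding \<omega>_def .
  ultimately show ?thesis
    unfolding Omega1_def bundle_hom_def using d0_outside Y(2) by blast
qed

lemma Omega1_add:
  assumes a: "a \<in> Omega1 \<xi>" and b: "b \<in> Omega1 \<xi>"
  shows "a + b \<in> Omega1 \<xi>"
proof -
  note h = bundle_homD[OF a[unfolded Omega1_def]] bundle_homD[OF b[unfolded Omega1_def]]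
  have c: "(a + b) X = a X + b X" for X by (rule plus_fun_apply)
  have "(a + b) X \<in> \<Gamma>L" if "X \<in> \<Gamma>TF" for X
    unfolding c by (intro qsecs_add h that)
  moreover have "(a + b) X = 0" if "X \<notin> \<Gamma>TF" for X
    unfolding c h(2)[OF that] h(6)[OF that] by (rule add_0_left)
  moreover have "(a + b) (X + Y) = (a + b) X + (a + b) Y" if "X \<in> \<Gamma>TF" "Y \<in> \<Gamma>TF" for X Y
    unfolding c h(3)[OF that] h(7)[OF that] by (simp only: add_ac)
  moreover have "(a + b) (f \<cdot> X) = f \<cdot> (a + b) X" if "f \<in> Cinf" "X \<in> \<Gamma>TF" for f X
    unfolding c h(4)[OF that] h(8)[OF that] by (rule ext) (simp add: scaleR_add_right)
  ultimately show ?thesis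
    unfolding Omega1_def bundle_hom_def by blast
qed

text \<open>A primitive \<open>cls TF Y\<close> of the difference projects to the primitive
  \<open>\<theta> Y\<close>. As the composite is minus the identity, the two forms change
  places.\<close>

lemma Phi_cohomologous_imp:
  assumes \<eta>: "\<eta> \<in> Omega1 \<xi>" and \<eta>': "\<eta>' \<in> Omega1 \<xi>" and B: "\<Phi> G \<eta> - \<Phi> G \<eta>' \<in> B1 TF"
  shows "\<eta>' - \<eta> \<in> B1 \<xi>"
proof -
  obtain Y where Y: "Y \<in> vfields" "\<Phi> G \<eta> - \<Phi> G \<eta>' = d0 TF (cls TF Y)"
    using B unfolding B1_def by (elim imageE qsecsE) blast
  obtain \<beta> where \<beta>: "\<beta> \<in> bundle_hom \<Gamma>NF \<Gamma>L" "\<forall>Y\<in>vfields. \<beta> (cls TF Y) = \<theta> Y"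
    using theta_bar by blast
  have "\<eta>' - \<eta> = d0 \<xi> (\<theta> Y)"
  proof
    fix X
    have c: "(\<eta>' - \<eta>) X = \<eta>' X - \<eta> X" by (rule minus_apply)
    show "(\<eta>' - \<eta>) X = d0 \<xi> (\<theta> Y) X"
    proof (cases "X \<in> \<Gamma>TF")
      case True
      have P: "\<Phi> G \<eta> X \<in> \<Gamma>NF" "\<Phi> G \<eta>' X \<in> \<Gamma>NF"
        using bundle_homD(1)[OF Phi_spec(1)[OF \<eta>, unfolded Omega1_def] True]
          bundle_homD(1)[OF Phi_spec(1)[OF \<eta>', unfolded Omega1_def] True] by blast+
      have "\<Phi> G \<eta> X - \<Phi> G \<eta>' X = (\<Phi> G \<eta> - \<Phi> G \<eta>') X" by (rule minus_apply[symmetric])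
      also have "\<dots> = cls TF (bracket X Y)"
        unfolding Y(2) by (rule d0_TF[OF Y(1) True])
      finally have "\<beta> (\<Phi> G \<eta> X - \<Phi> G \<eta>' X) = \<beta> (cls TF (bracket X Y))"
        by (rule arg_cong)
      then have "- \<eta> X - - \<eta>' X = \<theta> (bracket X Y)"
        unfolding bundle_hom_qsecs_diff[OF \<beta>(1) P] theta_bar_Phi[OF \<eta> \<beta> True] theta_bar_Phi[OF \<eta>' \<beta> True]
          bspec[OF \<beta>(2) bracket_vfields[OF secs_vfields[OF True] Y(1)]] .
      then show ?thesis
        unfolding c d0_xi[OF Y(1) True] minus_diff_minus minus_diff_eq .
    next
      case False
      show ?thesis
        unfolding c d0_outside[OF False] bundle_homD(2)[OF \<eta>[unfolded Omega1_def] False]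
          bundle_homD(2)[OF \<eta>'[unfolded Omega1_def] False] by (rule diff_self)
    qed
  qed
  then show ?thesis
    unfolding B1_def using cls_qsecs[OF Y(1), of \<xi>] by blast
qed

lemma Phi_cohomology_inj: "inj_on (Phi_cohomology G) H1_line"
proof (rule inj_onI)
  fix c1 c2 assume "c1 \<in> H1_line" "c2 \<in> H1_line" and eq: "Phi_cohomology G c1 = Phi_cohomology G c2"
  then obtain \<eta>1 \<eta>2 where \<eta>: "\<eta>1 \<in> Z1 \<xi>" "c1 = cohomology_class \<xi> \<eta>1" "\<eta>2 \<in> Z1 \<xi>" "c2 = cohomology_class \<xi> \<eta>2"
    unfolding H1_line_def H1_def by blast
  have O: "\<eta>1 \<in> Omega1 \<xi>" "\<eta>2 \<in> Omega1 \<xi>"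
    using \<eta> unfolding Z1_def by blast+
  have "\<eta>1 \<in> c1"
    unfolding \<eta>(2) cohomology_class_def mem_Collect_eq diff_self by (rule zero_B1[OF d0_xi])
  moreover have "\<Phi> G \<eta>1 \<in> cohomology_class TF (\<Phi> G \<eta>1)"
    unfolding cohomology_class_def mem_Collect_eq diff_self by (rule zero_B1[OF d0_TF])
  ultimately have "\<Phi> G \<eta>1 \<in> Phi_cohomology G c1"
    unfolding Phi_cohomology_def
    by (rule UN_I[where a = \<eta>1 and B = "\<lambda>\<eta>. cohomology_class TF (\<Phi> G \<eta>)"])
  then have "\<Phi> G \<eta>1 \<in> Phi_cohomology G c2"
    unfolding eq .
  \<comment> \<open>The union in \<open>Phi_cohomology\<close> yields some member of
    \<open>c2\<close>, a priori just a function differing from \<open>\<eta>2\<close> by an exact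
    form. It is a form itself because exact forms are, so the comparison above applies to
    it.\<close>
  then obtain \<eta>' where \<eta>': "\<eta>' \<in> c2" "\<Phi> G \<eta>1 - \<Phi> G \<eta>' \<in> B1 TF"
    unfolding Phi_cohomology_def cohomology_class_def by (elim UN_E) (simp only: mem_Collect_eq)
  have b: "\<eta>' - \<eta>2 \<in> B1 \<xi>"
    using \<eta>'(1) unfolding \<eta>(4) cohomology_class_def by (rule CollectD)
  have "(\<eta>' - \<eta>2) + \<eta>2 \<in> Omega1 \<xi>"
    by (rule Omega1_add[OF B1_Omega1[OF b] O(2)])
  then have "\<eta>' \<in> Omega1 \<xi>" unfolding diff_add_cancel .
  then have e: "\<eta>' - \<eta>1 \<in> B1 \<xi>"
    by (rule Phi_cohomologous_imp[OF O(1) _ \<eta>'(2)])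
  \<comment> \<open>Both representatives differ from \<open>\<eta>'\<close> by exact forms, hence
    from each other.\<close>
  note d = B1_diff[OF b e, unfolded diff_diff_cancel_left] B1_diff[OF e b, unfolded diff_diff_cancel_left]
  have sub: "x - b \<in> B1 \<xi>" if "x - a \<in> B1 \<xi>" "b - a \<in> B1 \<xi>" for x a b :: "'c vfield \<Rightarrow> 'c qsec"
    using B1_diff[OF that] unfolding diff_diff_eq2 diff_add_cancel .
  show "c1 = c2"
    unfolding \<eta>(2,4) cohomology_class_def
  proof (rule Collect_cong, rule iffI)
    fix x
    show "x - \<eta>2 \<in> B1 \<xi>" if "x - \<eta>1 \<in> B1 \<xi>" by (rule sub[OF that d(2)])
    show "x - \<eta>1 \<in> B1 \<xi>" if "x - \<eta>2 \<in> B1 \<xi>" by (rule sub[OF that d(1)])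
  qed
qed

end

theorem proposition3p1:
  fixes A :: "('c::{t2_space, second_countable_topology}, 'e::euclidean_space) atlas"
    and \<xi> G :: "'c \<Rightarrow> 'c tvec set"
  assumes "precontact_manifold A \<xi>"
    and "hyperplane_manifold.complement A \<xi> G"
  shows "inj_on (hyperplane_manifold.Phi_cohomology A \<xi> G) (hyperplane_manifold.H1_line A \<xi>)"
proof -
  interpret precontact_manifold A \<xi> by fact
  interpret complemented_manifold A \<xi> G
    by unfold_locales (rule assms(2))
  show ?thesis by (rule Phi_cohomology_inj)
qed

end
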